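(* Let $\Omega\subset\mathbb{R}^3$ be open and bounded, let $\Omega'\Subset\Omega$ be open with $C^2$-boundary, let $1\le p<\infty$ and $\boldsymbol F\in\mathscr{CM}^p(\Omega)$. Then $$\mathcal T_{(\boldsymbol F\times\nu)^{\mathrm{int}}_{\Omega'}}(\boldsymbol\varphi)=\mathcal T_{(\boldsymbol F\times\nu)^{\mathrm{int}}_{\Omega'}}(\boldsymbol\varphi_\tau)\qquad\text{for all }\boldsymbol\varphi\in\mathrm{Lip}(\partial\Omega';\mathbb{R}^3),$$ where $\boldsymbol\varphi_\tau$ is the tangential component of $\boldsymbol\varphi$. In particular, $$\mathcal T_{(\boldsymbol F\times\nu)^{\mathrm{int}}_{\Omega'}}(\nabla\varphi)=\mathcal T_{(\boldsymbol F\times\nu)^{\mathrm{int}}_{\Omega'}}(\nabla_\tau\varphi)\qquad\text{for all }\varphi\in C^2(\partial\Omega'),$$ where $\nabla\varphi$ denotes the restriction to $\partial\Omega'$ of the full gradient of a $C^2$-extension of $\varphi$ to $\mathbb{R}^3$. The same identities hold for $\mathcal T_{(\boldsymbol F\times\nu)^{\mathrm{ext}}_{\Omega'}}$.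
   Context: $\mathscr{CM}^p(\Omega)$: fields $\boldsymbol F\in L^p(\Omega;\mathbb{R}^3)$ whose distributional curl is a finite $\mathbb{R}^3$-valued Radon measure on $\Omega$. For $\boldsymbol\varphi\in\mathrm{Lip}(\partial\Omega';\mathbb{R}^3)$ and any $\overline{\boldsymbol\varphi}\in\mathrm{Lip}_c(\Omega;\mathbb{R}^3)$ with $\overline{\boldsymbol\varphi}|_{\partial\Omega'}=\boldsymbol\varphi$, $$\mathcal T_{(\boldsymbol F\times\nu)^{\mathrm{int}}_{\Omega'}}(\boldsymbol\varphi):=\int_{\Omega'}\overline{\boldsymbol\varphi}\cdot d(\operatorname{curl}\boldsymbol F)-\int_{\Omega'}\boldsymbol F\cdot\operatorname{curl}\overline{\boldsymbol\varphi}\,dx,$$ $$\mathcal T_{(\boldsymbol F\times\nu)^{\mathrm{ext}}_{\Omega'}}(\boldsymbol\varphi):=-\int_{\Omega\setminus\overline{\Omega'}}\overline{\boldsymbol\varphi}\cdot d(\operatorname{curl}\boldsymbol F)+\int_{\Omega\setminus\overline{\Omega'}}\boldsymbol F\cdot\operatorname{curl}\overline{\boldsymbol\varphi}\,dx;$$ these are independent of the extension. $\boldsymbol\varphi_\tau:=\boldsymbol\varphi-(\boldsymbol\varphi\cdot\nu_{\partial\Omega'})\nu_{\partial\Omega'}$ with $\nu_{\partial\Omega'}$ the inner unit normal, and $\nabla_\tau$ is the tangential gradient on $\partial\Omega'$. *)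

theory Defs
  imports "HOL-Analysis.Analysis"
begin

section \<open>Differential calculus\<close>

text \<open>At points where the partial derivative does not exist, its value is irrelevant: for Lipschitz
  functions this happens only on a Lebesgue null set.\<close>

definition partial_deriv :: "'n \<Rightarrow> (real^'n \<Rightarrow> 'b::real_normed_vector) \<Rightarrow> real^'n \<Rightarrow> 'b" where
  "partial_deriv i f x = vector_derivative (\<lambda>t. f (x + t *\<^sub>R axis i 1)) (at 0)"

text \<open>The classes \<open>C\<^sup>k(S)\<close> for open \<open>S\<close>.\<close>

primrec Ck_on :: "nat \<Rightarrow> (real^'n) set \<Rightarrow> (real^'n \<Rightarrow> 'b::real_normed_vector) \<Rightarrow> bool" where
  "Ck_on 0 S f \<longleftrightarrow> continuous_on S f"
| "Ck_on (Suc k) S f \<longleftrightarrow>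
     (\<forall>x\<in>S. f differentiable (at x)) \<and> (\<forall>i. Ck_on k S (partial_deriv i f))"

definition grad :: "(real^'n \<Rightarrow> real) \<Rightarrow> real^'n \<Rightarrow> real^'n" where
  "grad f x = (\<chi> i. partial_deriv i f x)"

definition curl :: "(real^3 \<Rightarrow> real^3) \<Rightarrow> real^3 \<Rightarrow> real^3" where
  "curl f x = vector
     [partial_deriv 2 f x $ 3 - partial_deriv 3 f x $ 2,
      partial_deriv 3 f x $ 1 - partial_deriv 1 f x $ 3,
      partial_deriv 1 f x $ 2 - partial_deriv 2 f x $ 1]"

definition compactly_supported_in :: "'a::topological_space set \<Rightarrow> ('a \<Rightarrow> 'b::zero) \<Rightarrow> bool" where
  "compactly_supported_in \<Omega> f \<longleftrightarrow>
     compact (closure {x. f x \<noteq> 0}) \<and> closure {x. f x \<noteq> 0} \<subseteq> \<Omega>"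

text \<open>\<open>C\<^sub>c\<^sup>\<infinity>(\<Omega>; \<real>\<^sup>3)\<close> and \<open>Lip\<^sub>c(\<Omega>; \<real>\<^sup>3)\<close>; their elements are extended by zero to the whole space.\<close>

definition test_fields :: "(real^3) set \<Rightarrow> (real^3 \<Rightarrow> real^3) set" where
  "test_fields \<Omega> = {f. (\<forall>k. Ck_on k UNIV f) \<and> compactly_supported_in \<Omega> f}"

definition Lip_c :: "(real^3) set \<Rightarrow> (real^3 \<Rightarrow> real^3) set" where
  "Lip_c \<Omega> = {f. (\<exists>L. L-lipschitz_on UNIV f) \<and> compactly_supported_in \<Omega> f}"

definition Lip :: "(real^3) set \<Rightarrow> (real^3 \<Rightarrow> real^3) set" where
  "Lip S = {f. \<exists>L. L-lipschitz_on S f}"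


section \<open>Finite vector-valued Radon measures\<close>

text \<open>An \<open>\<real>\<^sup>3\<close>-valued Radon measure on an open set \<open>\<Omega>\<close> is a countably additive set function on the
  Borel subsets of \<open>\<Omega>\<close>; its values on other sets are irrelevant. Finiteness of the total variation
  and regularity are automatic for such set functions on open subsets of Euclidean space.\<close>

definition vector_measure_on :: "(real^3) set \<Rightarrow> ((real^3) set \<Rightarrow> real^3) \<Rightarrow> bool" where
  "vector_measure_on \<Omega> \<mu> \<longleftrightarrow>
     (\<forall>A::nat \<Rightarrow> (real^3) set. range A \<subseteq> sets (restrict_space borel \<Omega>) \<longrightarrow> disjoint_family A \<longrightarrow>
        (\<lambda>i. \<mu> (A i)) sums \<mu> (\<Union>i. A i))"

text \<open>The upper variation of a real measure \<open>m\<close>, i.e. the positive part in its Jordan decomposition,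
  is \<open>m\<^sup>+(A) = sup {m(B) | B \<subseteq> A Borel}\<close>. Negative values \<open>m(B)\<close> are sent to \<open>0\<close> by \<open>ennreal\<close>, which does not
  affect the supremum since \<open>m({}) = 0\<close>. The negative part is the upper variation of \<open>- m\<close>.\<close>

definition upper_variation :: "(real^3) set \<Rightarrow> ((real^3) set \<Rightarrow> real) \<Rightarrow> (real^3) measure" where
  "upper_variation \<Omega> m =
     measure_of \<Omega> (sets (restrict_space borel \<Omega>))
       (\<lambda>A. SUP B\<in>{B \<in> sets borel. B \<subseteq> A}. ennreal (m B))"

definition signed_integral ::
    "(real^3) set \<Rightarrow> ((real^3) set \<Rightarrow> real) \<Rightarrow> (real^3) set \<Rightarrow> (real^3 \<Rightarrow> real) \<Rightarrow> real" where
  "signed_integral \<Omega> m A f =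
     (LINT x:A|upper_variation \<Omega> m. f x) - (LINT x:A|upper_variation \<Omega> (\<lambda>B. - m B). f x)"

text \<open>The integral of \<open>\<phi> \<cdot> d\<mu>\<close> over a Borel set \<open>A \<subseteq> \<Omega>\<close>.\<close>

definition vector_integral ::
    "(real^3) set \<Rightarrow> ((real^3) set \<Rightarrow> real^3) \<Rightarrow> (real^3) set \<Rightarrow> (real^3 \<Rightarrow> real^3) \<Rightarrow> real" where
  "vector_integral \<Omega> \<mu> A \<phi> = (\<Sum>i\<in>UNIV. signed_integral \<Omega> (\<lambda>B. \<mu> B $ i) A (\<lambda>x. \<phi> x $ i))"


section \<open>Fields whose curl is a measure\<close>

definition is_curl_measure ::
    "(real^3) set \<Rightarrow> (real^3 \<Rightarrow> real^3) \<Rightarrow> ((real^3) set \<Rightarrow> real^3) \<Rightarrow> bool" where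
  "is_curl_measure \<Omega> F \<mu> \<longleftrightarrow> vector_measure_on \<Omega> \<mu> \<and>
     (\<forall>\<phi>\<in>test_fields \<Omega>.
        vector_integral \<Omega> \<mu> \<Omega> \<phi> = (LINT x:\<Omega>|lebesgue. F x \<bullet> curl \<phi> x))"

definition CM :: "real \<Rightarrow> (real^3) set \<Rightarrow> (real^3 \<Rightarrow> real^3) set" where
  "CM p \<Omega> = {F. F \<in> borel_measurable (lebesgue_on \<Omega>) \<and>
                set_integrable lebesgue \<Omega> (\<lambda>x. norm (F x) powr p) \<and>
                (\<exists>\<mu>. is_curl_measure \<Omega> F \<mu>)}"

text \<open>The distributional curl; as a measure on the Borel subsets of \<open>\<Omega>\<close> it is unique.\<close>

definition curl_measure :: "(real^3) set \<Rightarrow> (real^3 \<Rightarrow> real^3) \<Rightarrow> (real^3) set \<Rightarrow> real^3" where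
  "curl_measure \<Omega> F = (SOME \<mu>. is_curl_measure \<Omega> F \<mu>)"


section \<open>Domains with \<open>C\<^sup>2\<close> boundary\<close>

text \<open>Near each boundary point, after a linear isometric change of coordinates, the set is the region
  above the graph of a \<open>C\<^sup>2\<close> function.\<close>

definition C2_boundary :: "(real^3) set \<Rightarrow> bool" where
  "C2_boundary U \<longleftrightarrow>
     (\<forall>x\<in>frontier U. \<exists>r>0. \<exists>T::real^3 \<Rightarrow> real^3. \<exists>\<gamma>::real^2 \<Rightarrow> real.
        orthogonal_transformation T \<and> Ck_on 2 UNIV \<gamma> \<and>
        U \<inter> ball x r = {y \<in> ball x r. T y $ 3 > \<gamma> (vector [T y $ 1, T y $ 2])})"

definition curve_through :: "(real^3) set \<Rightarrow> real^3 \<Rightarrow> real^3 \<Rightarrow> (real \<Rightarrow> real^3) \<Rightarrow> bool" where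
  "curve_through S x v c \<longleftrightarrow>
     c 0 = x \<and> eventually (\<lambda>t. c t \<in> S) (at 0) \<and> (c has_vector_derivative v) (at 0)"

definition tangent_space :: "(real^3) set \<Rightarrow> real^3 \<Rightarrow> (real^3) set" where
  "tangent_space S x = {v. \<exists>c. curve_through S x v c}"

definition inner_normal :: "(real^3) set \<Rightarrow> real^3 \<Rightarrow> real^3" where
  "inner_normal U x = (THE n. norm n = 1 \<and> (\<forall>v\<in>tangent_space (frontier U) x. n \<bullet> v = 0) \<and>
     eventually (\<lambda>t. x + t *\<^sub>R n \<in> U) (at_right 0))"

definition tangential_part :: "(real^3) set \<Rightarrow> (real^3 \<Rightarrow> real^3) \<Rightarrow> real^3 \<Rightarrow> real^3" where
  "tangential_part U \<phi> x = \<phi> x - (\<phi> x \<bullet> inner_normal U x) *\<^sub>R inner_normal U x"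

text \<open>The tangential (surface) gradient: the tangent vector representing the differential of \<open>\<phi>\<close> along
  the surface. It depends only on the values of \<open>\<phi>\<close> on \<open>S\<close>.\<close>

definition tangential_grad :: "(real^3) set \<Rightarrow> (real^3 \<Rightarrow> real) \<Rightarrow> real^3 \<Rightarrow> real^3" where
  "tangential_grad S \<phi> x = (THE g. g \<in> tangent_space S x \<and>
     (\<forall>v c. curve_through S x v c \<longrightarrow> ((\<lambda>t. \<phi> (c t)) has_real_derivative g \<bullet> v) (at 0)))"

text \<open>\<open>\<Phi>\<close> is a \<open>C\<^sup>2\<close>-extension to the whole space of the function \<open>\<phi>\<close> on \<open>S\<close>; the elements of \<open>C\<^sup>2(S)\<close>
  are the functions on \<open>S\<close> admitting such an extension.\<close>

definition C2_extension :: "(real^3) set \<Rightarrow> (real^3 \<Rightarrow> real) \<Rightarrow> (real^3 \<Rightarrow> real) \<Rightarrow> bool" where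
  "C2_extension S \<phi> \<Phi> \<longleftrightarrow> Ck_on 2 UNIV \<Phi> \<and> (\<forall>x\<in>S. \<Phi> x = \<phi> x)"


section \<open>Interior and exterior tangential traces\<close>

text \<open>The traces act on fields given on \<open>frontier U\<close>. They are evaluated on an arbitrarily chosen
  extension in \<open>Lip\<^sub>c(\<Omega>; \<real>\<^sup>3)\<close>; the choice depends only on the values of \<open>\<phi>\<close> on \<open>frontier U\<close>.\<close>

definition Lip_c_ext :: "(real^3) set \<Rightarrow> (real^3) set \<Rightarrow> (real^3 \<Rightarrow> real^3) \<Rightarrow> real^3 \<Rightarrow> real^3" where
  "Lip_c_ext \<Omega> U \<phi> = (SOME \<psi>. \<psi> \<in> Lip_c \<Omega> \<and> (\<forall>x\<in>frontier U. \<psi> x = \<phi> x))"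

definition trace_int ::
    "(real^3) set \<Rightarrow> (real^3 \<Rightarrow> real^3) \<Rightarrow> (real^3) set \<Rightarrow> (real^3 \<Rightarrow> real^3) \<Rightarrow> real" where
  "trace_int \<Omega> F U \<phi> = (let \<psi> = Lip_c_ext \<Omega> U \<phi> in
     vector_integral \<Omega> (curl_measure \<Omega> F) U \<psi> - (LINT x:U|lebesgue. F x \<bullet> curl \<psi> x))"

definition trace_ext ::
    "(real^3) set \<Rightarrow> (real^3 \<Rightarrow> real^3) \<Rightarrow> (real^3) set \<Rightarrow> (real^3 \<Rightarrow> real^3) \<Rightarrow> real" where
  "trace_ext \<Omega> F U \<phi> = (let \<psi> = Lip_c_ext \<Omega> U \<phi> in
     - vector_integral \<Omega> (curl_measure \<Omega> F) (\<Omega> - closure U) \<psi>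
     + (LINT x:(\<Omega> - closure U)|lebesgue. F x \<bullet> curl \<psi> x))"

end

theory Submission
  imports Defs
begin

text \<open>Only the normal component of a field is lost in its tangential trace, so the theorem says that the trace
  vanishes on fields which are normal along the boundary. The proof uses a cutoff function of the distance
  to the boundary.

  Let \<open>C\<close> be the complement of the domain, or its closure for the exterior trace, and let \<open>\<psi>\<close> be a Lipschitz
  field with compact support that is normal along the boundary. For \<open>e > 0\<close> let \<open>\<theta>\<close> be the minimum of \<open>1\<close> and
  \<open>infdist x C / e\<close>. The field \<open>\<theta> \<psi>\<close> is Lipschitz and vanishes on \<open>C\<close>; testing the distributional curl with
  it gives
  \<open>\<integral> \<theta> \<psi> \<cdot> d(curl F) = \<integral> F \<cdot> (\<theta> curl \<psi> + \<nabla>\<theta> \<times> \<psi>)\<close>.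
  Let \<open>y\<close> be a point of \<open>C\<close> nearest to \<open>x\<close>. Where \<open>\<nabla>\<theta>(x)\<close> is not \<open>0\<close>, it equals \<open>(x - y) / (e \<bar>x - y\<bar>)\<close>; moreover
  \<open>x - y\<close> is orthogonal to the boundary at \<open>y\<close>, hence parallel to \<open>\<psi>(y)\<close>. Therefore \<open>\<nabla>\<theta> \<times> \<psi>(x) = \<nabla>\<theta> \<times> (\<psi>(x) - \<psi>(y))\<close>, which
  is bounded by the Lipschitz constant of \<open>\<psi>\<close> because \<open>\<bar>x - y\<bar> < e\<close> wherever \<open>\<nabla>\<theta> \<noteq> 0\<close>. As \<open>e \<rightarrow> 0\<close> this error
  term lives on sets that shrink to the empty set, so it tends to \<open>0\<close>, and the trace of \<open>\<psi>\<close> is \<open>0\<close>. This is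
  the lemma \<open>trace_of_normal_field_vanishes\<close>. Applied to the difference of two extensions it also shows that
  the trace is independent of the extension.

  The argument tests the curl with Lipschitz fields, which \<open>curl_measure_Lip_c\<close> justifies by mollification.
  That in turn requires that Lipschitz functions have partial derivatives almost everywhere
  (\<open>lipschitz_AE_partially_differentiable\<close>), that mollification converges almost everywhere
  (\<open>mollify_AE_tendsto\<close>), and that the variations of a vector measure are finite
  (\<open>vector_measure_on_variations_finite\<close>).

  The \<open>C\<^sup>2\<close> charts enter in two ways: they identify the tangent plane and the inner normal at each boundary point
  (\<open>boundary_geometry\<close>), and they make the normal Lipschitz, so that the tangential part of a Lipschitz field
  has a Lipschitz extension. The statement on gradients is the special case of the field \<open>grad \<Phi>\<close>, whose
  tangential part on the boundary is the tangential gradient.\<close>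

section \<open>Lipschitz functions of one variable\<close>

text \<open>The function \<open>F t = f t + (L + 1) t\<close> has slope at least \<open>1\<close>, so it is a homeomorphism of the line, and the
  push-forward of Lebesgue measure under its inverse gives mass \<open>F b - F a\<close> to \<open>{a..b}\<close>. Since \<open>F\<close> is
  Lipschitz it maps null sets to null sets, which makes this push-forward absolutely continuous; its
  Radon--Nikodym density, minus \<open>L + 1\<close>, is the function \<open>g\<close>.\<close>

lemma lipschitz_real_density:
  fixes f :: "real \<Rightarrow> real"
  assumes "L-lipschitz_on UNIV f"
  obtains g where "\<And>a b. a \<le> b \<Longrightarrow> (g has_integral (f b - f a)) {a..b}"
proof -
  define F where "F = (\<lambda>t. f t + (L + 1) * t)"
  have L0: "L \<ge> 0" using assms by (rule lipschitz_on_nonneg)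
  have Lip: "\<bar>f s - f t\<bar> \<le> L * \<bar>s - t\<bar>" for s t
    using lipschitz_onD[OF assms, of s t] by (simp add: dist_real_def)
  have Fge: "F t - F s \<ge> t - s" if "s \<le> t" for s t
    using Lip[of s t] that by (simp add: F_def algebra_simps abs_if split: if_splits)
  have Flip: "(L + (L+1))-lipschitz_on UNIV F"
    unfolding F_def using L0
    by (intro lipschitz_on_add assms lipschitz_onI) (auto simp: dist_real_def abs_mult right_diff_distrib[symmetric])
  have Fcont: "continuous_on UNIV F"
    using Flip by (rule lipschitz_on_continuous_on)
  have Fmono: "strict_mono F"
    by (rule strict_monoI) (use Fge in \<open>smt (verit)\<close>)
  have "surj F"
  proof (rule surjI)
    fix y
    define R where "R = \<bar>y - F 0\<bar>"
    have "F (-R) \<le> y" "y \<le> F R"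
      using Fge[of "-R" 0] Fge[of 0 R] by (auto simp: R_def)
    then have "\<exists>x\<ge>-R. x \<le> R \<and> F x = y"
      by (intro IVT') (auto intro: continuous_on_subset[OF Fcont] simp: R_def)
    then show "F (SOME x. F x = y) = y" by (metis (mono_tags) someI)
  qed
  then have bij: "bij F" using Fmono strict_mono_imp_inj_on by (auto simp: bij_def)
  define G where "G = inv F"
  have FG: "F (G y) = y" and GF: "G (F y) = y" for y
    using bij by (auto simp: G_def bij_is_inj bij_is_surj surj_f_inv_f)
  have "mono G"
    by (rule monoI) (metis FG Fmono strict_mono_less_eq)
  then have Gm [measurable]: "G \<in> borel_measurable borel" by (rule borel_measurable_mono)
  define M where "M = distr lborel borel G"
  have vim: "G -` A = F ` A" for A :: "real set"
    using FG GF by (metis G_def bij bij_vimage_eq_inv_image inv_inv_eq bij_imp_bij_inv)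
  have "absolutely_continuous lborel M"
    unfolding absolutely_continuous_def
  proof
    fix A :: "real set" assume A: "A \<in> null_sets lborel"
    then have Ab: "A \<in> sets borel" by auto
    have "negligible A" using A by (simp add: negligible_iff_null_sets null_sets_completionI)
    then have "negligible (F ` A)"
      by (intro negligible_locally_Lipschitz_image)
         (auto intro!: exI[of _ UNIV] exI[of _ "L+(L+1)"] dest: lipschitz_onD[OF Flip] simp: dist_norm)
    moreover have "F ` A \<in> sets borel"
      using measurable_sets[OF Gm Ab] by (simp add: vim)
    ultimately have "emeasure lborel (F ` A) = 0"
      by (simp add: negligible_iff_null_sets null_sets_completion_iff null_sets_def)
    then show "A \<in> null_sets M"
      using Ab by (auto simp: M_def null_sets_def emeasure_distr vim)
  qed
  then obtain h where h [measurable]: "h \<in> borel_measurable lborel" and dens: "density lborel h = M"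
    by (metis M_def sigma_finite_measure.Radon_Nikodym sets_distr sets_lborel sigma_finite_lborel)
  have eM: "(\<integral>\<^sup>+x. h x * indicator {a..b} x \<partial>lborel) = ennreal (F b - F a)" if "a \<le> b" for a b
  proof -
    have "(\<integral>\<^sup>+x. h x * indicator {a..b} x \<partial>lborel) = emeasure M {a..b}"
      by (subst dens[symmetric]) (simp add: emeasure_density)
    also have "\<dots> = emeasure lborel (F ` {a..b})"
      by (simp add: M_def emeasure_distr vim)
    also have "F ` {a..b} = {F a..F b}"
    proof (intro equalityI subsetI)
      fix y assume "y \<in> {F a..F b}"
      then have "G y \<in> {a..b}" using Fmono by (metis FG atLeastAtMost_iff strict_mono_less_eq)
      then show "y \<in> F ` {a..b}" by (metis FG imageI)
    qed (use Fmono in \<open>auto simp: strict_mono_less_eq\<close>)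
    finally show ?thesis using Fge[OF that] that by simp
  qed
  define g0 where "g0 = (\<lambda>x. enn2real (h x))"
  have hi: "(g0 has_integral (F b - F a)) {a..b}" if "a \<le> b" for a b
  proof -
    have "AE x in lborel. h x * indicator {a..b} x \<noteq> \<infinity>"
      by (rule nn_integral_PInf_AE) (use eM[OF that] in auto)
    then have "(\<integral>\<^sup>+x. ennreal (g0 x * indicator {a..b} x) \<partial>lborel) = (\<integral>\<^sup>+x. h x * indicator {a..b} x \<partial>lborel)"
      by (intro nn_integral_cong_AE, eventually_elim)
         (auto simp: g0_def indicator_def less_top)
    then have "((\<lambda>x. g0 x * indicator {a..b} x) has_integral (F b - F a)) UNIV"
      using eM[OF that] Fge[OF that] that
      by (intro nn_integral_has_integral) (auto simp: g0_def)
    then have "((\<lambda>x. if x \<in> {a..b} then g0 x else 0) has_integral (F b - F a)) UNIV"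
      by (rule has_integral_eq[rotated]) auto
    then show ?thesis by (subst (asm) has_integral_restrict_UNIV)
  qed
  show ?thesis
  proof (rule that[of "\<lambda>x. g0 x - (L+1)"])
    fix a b :: real assume "a \<le> b"
    have "((\<lambda>x. g0 x - (L+1)) has_integral ((F b - F a) - (b-a) *\<^sub>R (L+1))) {a..b}"
      using \<open>a \<le> b\<close> has_integral_const_real[of "L+1" a b] by (intro has_integral_diff hi) auto
    then show "((\<lambda>x. g0 x - (L+1)) has_integral f b - f a) {a..b}"
      by (simp add: F_def algebra_simps)
  qed
qed

text \<open>The averages of \<open>g\<close> over \<open>{x..x + h}\<close> converge to \<open>g x\<close> for almost every \<open>x\<close>, which gives the right
  derivative of \<open>f\<close>. The same statement for the reflected function \<open>t \<mapsto> g (- t)\<close> gives the left one.\<close>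

lemma has_integral_imp_AE_differentiable:
  fixes f g :: "real \<Rightarrow> real"
  assumes fg: "\<And>a b. a \<le> b \<Longrightarrow> (g has_integral (f b - f a)) {a..b}"
  shows "negligible {t. \<not> f differentiable (at t)}"
proof -
  have gi: "g integrable_on cbox a b" for a b
    using fg by (cases "a \<le> b") (auto simp: integrable_on_def)
  have fg': "((\<lambda>t. g (-t)) has_integral (f (-a) - f (-b))) {a..b}" if "a \<le> b" for a b
    using fg[of "-b" "-a"] that by (subst has_integral_reflect_real[symmetric]) simp
  have gi': "(\<lambda>t. g (-t)) integrable_on cbox a b" for a b
    using fg' by (cases "a \<le> b") (auto simp: integrable_on_def)
  obtain N1 where N1: "negligible N1"
    and R: "\<And>x e. \<lbrakk>x \<notin> N1; 0 < e\<rbrakk> \<Longrightarrow> \<exists>d>0. \<forall>h. 0 < h \<and> h < d \<longrightarrow>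
       norm(integral (cbox x (x + h *\<^sub>R One)) g /\<^sub>R h ^ DIM(real) - g x) < e"
    using integrable_ccontinuous_explicit[OF gi] by metis
  obtain N2 where N2: "negligible N2"
    and Lf: "\<And>x e. \<lbrakk>x \<notin> N2; 0 < e\<rbrakk> \<Longrightarrow> \<exists>d>0. \<forall>h. 0 < h \<and> h < d \<longrightarrow>
       norm(integral (cbox x (x + h *\<^sub>R One)) (\<lambda>t. g (-t)) /\<^sub>R h ^ DIM(real) - g (-x)) < e"
    using integrable_ccontinuous_explicit[OF gi'] by metis
  have "negligible (N1 \<union> uminus ` N2)"
    using N1 N2 by (auto intro!: negligible_Un negligible_differentiable_image_negligible derivative_intros simp: differentiable_on_def)
  moreover have "f differentiable (at x)" if x: "x \<notin> N1 \<union> uminus ` N2" for x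
  proof -
    have "x \<notin> N1" "-x \<notin> N2" using x by (auto, metis add.inverse_inverse imageI)
    have "((\<lambda>h. (f (x + h) - f x) / h) \<longlongrightarrow> g x) (at 0)"
    proof (rule LIM_I)
      fix e :: real assume "e > 0"
      obtain d1 where d1: "d1 > 0" "\<And>h. 0 < h \<and> h < d1 \<Longrightarrow>
         norm(integral (cbox x (x + h *\<^sub>R One)) g /\<^sub>R h ^ DIM(real) - g x) < e"
        using R[OF \<open>x \<notin> N1\<close> \<open>e > 0\<close>] by blast
      obtain d2 where d2: "d2 > 0" "\<And>h. 0 < h \<and> h < d2 \<Longrightarrow>
         norm(integral (cbox (-x) (-x + h *\<^sub>R One)) (\<lambda>t. g (-t)) /\<^sub>R h ^ DIM(real) - g x) < e"
        using Lf[OF \<open>-x \<notin> N2\<close> \<open>e > 0\<close>] by auto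
      show "\<exists>s>0. \<forall>h. h \<noteq> 0 \<and> norm (h - 0) < s \<longrightarrow> norm ((f (x + h) - f x) / h - g x) < e"
      proof (intro exI[of _ "min d1 d2"] conjI allI impI)
        fix h :: real assume h: "h \<noteq> 0 \<and> norm (h - 0) < min d1 d2"
        show "norm ((f (x + h) - f x) / h - g x) < e"
        proof (cases "h > 0")
          case True
          then have "integral {x..x+h} g = f (x + h) - f x"
            by (intro integral_unique fg) auto
          then show ?thesis using d1(2)[of h] h True by (simp add: divide_inverse mult.commute)
        next
          case False
          then have "integral {-x..-x-h} (\<lambda>t. g (-t)) = f x - f (x + h)"
            using h by (intro integral_unique) (use fg'[of "-x" "-x-h"] in \<open>simp add: add.commute\<close>)
          then have "norm ((f x - f (x+h)) / (-h) - g x) < e"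
            using d2(2)[of "-h"] h False by (simp add: divide_inverse mult.commute)
          moreover have "(f x - f (x+h)) / (-h) = (f (x + h) - f x) / h"
            using h by (simp add: field_simps)
          ultimately show ?thesis by simp
        qed
      qed (use d1 d2 in auto)
    qed
    then have "DERIV f x :> g x" by (simp add: DERIV_def)
    then show ?thesis by (meson field_differentiable_imp_differentiable field_differentiable_def)
  qed
  ultimately show ?thesis by (elim negligible_subset) blast
qed

lemma lipschitz_curve_AE_differentiable:
  fixes f :: "real \<Rightarrow> 'a::euclidean_space"
  assumes "L-lipschitz_on UNIV f"
  shows "negligible {t. \<not> f differentiable (at t)}"
proof -
  have "negligible {t. \<not> (\<lambda>s. f s \<bullet> b) differentiable (at t)}" if "b \<in> Basis" for b
  proof -
    have "L-lipschitz_on UNIV (\<lambda>s. f s \<bullet> b)"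
    proof (rule lipschitz_onI)
      fix s t
      have "dist (f s \<bullet> b) (f t \<bullet> b) \<le> dist (f s) (f t)"
        using Basis_le_norm[OF that, of "f s - f t"] by (simp add: dist_norm inner_diff_left)
      also have "\<dots> \<le> L * dist s t" using assms by (auto dest: lipschitz_onD)
      finally show "dist (f s \<bullet> b) (f t \<bullet> b) \<le> L * dist s t" .
    qed (use assms in \<open>rule lipschitz_on_nonneg\<close>)
    from lipschitz_real_density[OF this] show ?thesis
      using has_integral_imp_AE_differentiable by metis
  qed
  then have "negligible (\<Union>b\<in>Basis. {t. \<not> (\<lambda>s. f s \<bullet> b) differentiable (at t)})"
    by (intro negligible_Union) auto
  then show ?thesis
    by (rule negligible_subset) (auto simp: differentiable_componentwise_within[of f _ UNIV])
qed

section \<open>Partial derivatives of Lipschitz functions\<close>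

text \<open>Translation invariance makes \<open>emeasure lborel N\<close> the average over \<open>t \<in> {0..1}\<close> of the integrals of
  \<open>x \<mapsto> indicator N (x + t e)\<close>. Exchanging the two integrals leaves the slices of \<open>N\<close> in direction
  \<open>e\<close>, which are null.\<close>

lemma null_sets_if_null_on_lines:
  fixes N :: "'a::euclidean_space set"
  assumes N [measurable]: "N \<in> sets borel"
    and lines: "\<And>x. negligible {t::real. x + t *\<^sub>R e \<in> N}"
  shows "N \<in> null_sets lborel"
proof -
  have slice: "(\<integral>\<^sup>+t. indicator {0..1::real} t * indicator N (x + t *\<^sub>R e) \<partial>lborel) = 0" for x
  proof -
    have "{t::real. x + t *\<^sub>R e \<in> N} \<in> null_sets lborel"
    proof -
      have "(\<lambda>t::real. x + t *\<^sub>R e) -` N \<inter> space borel \<in> sets borel"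
        by (rule measurable_sets[OF _ N]) measurable
      then have "{t::real. x + t *\<^sub>R e \<in> N} \<in> sets borel" by (simp add: vimage_def)
      then show ?thesis
        using lines[of x] by (simp add: negligible_iff_null_sets null_sets_completion_iff)
    qed
    then have "AE t in lborel. x + t *\<^sub>R e \<notin> N"
      using AE_not_in by fastforce
    then have "AE t in lborel. indicator {0..1::real} t * indicator N (x + t *\<^sub>R e) = (0::ennreal)"
      by eventually_elim auto
    then show ?thesis by (subst nn_integral_0_iff_AE) auto
  qed
  have trans: "(\<integral>\<^sup>+x. indicator N (x + t *\<^sub>R e) \<partial>lborel) = emeasure lborel N" for t :: real
  proof -
    have "(\<integral>\<^sup>+x. indicator N x \<partial>distr lborel borel ((+) (t *\<^sub>R e))) = (\<integral>\<^sup>+x. indicator N (t *\<^sub>R e + x) \<partial>lborel)"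
      by (subst nn_integral_distr) auto
    then show ?thesis by (simp add: lborel_distr_plus add.commute)
  qed
  have "emeasure lborel N = (\<integral>\<^sup>+t. indicator {0..1::real} t * emeasure lborel N \<partial>lborel)"
    by (subst nn_integral_multc) auto
  also have "\<dots> = (\<integral>\<^sup>+t. (\<integral>\<^sup>+x. indicator {0..1::real} t * indicator N (x + t *\<^sub>R e) \<partial>lborel) \<partial>lborel)"
    by (subst nn_integral_cmult) (auto simp: trans)
  also have "\<dots> = (\<integral>\<^sup>+x. (\<integral>\<^sup>+t. indicator {0..1::real} t * indicator N (x + t *\<^sub>R e) \<partial>lborel) \<partial>lborel)"
    by (rule lborel_pair.Fubini') measurable
  also have "\<dots> = 0" by (simp add: slice)
  finally show ?thesis by (auto simp: null_sets_def)
qed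

definition partially_differentiable :: "'n \<Rightarrow> (real^'n \<Rightarrow> 'b::real_normed_vector) \<Rightarrow> real^'n \<Rightarrow> bool" where
  "partially_differentiable i f x \<longleftrightarrow> (\<lambda>t. f (x + t *\<^sub>R axis i 1)) differentiable (at 0)"

definition diff_quotient :: "'n \<Rightarrow> (real^'n \<Rightarrow> 'b::real_normed_vector) \<Rightarrow> real \<Rightarrow> real^'n \<Rightarrow> 'b" where
  "diff_quotient i f t x = (f (x + t *\<^sub>R axis i 1) - f x) /\<^sub>R t"

lemma has_partial_deriv:
  "partially_differentiable i f x \<Longrightarrow>
    ((\<lambda>t. f (x + t *\<^sub>R axis i 1)) has_vector_derivative partial_deriv i f x) (at 0)"
  unfolding partially_differentiable_def partial_deriv_def
  by (simp add: vector_derivative_works)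

lemma partial_derivI:
  assumes "((\<lambda>t. f (x + t *\<^sub>R axis i 1)) has_vector_derivative D) (at 0)"
  shows "partially_differentiable i f x" "partial_deriv i f x = D"
  using assms by (auto simp: partially_differentiable_def partial_deriv_def
      differentiableI_vector vector_derivative_at)

lemma has_vector_derivative_iff_diff_quotient:
  "((\<lambda>t. f (x + t *\<^sub>R axis i 1)) has_vector_derivative D) (at 0) \<longleftrightarrow>
    ((\<lambda>t. diff_quotient i f t x) \<longlongrightarrow> D) (at 0)"
proof -
  have "norm (((f (x + y *\<^sub>R axis i 1) - f x) - y *\<^sub>R D) /\<^sub>R norm y) = norm (diff_quotient i f y x - D)"
    if "y \<noteq> 0" for y
  proof -
    have "diff_quotient i f y x - D = ((f (x + y *\<^sub>R axis i 1) - f x) - y *\<^sub>R D) /\<^sub>R y"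
      using that by (simp add: diff_quotient_def scaleR_diff_right)
    then show ?thesis by simp
  qed
  then have "((\<lambda>y. norm (((f (x + y *\<^sub>R axis i 1) - f x) - y *\<^sub>R D) /\<^sub>R norm y)) \<longlongrightarrow> 0) (at 0) \<longleftrightarrow>
     ((\<lambda>y. norm (diff_quotient i f y x - D)) \<longlongrightarrow> 0) (at 0)"
    by (intro filterlim_cong) (auto simp: eventually_at_filter)
  then have "((\<lambda>y. ((f (x + y *\<^sub>R axis i 1) - f x) - y *\<^sub>R D) /\<^sub>R norm y) \<longlongrightarrow> 0) (at 0) \<longleftrightarrow>
     ((\<lambda>t. diff_quotient i f t x) \<longlongrightarrow> D) (at 0)"
    by (simp only: tendsto_norm_zero_iff Lim_null[symmetric])
  then show ?thesis
    unfolding has_vector_derivative_def has_derivative_def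
    by (simp add: bounded_linear_scaleR_left)
qed

lemma diff_quotient_tendsto:
  "partially_differentiable i f x \<Longrightarrow> ((\<lambda>t. diff_quotient i f t x) \<longlongrightarrow> partial_deriv i f x) (at 0)"
  using has_partial_deriv has_vector_derivative_iff_diff_quotient by blast

text \<open>A Cauchy criterion for the difference quotients that only involves rational increments. Its point is
  that it exhibits the set of partial differentiability as a countable combination of closed sets.\<close>

lemma partially_differentiable_iff:
  fixes f :: "real^'n \<Rightarrow> 'b::banach"
  assumes f: "continuous_on UNIV f"
  shows "partially_differentiable i f x \<longleftrightarrow>
    (\<forall>n::nat. \<exists>m::nat. \<forall>s\<in>\<rat>-{0}. \<forall>t\<in>\<rat>-{0}. \<bar>s\<bar> < 1 / Suc m \<and> \<bar>t\<bar> < 1 / Suc m \<longrightarrow>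
        dist (diff_quotient i f s x) (diff_quotient i f t x) \<le> 1 / Suc n)"
    (is "_ = ?G")
proof
  assume "partially_differentiable i f x"
  then have lim: "((\<lambda>t. diff_quotient i f t x) \<longlongrightarrow> partial_deriv i f x) (at 0)"
    by (rule diff_quotient_tendsto)
  show ?G
  proof
    fix n :: nat
    obtain d where d: "d > 0" "\<And>t. t \<noteq> 0 \<Longrightarrow> dist t 0 < d \<Longrightarrow>
        dist (diff_quotient i f t x) (partial_deriv i f x) < 1 / Suc n / 2"
      using lim[unfolded LIM_def, rule_format, of "1 / Suc n / 2"] by auto
    obtain m where m: "1 / Suc m < d" using nat_approx_posE[OF d(1)] by auto
    show "\<exists>m::nat. \<forall>s\<in>\<rat>-{0}. \<forall>t\<in>\<rat>-{0}. \<bar>s\<bar> < 1 / Suc m \<and> \<bar>t\<bar> < 1 / Suc m \<longrightarrow>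
        dist (diff_quotient i f s x) (diff_quotient i f t x) \<le> 1 / Suc n"
    proof (intro exI ballI impI)
      fix s t :: real
      assume st: "s \<in> \<rat> - {0}" "t \<in> \<rat> - {0}" "\<bar>s\<bar> < 1 / Suc m \<and> \<bar>t\<bar> < 1 / Suc m"
      have "dist (diff_quotient i f s x) (partial_deriv i f x) < 1 / Suc n / 2"
        "dist (diff_quotient i f t x) (partial_deriv i f x) < 1 / Suc n / 2"
        using d(2)[of s] d(2)[of t] m st by (auto simp: dist_real_def)
      then show "dist (diff_quotient i f s x) (diff_quotient i f t x) \<le> 1 / Suc n"
        by (metis dist_triangle_half_l less_imp_le)
    qed
  qed
next
  assume G: ?G
  define r where "r k = 1 / real (Suc k)" for k
  have r: "r k \<in> \<rat> - {0}" "\<bar>r k\<bar> = r k" for k by (auto simp: r_def)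
  have rmono: "r k < 1 / Suc m" if "k \<ge> Suc m" for k m
    using that by (auto simp: r_def divide_simps)
  have "Cauchy (\<lambda>k. diff_quotient i f (r k) x)"
    unfolding Cauchy_altdef2
  proof (intro allI impI)
    fix e :: real assume "e > 0"
    then obtain n where n: "1 / Suc n < e" using nat_approx_posE by blast
    obtain m where "\<forall>s\<in>\<rat>-{0}. \<forall>t\<in>\<rat>-{0}. \<bar>s\<bar> < 1 / Suc m \<and> \<bar>t\<bar> < 1 / Suc m \<longrightarrow>
        dist (diff_quotient i f s x) (diff_quotient i f t x) \<le> 1 / Suc n" using G by blast
    then have "\<forall>k\<ge>Suc m. dist (diff_quotient i f (r k) x) (diff_quotient i f (r (Suc m)) x) \<le> 1 / Suc n"
      using r rmono by auto
    then show "\<exists>N. \<forall>k\<ge>N. dist (diff_quotient i f (r k) x) (diff_quotient i f (r N) x) < e"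
      using n by (meson order_le_less_trans)
  qed
  then obtain D where D: "(\<lambda>k. diff_quotient i f (r k) x) \<longlonglongrightarrow> D"
    using Cauchy_convergent_iff convergent_def by blast
  have qc: "continuous_on (-{0}) (\<lambda>t. diff_quotient i f t x)"
    unfolding diff_quotient_def by (intro continuous_intros continuous_on_compose2[OF f]) auto
  have "((\<lambda>t. diff_quotient i f t x) \<longlongrightarrow> D) (at 0)"
    unfolding LIM_def
  proof (intro allI impI)
    fix e :: real assume "e > 0"
    then obtain n where n: "1 / Suc n < e" using nat_approx_posE by blast
    obtain m where m: "\<forall>s\<in>\<rat>-{0}. \<forall>t\<in>\<rat>-{0}. \<bar>s\<bar> < 1 / Suc m \<and> \<bar>t\<bar> < 1 / Suc m \<longrightarrow>
        dist (diff_quotient i f s x) (diff_quotient i f t x) \<le> 1 / Suc n" using G by blast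
    have rat: "dist (diff_quotient i f s x) D \<le> 1 / Suc n" if s: "s \<in> \<rat>-{0}" "\<bar>s\<bar> < 1 / Suc m" for s
    proof -
      have "(\<lambda>k. dist (diff_quotient i f s x) (diff_quotient i f (r k) x)) \<longlonglongrightarrow> dist (diff_quotient i f s x) D"
        by (intro tendsto_intros D)
      moreover have "\<forall>k\<ge>Suc m. dist (diff_quotient i f s x) (diff_quotient i f (r k) x) \<le> 1 / Suc n"
        using m r rmono s by auto
      ultimately show ?thesis by (meson LIMSEQ_le_const2)
    qed
    have "dist (diff_quotient i f t x) D < e" if t: "t \<noteq> 0" "dist t 0 < 1 / Suc m" for t
    proof (rule ccontr)
      assume neg: "\<not> dist (diff_quotient i f t x) D < e"
      define V where "V = {t \<in> -{0}. diff_quotient i f t x \<in> - cball D (1 / Suc n)} \<inter> {-(1 / Suc m)<..<1 / Suc m}"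
      have "open ((\<lambda>t. diff_quotient i f t x) -` (- cball D (1 / Suc n)) \<inter> -{0})"
        using continuous_open_preimage[OF qc, of "- cball D (1 / Suc n)"]
        by (simp add: Int_commute open_Compl)
      then have "open V"
        unfolding V_def by (intro open_Int) (auto simp: vimage_def Int_def conj_commute)
      moreover have "t \<in> V"
        using neg n t by (auto simp: V_def dist_commute)
      ultimately obtain d where d: "d > 0" "\<And>y. dist y t < d \<Longrightarrow> y \<in> V"
        by (meson open_dist)
      obtain s where "s \<in> \<rat>" "t < s" "s < t + d"
        using Rats_dense_in_real[of t "t+d"] d by auto
      then have "s \<in> V" by (intro d) (auto simp: dist_real_def)
      then show False
        using rat[of s] \<open>s \<in> \<rat>\<close> by (auto simp: V_def dist_commute abs_less_iff)
    qed
    then show "\<exists>s>0. \<forall>t. t \<noteq> 0 \<and> dist t 0 < s \<longrightarrow> dist (diff_quotient i f t x) D < e"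
      by (intro exI[of _ "1 / Suc m"]) auto
  qed
  then show "partially_differentiable i f x"
    using has_vector_derivative_iff_diff_quotient partial_derivI(1) by blast
qed

lemma borel_measurable_diff_quotient:
  fixes f :: "real^'n \<Rightarrow> 'b::euclidean_space"
  assumes [measurable]: "f \<in> borel_measurable borel"
  shows "diff_quotient i f t \<in> borel_measurable borel"
  unfolding diff_quotient_def by measurable

lemma sets_partially_differentiable:
  fixes f :: "real^'n \<Rightarrow> 'b::euclidean_space"
  assumes f: "continuous_on UNIV f"
  shows "{x. partially_differentiable i f x} \<in> sets borel"
proof -
  have [measurable]: "f \<in> borel_measurable borel" by (rule borel_measurable_continuous_onI[OF f])
  have [measurable]: "diff_quotient i f t \<in> borel_measurable borel" for t
    by (rule borel_measurable_diff_quotient) measurable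
  have [measurable, simp]: "countable (\<rat> - {0::real})"
    using countable_rat by (rule countable_subset[rotated]) auto
  have "{x \<in> space borel. (\<forall>n::nat. \<exists>m::nat. \<forall>s\<in>\<rat>-{0}. \<forall>t\<in>\<rat>-{0}. \<bar>s\<bar> < 1 / Suc m \<and> \<bar>t\<bar> < 1 / Suc m \<longrightarrow>
        dist (diff_quotient i f s x) (diff_quotient i f t x) \<le> 1 / Suc n)} \<in> sets borel"
    by measurable
  then show ?thesis
    by (simp add: partially_differentiable_iff[OF f])
qed

text \<open>Where the partial derivative does not exist, \<open>partial_deriv\<close> takes one and the same unspecified
  value, so it is Borel measurable on the whole space.\<close>

lemma borel_measurable_partial_deriv:
  fixes f :: "real^'n \<Rightarrow> 'b::euclidean_space"
  assumes f: "continuous_on UNIV f"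
  shows "partial_deriv i f \<in> borel_measurable borel"
proof -
  define G where "G = {x. partially_differentiable i f x}"
  have [measurable]: "G \<in> sets borel" unfolding G_def by (rule sets_partially_differentiable[OF f])
  have [measurable]: "f \<in> borel_measurable borel" by (rule borel_measurable_continuous_onI[OF f])
  have [measurable]: "diff_quotient i f t \<in> borel_measurable borel" for t
    by (rule borel_measurable_diff_quotient) measurable
  define c where "c = (SOME d::'b. False)"
  have junk: "partial_deriv i f x = c" if "x \<notin> G" for x
    using that unfolding c_def partial_deriv_def vector_derivative_def G_def partially_differentiable_def
    by (metis differentiableI_vector mem_Collect_eq)
  show ?thesis
  proof (rule borel_measurable_LIMSEQ_metric)
    fix k :: nat
    show "(\<lambda>x. if x \<in> G then diff_quotient i f (1 / Suc k) x else c) \<in> borel_measurable borel"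
      by measurable
  next
    fix x
    have "(\<lambda>k. 1 / real (Suc k)) \<longlonglongrightarrow> 0" by (rule LIMSEQ_Suc[OF lim_1_over_n])
    then have "filterlim (\<lambda>k. 1 / real (Suc k)) (at 0) sequentially"
      by (auto simp: filterlim_at)
    then show "(\<lambda>k. if x \<in> G then diff_quotient i f (1 / Suc k) x else c) \<longlonglongrightarrow> partial_deriv i f x"
      by (cases "x \<in> G") (auto simp: junk G_def intro: filterlim_compose[OF diff_quotient_tendsto])
  qed
qed

lemma norm_diff_quotient_le:
  assumes "L-lipschitz_on UNIV f"
  shows "norm (diff_quotient i f t x) \<le> L"
proof (cases "t = 0")
  case False
  have "norm (f (x + t *\<^sub>R axis i 1) - f x) \<le> L * \<bar>t\<bar>"
    using lipschitz_onD[OF assms, of "x + t *\<^sub>R axis i 1" x] by (simp add: dist_norm norm_axis_1)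
  then show ?thesis using False by (simp add: diff_quotient_def divide_simps mult.commute)
qed (use lipschitz_on_nonneg[OF assms] in \<open>simp add: diff_quotient_def\<close>)

lemma norm_partial_deriv_le:
  assumes "L-lipschitz_on UNIV f" "partially_differentiable i f x"
  shows "norm (partial_deriv i f x) \<le> L"
  by (rule tendsto_le[OF _ tendsto_const tendsto_norm[OF diff_quotient_tendsto[OF assms(2)]]])
     (auto simp: norm_diff_quotient_le[OF assms(1)])

text \<open>On each line in direction \<open>i\<close> the exceptional set is null by the one-dimensional theorem, hence it is
  null altogether.\<close>

lemma lipschitz_AE_partially_differentiable:
  fixes f :: "real^'n \<Rightarrow> 'b::euclidean_space"
  assumes f: "L-lipschitz_on UNIV f"
  shows "AE x in lborel. partially_differentiable i f x"
proof -
  have c: "continuous_on UNIV f" using f by (rule lipschitz_on_continuous_on)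
  define N where "N = - {x. partially_differentiable i f x}"
  have "N \<in> null_sets lborel"
  proof (rule null_sets_if_null_on_lines)
    show "N \<in> sets borel" unfolding N_def using sets_partially_differentiable[OF c] by auto
    fix x :: "real^'n"
    define u where "u = (\<lambda>t. f (x + t *\<^sub>R axis i 1))"
    have "L-lipschitz_on UNIV u"
    proof (rule lipschitz_onI)
      fix s t
      have "dist (x + s *\<^sub>R axis i 1) (x + t *\<^sub>R axis i 1) = dist s t"
        by (simp add: dist_norm scaleR_diff_left[symmetric] norm_axis_1)
      then show "dist (u s) (u t) \<le> L * dist s t"
        using lipschitz_onD[OF f, of "x + s *\<^sub>R axis i 1" "x + t *\<^sub>R axis i 1"] by (simp add: u_def)
    qed (use f in \<open>rule lipschitz_on_nonneg\<close>)
    then have "negligible {t. \<not> u differentiable (at t)}"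
      by (rule lipschitz_curve_AE_differentiable)
    moreover have "partially_differentiable i f (x + t *\<^sub>R axis i 1)" if "u differentiable (at t)" for t
    proof -
      have "(u \<circ> (+) t) differentiable (at 0)"
        using that by (intro differentiable_chain_at) auto
      then show ?thesis
        by (simp add: partially_differentiable_def u_def o_def scaleR_add_left add.assoc)
    qed
    ultimately show "negligible {t. x + t *\<^sub>R axis i 1 \<in> N}"
      by (elim negligible_subset) (auto simp: N_def)
  qed
  then show ?thesis
    by (rule AE_I') (auto simp: N_def)
qed

section \<open>Smooth kernels and convolution\<close>

lemma linear_eq_sum_axis:
  fixes f :: "real^'n \<Rightarrow> 'b::real_vector"
  assumes "linear f"
  shows "f h = (\<Sum>i\<in>UNIV. h $ i *\<^sub>R f (axis i 1))"
proof -
  have "f h = f (\<Sum>i\<in>UNIV. h $ i *\<^sub>R axis i 1)"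
    using basis_expansion[of h] by (simp add: scalar_mult_eq_scaleR)
  then show ?thesis by (simp add: linear_sum[OF assms] linear_scale[OF assms])
qed

lemma sum_axis_scaleR:
  fixes g :: "'n::finite \<Rightarrow> 'b::real_vector"
  shows "(\<Sum>j\<in>UNIV. axis i (1::real) $ j *\<^sub>R g j) = g i"
proof -
  have "axis i (1::real) $ j *\<^sub>R g j = (if j = i then g j else 0)" for j
    by (simp add: axis_def)
  then show ?thesis by simp
qed

lemma has_derivative_imp_partial_deriv:
  assumes "(f has_derivative f') (at x)"
  shows "partially_differentiable i f x" "partial_deriv i f x = f' (axis i 1)"
proof -
  have "((\<lambda>t. f (x + t *\<^sub>R axis i 1)) has_derivative (\<lambda>t. f' (t *\<^sub>R axis i 1))) (at 0)"
    using assms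
    by (intro has_derivative_compose[of "\<lambda>t. x + t *\<^sub>R axis i 1" "\<lambda>t. t *\<^sub>R axis i 1" 0 UNIV f f'])
       (auto intro!: derivative_eq_intros)
  then have "((\<lambda>t. f (x + t *\<^sub>R axis i 1)) has_vector_derivative f' (axis i 1)) (at 0)"
    using linear_scale[OF has_derivative_linear[OF assms]] by (simp add: has_vector_derivative_def)
  then show "partially_differentiable i f x" "partial_deriv i f x = f' (axis i 1)"
    by (rule partial_derivI)+
qed

lemma differentiable_has_derivative:
  fixes f :: "real^'n \<Rightarrow> 'b::real_normed_vector"
  assumes "f differentiable (at x)"
  shows "(f has_derivative (\<lambda>h. \<Sum>i\<in>UNIV. h $ i *\<^sub>R partial_deriv i f x)) (at x)"
proof -
  obtain f' where f': "(f has_derivative f') (at x)" using assms by (auto simp: differentiable_def)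
  have "f' = (\<lambda>h. \<Sum>i\<in>UNIV. h $ i *\<^sub>R partial_deriv i f x)"
    unfolding has_derivative_imp_partial_deriv(2)[OF f']
    by (rule ext) (rule linear_eq_sum_axis[OF has_derivative_linear[OF f']])
  then show ?thesis using f' by simp
qed

lemma partial_deriv_add:
  assumes "f differentiable (at x)" "g differentiable (at x)"
  shows "partial_deriv i (\<lambda>x. f x + g x) x = partial_deriv i f x + partial_deriv i g x"
proof -
  obtain f' g' where d: "(f has_derivative f') (at x)" "(g has_derivative g') (at x)"
    using assms by (auto simp: differentiable_def)
  show ?thesis
    using has_derivative_imp_partial_deriv(2)[OF has_derivative_add[OF d]]
      has_derivative_imp_partial_deriv(2)[OF d(1)] has_derivative_imp_partial_deriv(2)[OF d(2)] by simp
qed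

lemma partial_deriv_scaleR:
  fixes f :: "real^'n \<Rightarrow> real"
  assumes "f differentiable (at x)" "g differentiable (at x)"
  shows "partial_deriv i (\<lambda>x. f x *\<^sub>R g x) x = f x *\<^sub>R partial_deriv i g x + partial_deriv i f x *\<^sub>R g x"
proof -
  obtain f' g' where d: "(f has_derivative f') (at x)" "(g has_derivative g') (at x)"
    using assms by (auto simp: differentiable_def)
  show ?thesis
    using has_derivative_imp_partial_deriv(2)[OF has_derivative_scaleR[OF d]]
      has_derivative_imp_partial_deriv(2)[OF d(1)] has_derivative_imp_partial_deriv(2)[OF d(2)] by simp
qed

lemma Ck_on_lower:
  "Ck_on (Suc k) S f \<Longrightarrow> Ck_on k S f"
proof (induction k arbitrary: f)
  case 0
  then have "\<forall>x\<in>S. f differentiable (at x)" by simp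
  then show ?case
    unfolding Ck_on.simps
    by (intro continuous_at_imp_continuous_on ballI) (blast intro: differentiable_imp_continuous_within)
next
  case (Suc k)
  have "Ck_on k S (partial_deriv i f)" for i
    using Suc.prems by (intro Suc.IH) simp
  then show ?case using Suc.prems by simp
qed

lemma Ck_on_const: "Ck_on k S (\<lambda>x::real^'n. c::'b::real_normed_vector)"
proof (induction k arbitrary: c)
  case (Suc k)
  have pd: "partial_deriv i (\<lambda>x::real^'n. c) = (\<lambda>x. 0)" for i and c :: 'b
    by (rule ext) (rule has_derivative_imp_partial_deriv(2)[OF has_derivative_const])
  show ?case
    unfolding Ck_on.simps pd by (intro conjI ballI allI differentiable_const Suc.IH)
qed simp

lemma Ck_on_linear: "bounded_linear f \<Longrightarrow> Ck_on k S f"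
proof (cases k)
  case 0
  assume "bounded_linear f"
  then show ?thesis using 0 by (auto intro: linear_continuous_on)
next
  case (Suc m)
  assume f: "bounded_linear f"
  have pd: "partial_deriv i f = (\<lambda>x. f (axis i 1))" for i
    by (rule ext) (rule has_derivative_imp_partial_deriv(2)[OF bounded_linear_imp_has_derivative[OF f]])
  show ?thesis
    unfolding Suc Ck_on.simps pd
    by (intro conjI ballI allI Ck_on_const bounded_linear_imp_differentiable f)
qed

lemma Ck_on_UNIV_add:
  "Ck_on k UNIV f \<Longrightarrow> Ck_on k UNIV g \<Longrightarrow> Ck_on k UNIV (\<lambda>x. f x + g x)"
proof (induction k arbitrary: f g)
  case (Suc k)
  have d: "f differentiable (at x)" "g differentiable (at x)" for x
    using Suc.prems by simp_all
  have pd: "partial_deriv i (\<lambda>x. f x + g x) = (\<lambda>x. partial_deriv i f x + partial_deriv i g x)" for i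
    by (intro ext partial_deriv_add d)
  have "Ck_on k UNIV (\<lambda>x. partial_deriv i f x + partial_deriv i g x)" for i
    using Suc.prems by (intro Suc.IH) simp_all
  then show ?case
    unfolding Ck_on.simps pd by (intro conjI ballI allI differentiable_add d)
qed (simp add: continuous_on_add)

lemma Ck_on_UNIV_scaleR:
  fixes f :: "real^'n \<Rightarrow> real"
  shows "Ck_on k UNIV f \<Longrightarrow> Ck_on k UNIV g \<Longrightarrow> Ck_on k UNIV (\<lambda>x. f x *\<^sub>R g x)"
proof (induction k arbitrary: f g)
  case (Suc k)
  have d: "f differentiable (at x)" "g differentiable (at x)" for x
    using Suc.prems by simp_all
  have pd: "partial_deriv i (\<lambda>x. f x *\<^sub>R g x) =
      (\<lambda>x. f x *\<^sub>R partial_deriv i g x + partial_deriv i f x *\<^sub>R g x)" for i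
    by (intro ext partial_deriv_scaleR d)
  have "Ck_on k UNIV f" "Ck_on k UNIV g"
    using Suc.prems by (blast intro: Ck_on_lower)+
  then have "Ck_on k UNIV (\<lambda>x. f x *\<^sub>R partial_deriv i g x + partial_deriv i f x *\<^sub>R g x)" for i
    using Suc.prems by (intro Ck_on_UNIV_add Suc.IH) simp_all
  then show ?case
    unfolding Ck_on.simps pd by (intro conjI ballI allI differentiable_scaleR d)
qed (simp add: continuous_on_scaleR)

lemma Ck_on_UNIV_minus: "Ck_on k UNIV f \<Longrightarrow> Ck_on k UNIV (\<lambda>x. - f x)"
  using Ck_on_UNIV_scaleR[OF Ck_on_const[of k UNIV "-1"], of f] by simp

lemma Ck_on_UNIV_sum:
  "(\<And>j. j \<in> J \<Longrightarrow> Ck_on k UNIV (f j)) \<Longrightarrow> Ck_on k UNIV (\<lambda>x. \<Sum>j\<in>J. f j x)"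
  by (induction J rule: infinite_finite_induct) (auto intro: Ck_on_const Ck_on_UNIV_add)

text \<open>For \<open>n = 0\<close> this is the classical smooth function that is flat at \<open>0\<close>. The additional powers of
  \<open>inverse t\<close> make the linear span of the family closed under differentiation.\<close>

definition flat_exp :: "nat \<Rightarrow> real \<Rightarrow> real" where
  "flat_exp n t = (if t > 0 then exp (- inverse t) * inverse t ^ n else 0)"

lemma flat_exp_tendsto_0: "((\<lambda>t. flat_exp n t) \<longlongrightarrow> 0) (at 0)"
proof -
  have "((\<lambda>t. (inverse t) ^ n / exp (inverse t)) \<longlongrightarrow> (0::real)) (at_right 0)"
    by (rule filterlim_compose[OF tendsto_power_div_exp_0 filterlim_inverse_at_top_right])
  then have "(flat_exp n \<longlongrightarrow> 0) (at_right 0)"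
    by (rule Lim_transform_eventually)
       (auto simp: eventually_at_filter flat_exp_def exp_minus field_simps)
  moreover have "(flat_exp n \<longlongrightarrow> 0) (at_left 0)"
    by (rule Lim_transform_eventually[OF tendsto_const]) (auto simp: eventually_at_filter flat_exp_def)
  ultimately show ?thesis by (simp add: filterlim_at_split)
qed

lemma DERIV_flat_exp:
  "DERIV (flat_exp n) t :> flat_exp (n + 2) t - n * flat_exp (n + 1) t"
proof -
  consider "t > 0" | "t < 0" | "t = 0" by linarith
  then show ?thesis
  proof cases
    case 1
    define u where "u = inverse t"
    have "DERIV (\<lambda>t. exp (- inverse t) * inverse t ^ n) t :>
        exp (- u) * u\<^sup>2 * u ^ n + real n * u ^ (n - 1) * (- u\<^sup>2) * exp (- u)"
    proof -
      have du: "DERIV inverse t :> - (u\<^sup>2)"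
        using 1 by (auto intro!: derivative_eq_intros simp: u_def power2_eq_square)
      from DERIV_mult[OF DERIV_fun_exp[OF DERIV_minus[OF du]] DERIV_power[OF du, of n]]
      show ?thesis by (simp add: u_def algebra_simps)
    qed
    also have "exp (- u) * u\<^sup>2 * u ^ n + real n * u ^ (n - 1) * (- u\<^sup>2) * exp (- u) =
        exp (- u) * u ^ (n + 2) - n * (exp (- u) * u ^ (n + 1))"
      by (cases n) (auto simp: algebra_simps power2_eq_square)
    finally have "DERIV (flat_exp n) t :> exp (- u) * u ^ (n + 2) - n * (exp (- u) * u ^ (n + 1))"
      by (rule has_field_derivative_transform_within_open[of _ _ _ "{0<..}"])
         (use 1 in \<open>auto simp: flat_exp_def\<close>)
    then show ?thesis using 1 by (simp add: flat_exp_def u_def)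
  next
    case 2
    have "DERIV (flat_exp n) t :> 0"
      by (rule has_field_derivative_transform_within_open[of "\<lambda>_. 0" _ _ "{..<0}"])
         (use 2 in \<open>auto simp: flat_exp_def\<close>)
    then show ?thesis using 2 by (simp add: flat_exp_def)
  next
    case 3
    have "((\<lambda>h. (flat_exp n (0 + h) - flat_exp n 0) / h) \<longlongrightarrow> 0) (at 0)"
      by (rule Lim_transform_eventually[OF flat_exp_tendsto_0[of "n+1"]])
         (auto simp: eventually_at_filter flat_exp_def divide_inverse ac_simps)
    then show ?thesis using 3 by (simp add: DERIV_def flat_exp_def)
  qed
qed

text \<open>Smoothness of all members of the family is proved at once, since differentiating one of them produces
  two others times a derivative of \<open>q\<close>.\<close>

lemma Ck_on_flat_exp_comp:
  fixes q :: "real^'n \<Rightarrow> real"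
  assumes q: "\<And>k. Ck_on k UNIV q"
  shows "Ck_on k UNIV (\<lambda>x. flat_exp n (q x))"
proof (induction k arbitrary: n)
  case 0
  have "continuous_on UNIV (flat_exp n)"
    by (rule DERIV_continuous_on) (rule DERIV_flat_exp)
  then show ?case using q[of 0] by (simp add: continuous_on_compose2[of UNIV "flat_exp n"])
next
  case (Suc k)
  have qd: "q differentiable (at x)" for x using q[of 1] by simp
  have d: "((\<lambda>x. flat_exp n (q x)) has_derivative
      (\<lambda>h. (\<Sum>i\<in>UNIV. h $ i *\<^sub>R partial_deriv i q x) * (flat_exp (n + 2) (q x) - n * flat_exp (n + 1) (q x)))) (at x)" for x
    by (rule DERIV_compose_FDERIV[OF DERIV_flat_exp differentiable_has_derivative[OF qd]])
  have pd: "partial_deriv i (\<lambda>x. flat_exp n (q x)) =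
      (\<lambda>x. (flat_exp (n + 2) (q x) + (- real n) *\<^sub>R flat_exp (n + 1) (q x)) *\<^sub>R partial_deriv i q x)"
    (is "_ = ?D i") for i
  proof
    fix x
    show "partial_deriv i (\<lambda>x. flat_exp n (q x)) x =
      (flat_exp (n + 2) (q x) + (- real n) *\<^sub>R flat_exp (n + 1) (q x)) *\<^sub>R partial_deriv i q x"
      using has_derivative_imp_partial_deriv(2)[OF d, of i x] unfolding sum_axis_scaleR by simp
  qed
  have Ck: "Ck_on k UNIV (?D i)" for i
    using q[of "Suc k"] by (intro Ck_on_UNIV_add Ck_on_UNIV_scaleR Ck_on_const Suc) simp
  have diff: "(\<lambda>x. flat_exp n (q x)) differentiable (at x)" for x
    using d by (auto simp: differentiable_def)
  show ?case unfolding Ck_on.simps pd by (intro conjI ballI allI diff Ck)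
qed

text \<open>All derivatives fall on the kernel: differentiating under the integral reproduces an integral of the
  same form with \<open>k\<close> replaced by \<open>- partial_deriv i k\<close>.\<close>

lemma Ck_on_convolution:
  fixes f :: "real^'n \<Rightarrow> 'b::euclidean_space" and k :: "real^'n \<Rightarrow> real"
  assumes f: "continuous_on UNIV f"
  shows "Ck_on m UNIV k \<Longrightarrow> Ck_on m UNIV (\<lambda>x. integral (cbox a b) (\<lambda>z. k (z - x) *\<^sub>R f z))"
proof (induction m arbitrary: k)
  case 0
  have "continuous_on (UNIV \<times> cbox a b) (\<lambda>(x, z). k (z - x) *\<^sub>R f z)"
    using 0 unfolding case_prod_unfold Ck_on.simps
    by (intro continuous_on_scaleR continuous_on_compose2[OF f] continuous_on_compose2[of UNIV k "UNIV \<times> cbox a b" "\<lambda>p. snd p - fst p"])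
       (auto intro!: continuous_intros)
  then show ?case by (auto intro: integral_continuous_on_param)
next
  case (Suc m)
  have kd: "k differentiable (at x)" for x using Suc.prems by simp
  have kc: "continuous_on UNIV k"
    using kd by (auto intro!: continuous_at_imp_continuous_on differentiable_imp_continuous_within)
  have pk: "continuous_on UNIV (partial_deriv i k)" for i
  proof -
    have "Ck_on m UNIV (partial_deriv i k)" using Suc.prems by simp
    then have "Ck_on 0 UNIV (partial_deriv i k)" by (induction m) (blast dest: Ck_on_lower)+
    then show ?thesis by simp
  qed
  define A where "A x z = Blinfun (\<lambda>h::real^'n. - (\<Sum>i\<in>UNIV. h $ i *\<^sub>R partial_deriv i k (z - x)) *\<^sub>R f z)" for x z
  have bl: "bounded_linear (\<lambda>h::real^'n. - (\<Sum>i\<in>UNIV. h $ i *\<^sub>R partial_deriv i k (z - x)) *\<^sub>R f z)" for x z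
    by (intro bounded_linear_scaleR_const bounded_linear_minus bounded_linear_sum bounded_linear_vec_nth)
  have A: "blinfun_apply (A x z) = (\<lambda>h. - (\<Sum>i\<in>UNIV. h $ i *\<^sub>R partial_deriv i k (z - x)) *\<^sub>R f z)" for x z
    unfolding A_def by (rule bounded_linear_Blinfun_apply[OF bl])
  have dx: "((\<lambda>x. k (z - x) *\<^sub>R f z) has_derivative blinfun_apply (A x z)) (at x within UNIV)" for x z
  proof -
    have "((\<lambda>x. k (z - x)) has_derivative (\<lambda>h. \<Sum>i\<in>UNIV. (- h) $ i *\<^sub>R partial_deriv i k (z - x))) (at x)"
      by (rule has_derivative_compose[OF _ differentiable_has_derivative[OF kd]])
         (auto intro!: derivative_eq_intros)
    from has_derivative_scaleR_left[OF this, of "f z"] show ?thesis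
      by (simp add: A sum_negf)
  qed
  have cA: "continuous_on (UNIV \<times> cbox a b) (\<lambda>(x, z). A x z)"
  proof (rule continuous_on_blinfun_componentwise)
    fix e :: "real^'n"
    show "continuous_on (UNIV \<times> cbox a b) (\<lambda>p. blinfun_apply (case p of (x, z) \<Rightarrow> A x z) e)"
      unfolding case_prod_unfold A
      by (intro continuous_on_scaleR continuous_on_minus continuous_on_sum continuous_on_const
            continuous_on_compose2[OF f] continuous_on_compose2[OF pk])
         (auto intro!: continuous_intros)
  qed
  have ki: "(\<lambda>z. k (z - x) *\<^sub>R f z) integrable_on cbox a b" for x
    by (intro integrable_continuous continuous_intros continuous_on_compose2[OF kc] continuous_on_subset[OF f]) auto
  have D: "((\<lambda>x. integral (cbox a b) (\<lambda>z. k (z - x) *\<^sub>R f z)) has_derivative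
      blinfun_apply (integral (cbox a b) (A x))) (at x)" for x
    using leibniz_rule[OF dx ki cA] by auto
  have pd: "partial_deriv i (\<lambda>x. integral (cbox a b) (\<lambda>z. k (z - x) *\<^sub>R f z)) =
      (\<lambda>x. integral (cbox a b) (\<lambda>z. (- partial_deriv i k (z - x)) *\<^sub>R f z))" for i
  proof
    fix x
    have "A x integrable_on cbox a b"
      by (intro integrable_continuous continuous_on_compose2[OF cA, of _ "\<lambda>z. (x, z)", simplified])
         (auto intro!: continuous_intros)
    then have "blinfun_apply (integral (cbox a b) (A x)) (axis i 1) = integral (cbox a b) (\<lambda>z. A x z (axis i 1))"
      by (rule blinfun_apply_integral)
    also have "(\<lambda>z. A x z (axis i 1)) = (\<lambda>z. (- partial_deriv i k (z - x)) *\<^sub>R f z)"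
      unfolding A sum_axis_scaleR by simp
    finally show "partial_deriv i (\<lambda>x. integral (cbox a b) (\<lambda>z. k (z - x) *\<^sub>R f z)) x =
        integral (cbox a b) (\<lambda>z. (- partial_deriv i k (z - x)) *\<^sub>R f z)"
      using has_derivative_imp_partial_deriv(2)[OF D] by simp
  qed
  have Ck: "Ck_on m UNIV (\<lambda>x. - partial_deriv i k x)" for i
    using Suc.prems by (intro Ck_on_UNIV_minus) simp
  have diff: "(\<lambda>x. integral (cbox a b) (\<lambda>z. k (z - x) *\<^sub>R f z)) differentiable (at x)" for x
    using D by (auto simp: differentiable_def)
  show ?case unfolding Ck_on.simps pd by (intro conjI ballI allI diff Suc.IH[OF Ck])
qed

text \<open>The bump is centred at the midpoint of the unit cube, so that its support lies in \<open>cbox 0 One\<close> and not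
  in a ball around the origin. Mollification then averages over the corner cubes \<open>cbox x (x + h *\<^sub>R One)\<close>
  of the differentiation theorem for integrals.\<close>

definition bump :: "real^'n \<Rightarrow> real" where
  "bump x = flat_exp 0 (1 / 4 - (x - (\<chi> i. 1 / 2)) \<bullet> (x - (\<chi> i. 1 / 2)))"

lemma Ck_on_bump_scaled:
  "Ck_on k UNIV (\<lambda>x::real^'n. c * bump (s *\<^sub>R x))"
proof -
  define q where "q = (\<lambda>x::real^'n. 1 / 4 + (-1) *\<^sub>R (\<Sum>i\<in>UNIV. (s * x $ i + (-1/2)) *\<^sub>R (s * x $ i + (-1/2))))"
  have "Ck_on k UNIV (\<lambda>x::real^'n. s * x $ i)" for k i
    by (intro Ck_on_linear bounded_linear_const_mult bounded_linear_vec_nth)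
  then have "Ck_on k UNIV q" for k
    unfolding q_def
    by (intro Ck_on_UNIV_add Ck_on_const Ck_on_UNIV_scaleR Ck_on_UNIV_sum)
  then have *: "Ck_on k UNIV (\<lambda>x. c *\<^sub>R flat_exp 0 (q x))"
    by (intro Ck_on_UNIV_scaleR Ck_on_const Ck_on_flat_exp_comp)
  have "(\<lambda>x. c *\<^sub>R flat_exp 0 (q x)) = (\<lambda>x. c * bump (s *\<^sub>R x))"
    by (rule ext) (simp add: bump_def q_def inner_vec_def)
  then show ?thesis using * by (simp only:)
qed

lemma bump_nonneg: "bump x \<ge> 0" and bump_le_1: "bump x \<le> 1"
  by (auto simp: bump_def flat_exp_def)

lemma sum_Basis_nth [simp]: "(\<Sum>b\<in>(Basis :: (real^'n) set). b $ i) = 1"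
proof -
  have "(\<Sum>b\<in>(Basis :: (real^'n) set). b $ i) = (\<Sum>b\<in>(Basis :: (real^'n) set). b \<bullet> axis i 1)"
    by (simp add: inner_axis)
  also have "\<dots> = (\<Sum>b\<in>(Basis :: (real^'n) set). if b = axis i 1 then 1 else 0)"
    by (intro sum.cong refl) (simp add: inner_Basis axis_in_Basis_iff)
  also have "\<dots> = 1"
    by (simp add: axis_in_Basis_iff)
  finally show ?thesis .
qed

lemma bump_eq_0: 
  fixes x :: "real^'n"
  assumes "x \<notin> cbox 0 One"
  shows "bump x = 0"
proof -
  obtain i where i: "x $ i < 0 \<or> x $ i > 1"
    using assms by (auto simp: mem_box_cart not_le)
  define v where "v = x - (\<chi> i. 1 / 2)"
  have "\<bar>v $ i\<bar> \<ge> 1 / 2" using i by (auto simp: v_def)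
  then have "norm v \<ge> 1 / 2" using component_le_norm_cart[of v i] by linarith
  then have "(norm v)\<^sup>2 \<ge> (1 / 2)\<^sup>2" by (intro power_mono) auto
  then have "v \<bullet> v \<ge> 1 / 4" unfolding power2_norm_eq_inner by (simp add: power2_eq_square)
  then show ?thesis by (simp add: bump_def flat_exp_def v_def)
qed

lemma continuous_on_bump: "continuous_on UNIV (bump :: real^'n \<Rightarrow> real)"
  using Ck_on_bump_scaled[of 0 1 1] by simp

text \<open>The mass depends on the dimension only, which is passed as a type.\<close>

definition bump_mass :: "'n::finite itself \<Rightarrow> real" where
  "bump_mass _ = integral (cbox 0 One) (bump :: real^'n \<Rightarrow> real)"

lemma bump_mass_pos: "bump_mass TYPE('n::finite) > 0"
proof -
  have c: "continuous_on (cbox 0 One) (bump :: real^'n \<Rightarrow> real)"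
    using continuous_on_bump continuous_on_subset by blast
  have int: "(bump :: real^'n \<Rightarrow> real) integrable_on cbox 0 One"
    by (intro integrable_continuous c)
  have mid: "(\<chi> i. 1/2) \<in> box (0::real^'n) One"
    by (simp add: mem_box_cart)
  have "integral (cbox 0 One) (bump :: real^'n \<Rightarrow> real) \<noteq> 0"
  proof
    assume "integral (cbox 0 One) (bump :: real^'n \<Rightarrow> real) = 0"
    then have "((bump :: real^'n \<Rightarrow> real) has_integral 0) (cbox 0 One)"
      using int by (metis integrable_integral)
    then have "bump ((\<chi> i. 1/2) :: real^'n) = 0"
      using mid box_subset_cbox[of "0::real^'n" One]
      by (intro has_integral_0_cbox_imp_0[OF c]) (auto intro: bump_nonneg)
    then show False by (simp add: bump_def flat_exp_def)
  qed
  moreover have "integral (cbox 0 One) (bump :: real^'n \<Rightarrow> real) \<ge> 0"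
    using int by (rule integral_nonneg) (rule bump_nonneg)
  ultimately show ?thesis by (simp add: bump_mass_def)
qed

section \<open>Integration against a vector measure\<close>

text \<open>If \<open>m\<close> were unbounded on some set \<open>E\<close>, then \<open>E\<close> could be cut into two pieces whose masses have
  absolute value at least \<open>1\<close>, one of which is again unbounded. Iterating yields disjoint sets whose masses do not tend to \<open>0\<close>, against
  countable additivity.\<close>

lemma real_measure_bounded:
  fixes m :: "'a set \<Rightarrow> real"
  assumes "sigma_algebra \<Omega> \<Sigma>"
    and sums: "\<And>A. range A \<subseteq> \<Sigma> \<Longrightarrow> disjoint_family A \<Longrightarrow> (\<lambda>i. m (A i)) sums m (\<Union>i. A i)"
  shows "\<exists>K. \<forall>B\<in>\<Sigma>. \<bar>m B\<bar> \<le> K"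
proof (rule ccontr)
  assume neg: "\<not> ?thesis"
  interpret sigma_algebra \<Omega> \<Sigma> by fact
  have m0: "m {} = 0"
  proof -
    have "(\<lambda>i::nat. m {}) sums m (\<Union>i::nat. {})"
      by (rule sums) (auto simp: disjoint_family_on_def)
    then have "(\<lambda>i::nat. m {}) \<longlonglongrightarrow> 0" by (intro summable_LIMSEQ_zero) (auto simp: sums_iff)
    then show ?thesis by (simp add: LIMSEQ_const_iff)
  qed
  have add: "m (A \<union> B) = m A + m B" if "A \<in> \<Sigma>" "B \<in> \<Sigma>" "A \<inter> B = {}" for A B
  proof -
    have "(\<lambda>i. m (binaryset A B i)) sums m (\<Union>i. binaryset A B i)"
      using that by (intro sums) (auto simp: range_binaryset_eq disjoint_family_on_def binaryset_def)
    moreover have "(\<lambda>i. m (binaryset A B i)) sums (m A + m B)"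
      by (rule binaryset_sums) (rule m0)
    ultimately show ?thesis unfolding UN_binaryset_eq by (rule sums_unique2)
  qed
  define unb where "unb E \<longleftrightarrow> E \<in> \<Sigma> \<and> (\<forall>K. \<exists>B\<in>\<Sigma>. B \<subseteq> E \<and> \<bar>m B\<bar> > K)" for E
  have nb: "\<exists>K. \<forall>C\<in>\<Sigma>. C \<subseteq> E \<longrightarrow> \<bar>m C\<bar> \<le> K" if nu: "\<not> unb E" "E \<in> \<Sigma>" for E
  proof -
    obtain K where "\<not> (\<exists>B\<in>\<Sigma>. B \<subseteq> E \<and> \<bar>m B\<bar> > K)" using nu by (auto simp: unb_def)
    then show ?thesis by (intro exI[of _ K]) (simp add: not_less)
  qed
  have step: "\<exists>E'. unb E' \<and> E' \<subseteq> E \<and> 1 \<le> \<bar>m (E - E')\<bar>" if E: "unb E" for E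
  proof -
    obtain B where B: "B \<in> \<Sigma>" "B \<subseteq> E" "\<bar>m B\<bar> > \<bar>m E\<bar> + 1"
      using E by (auto simp: unb_def)
    have ES: "E \<in> \<Sigma>" using E by (auto simp: unb_def)
    have "m E = m B + m (E - B)"
    proof -
      have "B \<union> (E - B) = E" using B by blast
      then show ?thesis using add[of B "E - B"] B(1) ES by (simp add: Diff)
    qed
    then have big: "1 \<le> \<bar>m B\<bar>" "1 \<le> \<bar>m (E - B)\<bar>" using B(3) by linarith+
    have "unb B \<or> unb (E - B)"
    proof (rule ccontr)
      assume "\<not> ?thesis"
      then have "\<exists>K. \<forall>C\<in>\<Sigma>. C \<subseteq> B \<longrightarrow> \<bar>m C\<bar> \<le> K" "\<exists>K. \<forall>C\<in>\<Sigma>. C \<subseteq> E - B \<longrightarrow> \<bar>m C\<bar> \<le> K"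
        using nb[of B] nb[of "E - B"] B(1) Diff[OF ES B(1)] by blast+
      then obtain K1 K2 where K: "\<forall>C\<in>\<Sigma>. C \<subseteq> B \<longrightarrow> \<bar>m C\<bar> \<le> K1" "\<forall>C\<in>\<Sigma>. C \<subseteq> E - B \<longrightarrow> \<bar>m C\<bar> \<le> K2"
        by (elim exE)
      obtain C where C: "C \<in> \<Sigma>" "C \<subseteq> E" "\<bar>m C\<bar> > K1 + K2" using E by (auto simp: unb_def)
      have "m C = m (C \<inter> B) + m (C - B)"
      proof -
        have "C \<inter> B \<union> (C - B) = C" "C \<inter> B \<inter> (C - B) = {}" by blast+
        then show ?thesis using add[of "C \<inter> B" "C - B"] C(1) B(1) by (simp add: Diff Int)
      qed
      moreover have "\<bar>m (C \<inter> B)\<bar> \<le> K1" "\<bar>m (C - B)\<bar> \<le> K2"         using K C(2) Int[OF C(1) B(1)] Diff[OF C(1) B(1)] by (simp_all add: le_infI2 Diff_mono)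
      ultimately show False using C(3) by linarith
    qed
    then show ?thesis
    proof
      assume "unb B" then show ?thesis using B big by auto
    next
      assume "unb (E - B)"
      moreover have "E - (E - B) = B" using B by auto
      ultimately show ?thesis using big by (intro exI[of _ "E - B"]) auto
    qed
  qed
  have "unb \<Omega>"
    unfolding unb_def
  proof (intro conjI allI)
    fix K
    obtain B where "B \<in> \<Sigma>" "\<bar>m B\<bar> > K" using neg by (auto simp: not_le)
    then show "\<exists>B\<in>\<Sigma>. B \<subseteq> \<Omega> \<and> K < \<bar>m B\<bar>" using sets_into_space by blast
  qed simp
  then have "\<exists>E. \<forall>n::nat. unb (E n) \<and> (E (Suc n) \<subseteq> E n \<and> 1 \<le> \<bar>m (E n - E (Suc n))\<bar>)"
    by (intro dependent_nat_choice exI step)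
  then obtain E where "\<forall>n::nat. unb (E n) \<and> (E (Suc n) \<subseteq> E n \<and> 1 \<le> \<bar>m (E n - E (Suc n))\<bar>)"
    by (elim exE)
  then have E: "unb (E n)" "E (Suc n) \<subseteq> E n \<and> 1 \<le> \<bar>m (E n - E (Suc n))\<bar>" for n
    by simp_all
  have "decseq E" using E(2) by (intro decseq_SucI) auto
  then have "disjoint_family (\<lambda>n. E n - E (Suc n))"
    unfolding disjoint_family_on_def
  proof (intro ballI impI)
    fix i j :: nat assume "i \<noteq> j"
    then consider "Suc i \<le> j" | "Suc j \<le> i" by linarith
    then show "(E i - E (Suc i)) \<inter> (E j - E (Suc j)) = {}"
      using decseqD[OF \<open>decseq E\<close>] by cases blast+
  qed
  moreover have "range (\<lambda>n. E n - E (Suc n)) \<subseteq> \<Sigma>" using E(1) by (auto simp: unb_def)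
  ultimately have "(\<lambda>n. m (E n - E (Suc n))) sums m (\<Union>n. E n - E (Suc n))" by (intro sums)
  then have "(\<lambda>n. m (E n - E (Suc n))) \<longlonglongrightarrow> 0" by (intro summable_LIMSEQ_zero) (auto simp: sums_iff)
  then have "1 \<le> (0::real)"
    by (intro tendsto_lowerbound[OF tendsto_rabs_zero always_eventually]) (use E(2) in auto)
  then show False by simp
qed

lemma sets_upper_variation [simp]:
  "sets (upper_variation \<Omega> m) = sets (restrict_space borel \<Omega>)"
  unfolding upper_variation_def
  using sets.sets_measure_of_eq[of "restrict_space borel \<Omega>"] by (simp add: space_restrict_space)

lemma space_upper_variation [simp]: "space (upper_variation \<Omega> m) = \<Omega>"
  using sets_eq_imp_space_eq[OF sets_upper_variation] by (simp add: space_restrict_space)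

text \<open>A bound on the values of \<open>m\<close> is enough. The emeasure of a set under \<open>measure_of\<close> is either the
  prescribed supremum, or \<open>0\<close> in case the prescribed set function fails to be a measure.\<close>

lemma finite_measure_upper_variation:
  assumes K: "\<And>B. B \<in> sets borel \<Longrightarrow> B \<subseteq> \<Omega> \<Longrightarrow> \<bar>m B\<bar> \<le> K"
  shows "finite_measure (upper_variation \<Omega> m)"
proof
  have "(SUP B\<in>{B \<in> sets borel. B \<subseteq> \<Omega>}. ennreal (m B)) \<le> ennreal K"
    by (intro SUP_least ennreal_leI) (use K in \<open>simp add: abs_le_iff\<close>)
  then have "(SUP B\<in>{B \<in> sets borel. B \<subseteq> \<Omega>}. ennreal (m B)) \<noteq> \<infinity>"
    unfolding infinity_ennreal_def by (intro less_imp_neq le_less_trans[OF _ ennreal_less_top])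
  then show "emeasure (upper_variation \<Omega> m) (space (upper_variation \<Omega> m)) \<noteq> \<infinity>"
    unfolding space_upper_variation unfolding upper_variation_def emeasure_measure_of_conv by auto
qed

lemma vector_measure_on_variations_finite:
  assumes \<mu>: "vector_measure_on \<Omega> \<mu>" and \<Omega>: "\<Omega> \<in> sets borel"
  shows "finite_measure (upper_variation \<Omega> (\<lambda>B. \<mu> B $ i))"
    and "finite_measure (upper_variation \<Omega> (\<lambda>B. - \<mu> B $ i))"
proof -
  let ?\<Sigma> = "sets (restrict_space borel \<Omega>)"
  have "sigma_algebra \<Omega> ?\<Sigma>"
    using sets.sigma_algebra_axioms[of "restrict_space borel \<Omega>"] by (simp add: space_restrict_space)
  moreover have "(\<lambda>n. \<mu> (A n) $ i) sums (\<mu> (\<Union>n. A n) $ i)"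
    if "range A \<subseteq> ?\<Sigma>" "disjoint_family A" for A :: "nat \<Rightarrow> _"
  proof -
    have "(\<lambda>n. \<mu> (A n)) sums \<mu> (\<Union>n. A n)" using \<mu> that by (simp add: vector_measure_on_def)
    then show ?thesis by (rule bounded_linear.sums[OF bounded_linear_vec_nth])
  qed
  ultimately obtain K where "\<forall>B\<in>?\<Sigma>. \<bar>\<mu> B $ i\<bar> \<le> K"
    using real_measure_bounded[of \<Omega> ?\<Sigma> "\<lambda>B. \<mu> B $ i"] by blast
  then have K: "\<bar>\<mu> B $ i\<bar> \<le> K" if "B \<in> sets borel" "B \<subseteq> \<Omega>" for B
    using that \<Omega> by (auto simp: sets_restrict_space_iff)
  show "finite_measure (upper_variation \<Omega> (\<lambda>B. \<mu> B $ i))"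
    by (rule finite_measure_upper_variation) (rule K)
  show "finite_measure (upper_variation \<Omega> (\<lambda>B. - \<mu> B $ i))"
    by (rule finite_measure_upper_variation[of _ _ K]) (use K in auto)
qed

lemma borel_measurable_upper_variation:
  "f \<in> borel_measurable borel \<Longrightarrow> f \<in> borel_measurable (upper_variation \<Omega> m)"
  unfolding measurable_cong_sets[OF sets_upper_variation refl] by (rule measurable_restrict_space1)

lemma borel_measurable_vec_component:
  fixes f :: "'a \<Rightarrow> real^'n"
  assumes "f \<in> borel_measurable M"
  shows "(\<lambda>x. f x $ i) \<in> borel_measurable M"
  by (rule measurable_compose[OF assms borel_measurable_continuous_onI])
     (intro continuous_intros)

lemma set_integrable_upper_variation:
  fixes f :: "real^3 \<Rightarrow> real"
  assumes fin: "finite_measure (upper_variation \<Omega> m)" and \<Omega>: "\<Omega> \<in> sets borel"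
    and f: "f \<in> borel_measurable borel" "\<And>x. \<bar>f x\<bar> \<le> K" and A: "A \<in> sets borel" "A \<subseteq> \<Omega>"
  shows "set_integrable (upper_variation \<Omega> m) A f"
proof -
  have "A \<in> sets (upper_variation \<Omega> m)" using A \<Omega> by (simp add: sets_restrict_space_iff)
  moreover have "integrable (upper_variation \<Omega> m) f"
    by (rule finite_measure.integrable_const_bound[OF fin, of _ K])
       (simp_all add: f borel_measurable_upper_variation)
  ultimately show ?thesis
    unfolding set_integrable_def by (rule integrable_mult_indicator)
qed

lemma vector_integral_diff:
  assumes \<mu>: "vector_measure_on \<Omega> \<mu>" and \<Omega>: "\<Omega> \<in> sets borel"
    and f: "f \<in> borel_measurable borel" "\<And>x. norm (f x) \<le> K"
    and g: "g \<in> borel_measurable borel" "\<And>x. norm (g x) \<le> K"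
    and A: "A \<in> sets borel" "A \<subseteq> \<Omega>"
  shows "vector_integral \<Omega> \<mu> A (\<lambda>x. f x - g x) = vector_integral \<Omega> \<mu> A f - vector_integral \<Omega> \<mu> A g"
proof -
  have m: "(\<lambda>x. f x $ i) \<in> borel_measurable borel" "(\<lambda>x. g x $ i) \<in> borel_measurable borel" for i
    by (intro borel_measurable_vec_component f g)+
  have b: "\<bar>f x $ i\<bar> \<le> K" "\<bar>g x $ i\<bar> \<le> K" for x i
    using f(2)[of x] g(2)[of x] component_le_norm_cart[of "f x" i] component_le_norm_cart[of "g x" i] by linarith+
  note int = set_integrable_upper_variation[OF _ \<Omega> m(1) b(1) A] set_integrable_upper_variation[OF _ \<Omega> m(2) b(2) A]
  show ?thesis
    unfolding vector_integral_def signed_integral_def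
    by (simp add: set_integral_diff int vector_measure_on_variations_finite[OF \<mu> \<Omega>] sum_subtractf[symmetric] algebra_simps)
qed

text \<open>Dominated convergence with respect to each of the six finite variation measures.\<close>

lemma vector_integral_tendsto:
  assumes \<mu>: "vector_measure_on \<Omega> \<mu>" and \<Omega>: "\<Omega> \<in> sets borel"
    and f: "\<And>n::nat. f n \<in> borel_measurable borel" "\<And>n x. norm (f n x) \<le> K"
    and g: "g \<in> borel_measurable borel"
    and lim: "\<And>x. x \<in> \<Omega> \<Longrightarrow> (\<lambda>n. f n x) \<longlonglongrightarrow> g x"
  shows "(\<lambda>n. vector_integral \<Omega> \<mu> \<Omega> (f n)) \<longlonglongrightarrow> vector_integral \<Omega> \<mu> \<Omega> g"
proof -
  have m: "(\<lambda>x. f n x $ i) \<in> borel_measurable borel" "(\<lambda>x. g x $ i) \<in> borel_measurable borel" for i n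
    by (intro borel_measurable_vec_component f g)+
  have b: "\<bar>f n x $ i\<bar> \<le> K" for n x i
    using f(2)[of n x] component_le_norm_cart[of "f n x" i] by linarith
  have "(\<lambda>n. LINT x:\<Omega>|M. f n x $ i) \<longlonglongrightarrow> (LINT x:\<Omega>|M. g x $ i)"
    if fin: "finite_measure M" and M: "M = upper_variation \<Omega> w" for i M w
    unfolding set_lebesgue_integral_def
  proof (rule integral_dominated_convergence)
    show "integrable M (\<lambda>x. K)" using fin by (simp add: finite_measure.integrable_const)
    show "(\<lambda>x. indicat_real \<Omega> x *\<^sub>R g x $ i) \<in> borel_measurable M"
      "(\<lambda>x. indicat_real \<Omega> x *\<^sub>R f n x $ i) \<in> borel_measurable M" for n
      unfolding M
      by (intro borel_measurable_upper_variation borel_measurable_scaleR borel_measurable_indicator m; use \<Omega> in simp)+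
    show "AE x in M. (\<lambda>n. indicat_real \<Omega> x *\<^sub>R f n x $ i) \<longlonglongrightarrow> indicat_real \<Omega> x *\<^sub>R g x $ i"
      by (rule AE_I2) (use lim in \<open>auto simp: M intro: tendsto_vec_nth\<close>)
    show "AE x in M. norm (indicat_real \<Omega> x *\<^sub>R f n x $ i) \<le> K" for n
      using b by (intro AE_I2) (auto simp: M)
  qed
  then show ?thesis
    unfolding vector_integral_def signed_integral_def
    by (intro tendsto_sum tendsto_diff)
       (simp_all add: vector_measure_on_variations_finite[OF \<mu> \<Omega>])
qed

lemma vector_integral_indicator:
  assumes "B \<subseteq> A"
  shows "vector_integral \<Omega> \<mu> A (\<lambda>x. indicator B x *\<^sub>R f x) = vector_integral \<Omega> \<mu> B f"
proof -
  have "indicat_real A x *\<^sub>R (indicat_real B x *\<^sub>R f x) $ i = indicat_real B x *\<^sub>R f x $ i" for x i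
    using assms by (auto simp: indicator_def)
  then show ?thesis
    unfolding vector_integral_def signed_integral_def set_lebesgue_integral_def by (simp only:)
qed

section \<open>Mollification of Lipschitz functions\<close>

lemma integrable_lborel_bounded_support:
  fixes h :: "'a::euclidean_space \<Rightarrow> 'b::euclidean_space"
  assumes h: "h \<in> borel_measurable borel" and K: "\<And>x. norm (h x) \<le> K"
    and supp: "\<And>x. x \<notin> cbox a b \<Longrightarrow> h x = 0"
  shows "integrable lborel h"
proof (rule Bochner_Integration.integrable_bound)
  show "integrable lborel (\<lambda>x. K * indicator (cbox a b) x :: real)"
    using emeasure_lborel_cbox_finite[of a b]
    by (intro integrable_mult_right integrable_real_indicator) (simp_all add: less_top)
  have K0: "0 \<le> K" using order_trans[OF norm_ge_zero K] .
  show "AE x in lborel. norm (h x) \<le> norm (K * indicat_real (cbox a b) x)"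
    by (rule AE_I2) (use K supp K0 in \<open>auto simp: indicator_def\<close>)
qed (use h in simp)

lemma integral_lborel_eq_cbox:
  fixes h :: "'a::euclidean_space \<Rightarrow> 'b::euclidean_space"
  assumes "integrable lborel h" and supp: "\<And>x. x \<notin> cbox a b \<Longrightarrow> h x = 0"
  shows "(h has_integral (LINT x|lborel. h x)) (cbox a b)"
proof -
  have "(h has_integral (LINT x|lborel. h x)) UNIV"
    by (rule has_integral_integral_lborel[OF assms(1)])
  then have "((\<lambda>x. if x \<in> cbox a b then h x else 0) has_integral (LINT x|lborel. h x)) UNIV"
    by (rule has_integral_eq[rotated]) (use supp in auto)
  then show ?thesis by (subst (asm) has_integral_restrict_UNIV)
qed

lemma integral_lborel_translate:
  fixes h :: "'a::euclidean_space \<Rightarrow> 'b::{banach, second_countable_topology}"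
  assumes h: "h \<in> borel_measurable borel"
  shows "(LINT y|lborel. h (x + y)) = (LINT z|lborel. h z)"
proof -
  have "(LINT z|distr lborel borel ((+) x). h z) = (LINT y|lborel. h (x + y))"
    by (rule integral_distr) (use h in simp_all)
  then show ?thesis by (simp only: lborel_distr_plus)
qed

definition mollifier :: "real \<Rightarrow> real^'n \<Rightarrow> real" where
  "mollifier e y = bump (y /\<^sub>R e) / (e ^ CARD('n) * bump_mass TYPE('n))"

text \<open>Mollification with translates \<open>x + y\<close> in place of the customary \<open>x - y\<close>, matching the corner cubes.\<close>

definition mollify :: "real \<Rightarrow> (real^'n \<Rightarrow> 'b::euclidean_space) \<Rightarrow> real^'n \<Rightarrow> 'b" where
  "mollify e f x = (LINT y|lborel. mollifier e y *\<^sub>R f (x + y))"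

lemma Ck_on_mollifier: "Ck_on k UNIV (mollifier e)"
  using Ck_on_bump_scaled[of k "1 / (e ^ CARD('a) * bump_mass TYPE('a))" "inverse e"]
  by (simp add: mollifier_def[abs_def])

lemma continuous_on_mollifier: "continuous_on UNIV (mollifier e)"
  using Ck_on_mollifier[of 0] by simp

lemma borel_measurable_mollifier [measurable]: "mollifier e \<in> borel_measurable borel"
  by (rule borel_measurable_continuous_onI[OF continuous_on_mollifier])

context
  fixes e :: real
  assumes e: "e > 0"
begin

lemma mollifier_nonneg: "mollifier e (y::real^'n) \<ge> 0"
  using e bump_mass_pos[where 'n='n] by (simp add: mollifier_def bump_nonneg less_imp_le)

lemma mollifier_le: "mollifier e (y::real^'n) \<le> 1 / (e ^ CARD('n) * bump_mass TYPE('n))"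
  unfolding mollifier_def
  by (rule divide_right_mono[OF bump_le_1]) (use e bump_mass_pos[where 'n='n] in \<open>simp add: less_imp_le\<close>)

lemma mollifier_bound_nonneg: "0 \<le> 1 / (e ^ CARD('n::finite) * bump_mass TYPE('n))"
  using e bump_mass_pos[where 'n='n] by (simp add: less_imp_le)

lemma mollifier_eq_0: "y \<notin> cbox 0 (e *\<^sub>R One) \<Longrightarrow> mollifier e (y::real^'n) = 0"
proof -
  assume y: "y \<notin> cbox 0 (e *\<^sub>R One)"
  have "y /\<^sub>R e \<notin> cbox 0 One"
    using y e by (simp add: mem_box_cart field_simps)
  then show ?thesis by (simp add: mollifier_def bump_eq_0)
qed

lemma integrable_mollifier: "integrable lborel (mollifier e :: real^'n \<Rightarrow> real)"
  by (rule integrable_lborel_bounded_support[of _ "1 / (e ^ CARD('n) * bump_mass TYPE('n))" 0 "e *\<^sub>R One"])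
     (simp_all add: mollifier_nonneg mollifier_le mollifier_eq_0)

lemma integral_mollifier: "(LINT y|lborel. mollifier e (y::real^'n)) = 1"
proof -
  have ne: "cbox 0 (One::real^'n) \<noteq> {}" by (simp add: box_ne_empty)
  have "continuous_on (cbox 0 One) (bump :: real^'n \<Rightarrow> real)"
    by (rule continuous_on_subset[OF continuous_on_bump]) simp
  then have "((bump :: real^'n \<Rightarrow> real) has_integral bump_mass TYPE('n)) (cbox 0 One)"
    unfolding bump_mass_def by (intro integrable_integral integrable_continuous)
  from has_integral_affinity[OF this, of "inverse e" 0]
  have "((\<lambda>x::real^'n. bump (x /\<^sub>R e)) has_integral (e ^ CARD('n) * bump_mass TYPE('n)))
      ((\<lambda>x. e *\<^sub>R x) ` cbox 0 One)"
    using e by (simp add: divide_inverse power_inverse)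
  moreover have "(\<lambda>x. e *\<^sub>R x) ` cbox 0 (One::real^'n) = cbox 0 (e *\<^sub>R One)"
    using e ne by (subst image_smult_cbox) simp_all
  ultimately have "((\<lambda>x::real^'n. bump (x /\<^sub>R e)) has_integral (e ^ CARD('n) * bump_mass TYPE('n)))
      (cbox 0 (e *\<^sub>R One))" by simp
  from has_integral_divide[OF this, of "e ^ CARD('n) * bump_mass TYPE('n)"]
  have "((mollifier e :: real^'n \<Rightarrow> real) has_integral 1) (cbox 0 (e *\<^sub>R One))"
    using e bump_mass_pos[where 'n='n] by (simp add: mollifier_def[abs_def])
  moreover have "((mollifier e :: real^'n \<Rightarrow> real) has_integral (LINT y|lborel. mollifier e (y::real^'n))) (cbox 0 (e *\<^sub>R One))"
    by (rule integral_lborel_eq_cbox[OF integrable_mollifier mollifier_eq_0])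
  ultimately show ?thesis by (rule has_integral_unique[symmetric])
qed

lemma integrable_mollify:
  fixes f :: "real^'n \<Rightarrow> 'b::euclidean_space"
  assumes f [measurable]: "f \<in> borel_measurable borel" and K: "\<And>x. norm (f x) \<le> K"
  shows "integrable lborel (\<lambda>y. mollifier e y *\<^sub>R f (x + y))"
proof (rule integrable_lborel_bounded_support[of _ "1 / (e ^ CARD('n) * bump_mass TYPE('n)) * K" 0 "e *\<^sub>R One"])
  show "norm (mollifier e y *\<^sub>R f (x + y)) \<le> 1 / (e ^ CARD('n) * bump_mass TYPE('n)) * K" for y
    unfolding norm_scaleR
    by (intro mult_mono K mollifier_bound_nonneg) (simp_all add: mollifier_nonneg mollifier_le)
qed (auto simp: mollifier_eq_0)

lemma norm_mollify_diff_le: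
  fixes f :: "real^'n \<Rightarrow> 'b::euclidean_space"
  assumes f [measurable]: "f \<in> borel_measurable borel" and K: "\<And>x. norm (f x) \<le> K"
  shows "norm (mollify e f x - c) \<le> (LINT y|lborel. mollifier e y * norm (f (x + y) - c))"
proof -
  have "mollify e f x - c = mollify e f x - (LINT y|lborel. mollifier e (y::real^'n)) *\<^sub>R c"
    by (simp add: integral_mollifier)
  also have "\<dots> = (LINT y|lborel. mollifier e y *\<^sub>R f (x + y)) - (LINT y|lborel. mollifier e (y::real^'n) *\<^sub>R c)"
    by (simp add: mollify_def integrable_mollifier)
  also have "\<dots> = (LINT y|lborel. mollifier e y *\<^sub>R f (x + y) - mollifier e y *\<^sub>R c)"
    by (intro Bochner_Integration.integral_diff[symmetric] integrable_mollify[OF f K] integrable_scaleR_left)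
       (rule integrable_mollifier)
  also have "norm \<dots> \<le> (LINT y|lborel. norm (mollifier e y *\<^sub>R f (x + y) - mollifier e y *\<^sub>R c))"
    by (rule integral_norm_bound)
  also have "\<dots> = (LINT y|lborel. mollifier e y * norm (f (x + y) - c))"
    by (simp add: scaleR_diff_right[symmetric] mollifier_nonneg)
  finally show ?thesis .
qed

lemma norm_mollify_diff_le_const:
  fixes f :: "real^'n \<Rightarrow> 'b::euclidean_space"
  assumes f [measurable]: "f \<in> borel_measurable borel" and K: "\<And>x. norm (f x) \<le> K"
    and B: "\<And>y. y \<in> cbox 0 (e *\<^sub>R One) \<Longrightarrow> norm (f (x + y) - c) \<le> B"
  shows "norm (mollify e f x - c) \<le> B"
proof -
  have bd: "norm (norm (f z - c)) \<le> K + norm c" for z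
    using norm_triangle_ineq4[of "f z" c] K[of z] by simp
  have "norm (mollify e f x - c) \<le> (LINT y|lborel. mollifier e y * norm (f (x + y) - c))"
    by (rule norm_mollify_diff_le[OF f K])
  also have "\<dots> \<le> (LINT y|lborel. mollifier e (y::real^'n) * B)"
  proof (rule integral_mono)
    show "integrable lborel (\<lambda>y. mollifier e y * norm (f (x + y) - c))"
      using integrable_mollify[of "\<lambda>z. norm (f z - c)", OF _ bd, of x] by simp
    show "integrable lborel (\<lambda>y::real^'n. mollifier e y * B)"
      by (intro integrable_mult_left integrable_mollifier)
    show "mollifier e y * norm (f (x + y) - c) \<le> mollifier e y * B" for y
      using mollifier_eq_0[of y] mollifier_nonneg[of y] B[of y]
      by (cases "y \<in> cbox 0 (e *\<^sub>R One)") (auto intro: mult_left_mono)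
  qed
  also have "\<dots> = B" by (simp add: integral_mollifier)
  finally show ?thesis .
qed

lemma norm_mollify_le:
  fixes f :: "real^'n \<Rightarrow> 'b::euclidean_space"
  assumes f: "f \<in> borel_measurable borel" and K: "\<And>x. norm (f x) \<le> K"
  shows "norm (mollify e f x) \<le> K"
  using norm_mollify_diff_le_const[OF f K, of x 0 K] K by simp

text \<open>The substitution \<open>z = x + y\<close> moves the dependence on \<open>x\<close> into the kernel, where it is smooth.\<close>

lemma mollify_eq_convolution:
  fixes f :: "real^'n \<Rightarrow> 'b::euclidean_space"
  assumes f [measurable]: "f \<in> borel_measurable borel" and K: "\<And>x. norm (f x) \<le> K"
    and supp: "\<And>x. x \<notin> cbox a b \<Longrightarrow> f x = 0"
  shows "mollify e f x = integral (cbox a b) (\<lambda>z. mollifier e (z - x) *\<^sub>R f z)"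
proof -
  have "(LINT y|lborel. mollifier e (x + y - x) *\<^sub>R f (x + y)) = (LINT z|lborel. mollifier e (z - x) *\<^sub>R f z)"
    by (rule integral_lborel_translate) measurable
  then have eq: "mollify e f x = (LINT z|lborel. mollifier e (z - x) *\<^sub>R f z)"
    by (simp add: mollify_def)
  have "integrable lborel (\<lambda>z. mollifier e (z - x) *\<^sub>R f z)"
  proof (rule integrable_lborel_bounded_support[of _ "1 / (e ^ CARD('n) * bump_mass TYPE('n)) * K" a b])
    show "norm (mollifier e (z - x) *\<^sub>R f z) \<le> 1 / (e ^ CARD('n) * bump_mass TYPE('n)) * K" for z
      unfolding norm_scaleR
      by (intro mult_mono K mollifier_bound_nonneg) (simp_all add: mollifier_nonneg mollifier_le)
  qed (auto simp: supp)
  then show ?thesis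
    unfolding eq by (intro integral_unique[symmetric] integral_lborel_eq_cbox) (simp_all add: supp)
qed

text \<open>Mollification commutes with difference quotients, and dominated convergence, with the Lipschitz
  constant as bound, carries this over to the limit.\<close>

lemma partial_deriv_mollify:
  fixes f :: "real^'n \<Rightarrow> 'b::euclidean_space"
  assumes f: "L-lipschitz_on UNIV f" and K: "\<And>x. norm (f x) \<le> K"
    and pd: "partially_differentiable i (mollify e f) x"
  shows "partial_deriv i (mollify e f) x = mollify e (partial_deriv i f) x"
proof -
  have fc: "continuous_on UNIV f" using f by (rule lipschitz_on_continuous_on)
  have fm [measurable]: "f \<in> borel_measurable borel" by (rule borel_measurable_continuous_onI[OF fc])
  have pm [measurable]: "partial_deriv i f \<in> borel_measurable borel" by (rule borel_measurable_partial_deriv[OF fc])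
  have qm [measurable]: "diff_quotient i f t \<in> borel_measurable borel" for t
    by (rule borel_measurable_diff_quotient[OF fm])
  define r where "r k = 1 / real (Suc k)" for k
  have r0: "filterlim r (at 0) sequentially"
    unfolding r_def filterlim_at using LIMSEQ_Suc[OF lim_1_over_n] by (auto simp: always_eventually)
  have quot: "diff_quotient i (mollify e f) t x = mollify e (diff_quotient i f t) x" for t
  proof -
    let ?u = "x + t *\<^sub>R axis i 1"
    have "mollify e f ?u - mollify e f x =
      (LINT y|lborel. mollifier e y *\<^sub>R f (?u + y) - mollifier e y *\<^sub>R f (x + y))"
      unfolding mollify_def
      by (rule Bochner_Integration.integral_diff[symmetric]) (rule integrable_mollify[OF fm K])+
    then have "diff_quotient i (mollify e f) t x =
        (LINT y|lborel. (mollifier e y *\<^sub>R f (?u + y) - mollifier e y *\<^sub>R f (x + y)) /\<^sub>R t)"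
      by (simp add: diff_quotient_def)
    also have "\<dots> = mollify e (diff_quotient i f t) x"
      unfolding mollify_def
      by (rule Bochner_Integration.integral_cong)
         (simp_all add: diff_quotient_def scaleR_diff_right add_ac mult.commute)
    finally show ?thesis .
  qed
  have "(\<lambda>k. diff_quotient i (mollify e f) (r k) x) \<longlonglongrightarrow> mollify e (partial_deriv i f) x"
    unfolding quot unfolding mollify_def
  proof (rule integral_dominated_convergence[where w="\<lambda>y. mollifier e y * L"])
    show "integrable lborel (\<lambda>y::real^'n. mollifier e y * L)"
      by (intro integrable_mult_left integrable_mollifier)
    have "AE y in lborel. partially_differentiable i f y"
      by (rule lipschitz_AE_partially_differentiable[OF f])
    then have "AE y in distr lborel borel ((+) x). partially_differentiable i f y"
      by (simp only: lborel_distr_plus)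
    then have "AE y in lborel. partially_differentiable i f (x + y)"
      by (rule AE_distrD[rotated]) simp
    then show "AE y in lborel. (\<lambda>k. mollifier e y *\<^sub>R diff_quotient i f (r k) (x + y)) \<longlonglongrightarrow>
        mollifier e y *\<^sub>R partial_deriv i f (x + y)"
      by eventually_elim
         (intro tendsto_scaleR tendsto_const filterlim_compose[OF diff_quotient_tendsto r0])
    show "AE y in lborel. norm (mollifier e y *\<^sub>R diff_quotient i f (r k) (x + y)) \<le> mollifier e y * L" for k
      by (rule AE_I2) (simp add: mollifier_nonneg norm_diff_quotient_le[OF f] mult_left_mono)
  qed measurable
  moreover have "(\<lambda>k. diff_quotient i (mollify e f) (r k) x) \<longlonglongrightarrow> partial_deriv i (mollify e f) x"
    by (rule filterlim_compose[OF diff_quotient_tendsto[OF pd] r0])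
  ultimately show ?thesis by (rule LIMSEQ_unique[symmetric])
qed

end

text \<open>The points \<open>x\<close> in question are Lebesgue points in the strong sense that the averages of
  \<open>norm (g z - g x)\<close> vanish in the limit. They are reached by applying the differentiation theorem for
  integrals to the functions \<open>norm (g z - q)\<close> with \<open>q\<close> in a countable dense set.\<close>

lemma cube_average_near_Lebesgue_point:
  fixes g :: "real^'n \<Rightarrow> 'b::euclidean_space"
  assumes g [measurable]: "g \<in> borel_measurable borel" and K: "\<And>x. norm (g x) \<le> K"
  shows "\<exists>N. negligible N \<and> (\<forall>x. x \<notin> N \<longrightarrow> (\<forall>\<epsilon>>0. \<exists>q. norm (g x - q) < \<epsilon> \<and>
     (\<exists>d>0. \<forall>h. 0 < h \<and> h < d \<longrightarrow>
        integral (cbox x (x + h *\<^sub>R One)) (\<lambda>z. norm (g z - q)) / h ^ CARD('n) < 2 * \<epsilon>)))"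
proof -
  obtain D :: "'b set" where D: "countable D" "\<And>U. open U \<Longrightarrow> U \<noteq> {} \<Longrightarrow> \<exists>d\<in>D. d \<in> U"
    using countable_dense_exists[where 'a='b] by (elim exE conjE) simp
  have "\<exists>N. negligible N \<and> (\<forall>x \<epsilon>. x \<notin> N \<longrightarrow> 0 < \<epsilon> \<longrightarrow> (\<exists>d>0. \<forall>h. 0 < h \<and> h < d \<longrightarrow>
      norm (integral (cbox x (x + h *\<^sub>R One)) (\<lambda>z. norm (g z - q)) /\<^sub>R h ^ DIM(real^'n) - norm (g x - q)) < \<epsilon>))"
    for q
  proof -
    have int: "(\<lambda>z. norm (g z - q)) integrable_on cbox a b" for a b
    proof -
      have "integrable lborel (\<lambda>z. indicat_real (cbox a b) z *\<^sub>R norm (g z - q))"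
      proof (rule integrable_lborel_bounded_support[of _ "K + norm q"])
        show "norm (indicat_real (cbox a b) z *\<^sub>R norm (g z - q)) \<le> K + norm q" for z
          using norm_triangle_ineq4[of "g z" q] K[of z] order_trans[OF norm_ge_zero K[of z]]
          by (auto simp: indicator_def)
      qed (auto simp: indicator_def)
      then have "set_integrable lborel (cbox a b) (\<lambda>z. norm (g z - q))"
        by (simp add: set_integrable_def)
      then show ?thesis by (rule set_borel_integral_eq_integral)
    qed
    show ?thesis
    proof (rule integrable_ccontinuous_explicit[OF int])
      fix N
      assume "negligible N" "\<And>x e. \<lbrakk>x \<notin> N; 0 < e\<rbrakk> \<Longrightarrow> \<exists>d>0. \<forall>h. 0 < h \<and> h < d \<longrightarrow>
        norm (integral (cbox x (x + h *\<^sub>R One)) (\<lambda>z. norm (g z - q)) /\<^sub>R h ^ DIM(real^'n) - norm (g x - q)) < e"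
      then show ?thesis by (intro exI[of _ N]) simp
    qed
  qed
  then obtain N where N: "\<And>q. negligible (N q)" and av: "\<And>q x \<epsilon>. x \<notin> N q \<Longrightarrow> 0 < \<epsilon> \<Longrightarrow> \<exists>d>0. \<forall>h. 0 < h \<and> h < d \<longrightarrow>
      norm (integral (cbox x (x + h *\<^sub>R One)) (\<lambda>z. norm (g z - q)) /\<^sub>R h ^ DIM(real^'n) - norm (g x - q)) < \<epsilon>"
    by metis
  have "negligible (\<Union>q\<in>D. N q)"
    using D(1) N negligible_countable_Union[of "N ` D"] by auto
  moreover have "\<exists>q. norm (g x - q) < \<epsilon> \<and> (\<exists>d>0. \<forall>h. 0 < h \<and> h < d \<longrightarrow>
        integral (cbox x (x + h *\<^sub>R One)) (\<lambda>z. norm (g z - q)) / h ^ CARD('n) < 2 * \<epsilon>)"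
    if x: "x \<notin> (\<Union>q\<in>D. N q)" and \<epsilon>: "\<epsilon> > 0" for x \<epsilon>
  proof -
    obtain q where q: "q \<in> D" "q \<in> ball (g x) \<epsilon>"
      using D(2)[of "ball (g x) \<epsilon>"] \<epsilon> by auto
    then have gq: "norm (g x - q) < \<epsilon>" by (simp add: dist_norm)
    have "x \<notin> N q" using x q by auto
    from av[OF this \<epsilon>] obtain d where d: "d > 0" "\<And>h. 0 < h \<and> h < d \<Longrightarrow>
      norm (integral (cbox x (x + h *\<^sub>R One)) (\<lambda>z. norm (g z - q)) /\<^sub>R h ^ DIM(real^'n) - norm (g x - q)) < \<epsilon>"
      by auto
    have "integral (cbox x (x + h *\<^sub>R One)) (\<lambda>z. norm (g z - q)) / h ^ CARD('n) < 2 * \<epsilon>" if "0 < h \<and> h < d" for h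
      using d(2)[OF that] gq by (simp add: divide_inverse mult.commute)
    then show ?thesis using gq d(1) by (intro exI[of _ q] conjI exI[of _ d]) auto
  qed
  ultimately show ?thesis by (intro exI[of _ "\<Union>q\<in>D. N q"]) simp
qed

text \<open>The kernel is bounded by a constant times the inverse volume of the cube that supports it, so the error
  at \<open>x\<close> is controlled by the cube averages at a Lebesgue point.\<close>

lemma mollify_AE_tendsto:
  fixes g :: "real^'n \<Rightarrow> 'b::euclidean_space"
  assumes g [measurable]: "g \<in> borel_measurable borel" and K: "\<And>x. norm (g x) \<le> K"
  shows "\<exists>N. negligible N \<and> (\<forall>x. x \<notin> N \<longrightarrow> ((\<lambda>e. mollify e g x) \<longlongrightarrow> g x) (at_right 0))"
proof -
  obtain N where N: "negligible N" and av: "\<And>x \<epsilon>. x \<notin> N \<Longrightarrow> \<epsilon> > 0 \<Longrightarrow> \<exists>q. norm (g x - q) < \<epsilon> \<and>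
     (\<exists>d>0. \<forall>h. 0 < h \<and> h < d \<longrightarrow>
        integral (cbox x (x + h *\<^sub>R One)) (\<lambda>z. norm (g z - q)) / h ^ CARD('n) < 2 * \<epsilon>)"
    using cube_average_near_Lebesgue_point[OF g K] by auto
  let ?m = "bump_mass TYPE('n)"
  have m: "?m > 0" by (rule bump_mass_pos)
  have "((\<lambda>e. mollify e g x) \<longlongrightarrow> g x) (at_right 0)" if x: "x \<notin> N" for x
  proof (rule tendstoI)
    fix \<eta> :: real assume \<eta>: "\<eta> > 0"
    \<comment> \<open>The error will be at most \<open>2 \<epsilon> / ?m\<close> from the cube average and \<open>\<epsilon>\<close> from replacing \<open>g x\<close> by \<open>q\<close>.\<close>
    define \<epsilon> where "\<epsilon> = \<eta> / (2 / ?m + 2)"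
    have \<epsilon>: "\<epsilon> > 0" using \<eta> m by (simp add: \<epsilon>_def add_pos_pos)
    from av[OF x this] obtain q d where q: "norm (g x - q) < \<epsilon>" and d: "d > 0"
      and avg: "\<And>h. 0 < h \<and> h < d \<Longrightarrow> integral (cbox x (x + h *\<^sub>R One)) (\<lambda>z. norm (g z - q)) / h ^ CARD('n) < 2 * \<epsilon>"
      by auto
    have "dist (mollify h g x) (g x) < \<eta>" if h: "0 < h" "h < d" for h
    proof -
      define u where "u z = indicat_real (cbox x (x + h *\<^sub>R One)) z * norm (g z - q)" for z
      have um [measurable]: "u \<in> borel_measurable borel" unfolding u_def by measurable
      have ubd: "norm (u z) \<le> K + norm q" for z
        using norm_triangle_ineq4[of "g z" q] K[of z] order_trans[OF norm_ge_zero K[of z]]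
        by (auto simp: indicator_def u_def)
      have u0: "z \<notin> cbox x (x + h *\<^sub>R One) \<Longrightarrow> u z = 0" for z by (simp add: u_def)
      have ui: "integrable lborel u"
        by (rule integrable_lborel_bounded_support[OF um ubd u0])
      have mem: "y \<in> cbox 0 (h *\<^sub>R One) \<longleftrightarrow> x + y \<in> cbox x (x + h *\<^sub>R One)" for y :: "real^'n"
        by (simp add: mem_box_cart)
      have "norm (mollify h g x - q) \<le> (LINT y|lborel. mollifier h y * norm (g (x + y) - q))"
        by (rule norm_mollify_diff_le[OF h(1) g K])
      also have "\<dots> = (LINT y|lborel. mollifier h y * u (x + y))"
        by (rule Bochner_Integration.integral_cong)
           (use mollifier_eq_0[OF h(1)] mem in \<open>auto simp: u_def indicator_def\<close>)
      also have "\<dots> \<le> (LINT y|lborel. 1 / (h ^ CARD('n) * ?m) * u (x + y))"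
      proof (rule integral_mono)
        show "integrable lborel (\<lambda>y. mollifier h y * u (x + y))"
          using integrable_mollify[OF h(1) um ubd, of x] by simp
        have "integrable (distr lborel borel ((+) x)) u" using ui by (simp only: lborel_distr_plus)
        then have "integrable lborel (\<lambda>y. u (x + y))" by (rule integrable_distr[rotated]) simp
        then show "integrable lborel (\<lambda>y. 1 / (h ^ CARD('n) * ?m) * u (x + y))"
          by (rule integrable_mult_right)
        show "mollifier h y * u (x + y) \<le> 1 / (h ^ CARD('n) * ?m) * u (x + y)" for y
          by (rule mult_right_mono[OF mollifier_le[OF h(1)]]) (simp add: u_def)
      qed
      also have "\<dots> = 1 / (h ^ CARD('n) * ?m) * (LINT z|lborel. u z)"
        by (simp add: integral_lborel_translate[OF um])
      also have "(LINT z|lborel. u z) = integral (cbox x (x + h *\<^sub>R One)) u"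
        by (rule integral_unique[symmetric, OF integral_lborel_eq_cbox[OF ui u0]])
      also have "\<dots> = integral (cbox x (x + h *\<^sub>R One)) (\<lambda>z. norm (g z - q))"
        by (rule Henstock_Kurzweil_Integration.integral_cong) (simp add: u_def)
      also have "1 / (h ^ CARD('n) * ?m) * \<dots> = (\<dots> / h ^ CARD('n)) / ?m"
        by simp
      also have "\<dots> < 2 * \<epsilon> / ?m"
        using avg[of h] h m by (intro divide_strict_right_mono) auto
      finally have "norm (mollify h g x - q) < 2 * \<epsilon> / ?m" .
      moreover have "dist (mollify h g x) (g x) \<le> norm (mollify h g x - q) + norm (g x - q)"
        using norm_triangle_ineq4[of "mollify h g x - q" "g x - q"] by (simp add: dist_norm)
      moreover have "2 * \<epsilon> / ?m + \<epsilon> + \<epsilon> = \<epsilon> * (2 / ?m + 2)" by (simp add: algebra_simps)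
      moreover have "\<epsilon> * (2 / ?m + 2) = \<eta>"
        using m by (simp add: \<epsilon>_def add_pos_pos less_imp_neq[symmetric])
      ultimately show ?thesis using q \<epsilon> by linarith
    qed
    then show "eventually (\<lambda>e. dist (mollify e g x) (g x) < \<eta>) (at_right 0)"
      using d by (auto simp: eventually_at_right_field)
  qed
  then show ?thesis using N by (intro exI[of _ N]) simp
qed

section \<open>Lipschitz test fields\<close>

lemma compactly_supported_inI:
  fixes f :: "'a::t2_space \<Rightarrow> 'b::zero"
  assumes T: "compact T" "T \<subseteq> \<Omega>" and f: "{x. f x \<noteq> 0} \<subseteq> T"
  shows "compactly_supported_in \<Omega> f"
proof -
  have cl: "closure {x. f x \<noteq> 0} \<subseteq> T" by (intro closure_minimal f compact_imp_closed T)
  show ?thesis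
    using compact_Int_closed[OF T(1) closed_closure, of "{x. f x \<noteq> 0}"] order_trans[OF cl T(2)]
    unfolding compactly_supported_in_def Int_absorb1[OF cl] by (rule conjI)
qed

lemma norm_cube_le:
  fixes y :: "real^'n"
  assumes "y \<in> cbox 0 (e *\<^sub>R One)"
  shows "norm y \<le> real CARD('n) * e"
proof -
  have "norm y \<le> (\<Sum>i\<in>UNIV. \<bar>y $ i\<bar>)" by (rule norm_le_l1_cart)
  also have "\<dots> \<le> (\<Sum>i\<in>(UNIV::'n set). e)"
    using assms by (intro sum_mono) (auto simp: mem_box_cart)
  finally show ?thesis by simp
qed

lemma Lip_cE:
  assumes "f \<in> Lip_c \<Omega>"
  obtains L K a b where "L-lipschitz_on UNIV f" "\<And>x. norm (f x) \<le> K" "\<And>x. x \<notin> cbox a b \<Longrightarrow> f x = 0"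
proof -
  obtain L where L: "L-lipschitz_on UNIV f" and cs: "compactly_supported_in \<Omega> f"
    using assms by (auto simp: Lip_c_def)
  let ?S = "closure {x. f x \<noteq> 0}"
  have S: "compact ?S" using cs by (simp add: compactly_supported_in_def)
  have zero: "x \<notin> ?S \<Longrightarrow> f x = 0" for x using closure_subset[of "{x. f x \<noteq> 0}"] by auto
  obtain a b where ab: "?S \<subseteq> cbox a b"
    using compact_imp_bounded[OF S] bounded_subset_cbox_symmetric by metis
  have "continuous_on ?S f"
    by (rule continuous_on_subset[OF lipschitz_on_continuous_on[OF L]]) simp
  then have "bounded (f ` ?S)" using S by (intro compact_imp_bounded compact_continuous_image)
  then obtain K where K: "K > 0" "\<And>x. x \<in> ?S \<Longrightarrow> norm (f x) \<le> K"
    by (auto simp: bounded_pos)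
  have "norm (f x) \<le> K" for x using K zero[of x] by (cases "x \<in> ?S") auto
  moreover have "f x = 0" if "x \<notin> cbox a b" for x using that ab zero by blast
  ultimately show ?thesis using L that by blast
qed

lemma Lip_c_borel_measurable:
  assumes "f \<in> Lip_c \<Omega>" shows "f \<in> borel_measurable borel"
proof (rule Lip_cE[OF assms])
  fix L assume "L-lipschitz_on UNIV f"
  then show ?thesis by (intro borel_measurable_continuous_onI lipschitz_on_continuous_on)
qed

text \<open>The bound extends to the points without a partial derivative, because \<open>partial_deriv\<close> takes a single
  value at all of them.\<close>

lemma partial_deriv_bounded:
  assumes "L-lipschitz_on UNIV f"
  shows "\<exists>K. \<forall>i x. norm (partial_deriv i f x) \<le> K"
proof (intro exI allI)
  fix i x
  show "norm (partial_deriv i f x) \<le> L + norm (SOME d::'b. False)"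
  proof (cases "partially_differentiable i f x")
    case True
    then show ?thesis using norm_partial_deriv_le[OF assms, of i x] by (simp add: add_increasing2)
  next
    case False
    then have "partial_deriv i f x = (SOME d. False)"
      unfolding partially_differentiable_def partial_deriv_def vector_derivative_def
      by (metis differentiableI_vector)
    then show ?thesis using lipschitz_on_nonneg[OF assms] by simp
  qed
qed

lemma curl_nth:
  "curl f x $ 1 = partial_deriv 2 f x $ 3 - partial_deriv 3 f x $ 2"
  "curl f x $ 2 = partial_deriv 3 f x $ 1 - partial_deriv 1 f x $ 3"
  "curl f x $ 3 = partial_deriv 1 f x $ 2 - partial_deriv 2 f x $ 1"
  by (simp_all add: curl_def)

lemma norm_curl_le:
  assumes "\<And>i. norm (partial_deriv i f x) \<le> K"
  shows "norm (curl f x) \<le> 6 * K"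
proof -
  have c: "\<bar>partial_deriv i f x $ j\<bar> \<le> K" for i j
    using component_le_norm_cart[of "partial_deriv i f x" j] assms[of i] by linarith
  have d: "\<bar>partial_deriv i f x $ j - partial_deriv k f x $ l\<bar> \<le> 2 * K" for i j k l
    using c[of i j] c[of k l] by linarith
  have "norm (curl f x) \<le> (\<Sum>i\<in>UNIV. \<bar>curl f x $ i\<bar>)" by (rule norm_le_l1_cart)
  also have "\<dots> \<le> 2 * K + 2 * K + 2 * K"
    unfolding sum_3 curl_nth by (intro add_mono d)
  finally show ?thesis by simp
qed

lemma tendsto_curl:
  assumes "\<And>i. ((\<lambda>n. partial_deriv i (f n) x) \<longlongrightarrow> partial_deriv i g x) F"
  shows "((\<lambda>n. curl (f n) x) \<longlongrightarrow> curl g x) F"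
proof (rule vec_tendstoI)
  fix j :: 3
  have c: "((\<lambda>n. partial_deriv i (f n) x $ k) \<longlongrightarrow> partial_deriv i g x $ k) F" for i k
    by (rule tendsto_vec_nth[OF assms])
  show "((\<lambda>n. curl (f n) x $ j) \<longlongrightarrow> curl g x $ j) F"
    using exhaust_3[of j] by (elim disjE) (simp_all add: curl_nth c tendsto_diff)
qed

lemma borel_measurable_vecI:
  fixes f :: "'a \<Rightarrow> real^'n"
  assumes "\<And>i. (\<lambda>x. f x $ i) \<in> borel_measurable M"
  shows "f \<in> borel_measurable M"
  unfolding borel_measurable_euclidean_space[of f]
proof
  fix b :: "real^'n" assume "b \<in> Basis"
  then obtain i where "b = axis i 1" by (auto simp: Basis_vec_def)
  then show "(\<lambda>x. f x \<bullet> b) \<in> borel_measurable M" using assms[of i] by (simp add: inner_axis)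
qed

lemma borel_measurable_curl:
  assumes "continuous_on UNIV f"
  shows "curl f \<in> borel_measurable borel"
proof (rule borel_measurable_vecI)
  fix j :: 3
  have c [measurable]: "(\<lambda>x. partial_deriv i f x $ k) \<in> borel_measurable borel" for i k
    by (rule borel_measurable_vec_component[OF borel_measurable_partial_deriv[OF assms]])
  show "(\<lambda>x. curl f x $ j) \<in> borel_measurable borel"
    using exhaust_3[of j] by (elim disjE) (simp_all add: curl_nth)
qed

lemma curl_Lip_c:
  assumes "f \<in> Lip_c \<Omega>"
  obtains K where "curl f \<in> borel_measurable borel" "\<And>x. norm (curl f x) \<le> K"
proof (rule Lip_cE[OF assms])
  fix L assume L: "L-lipschitz_on UNIV f"
  obtain K where "\<forall>i x. norm (partial_deriv i f x) \<le> K"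
    using partial_deriv_bounded[OF L] by (elim exE)
  then have "norm (curl f x) \<le> 6 * K" for x by (intro norm_curl_le) simp
  then show ?thesis
    by (rule that[OF borel_measurable_curl[OF lipschitz_on_continuous_on[OF L]]])
qed

lemma set_integrable_inner_bounded:
  fixes F h :: "real^3 \<Rightarrow> real^3"
  assumes F: "set_integrable lebesgue \<Omega> F" and A: "A \<in> sets borel" "A \<subseteq> \<Omega>"
    and h: "h \<in> borel_measurable borel" and K: "\<And>x. norm (h x) \<le> K"
  shows "set_integrable lebesgue A (\<lambda>x. F x \<bullet> h x)"
  unfolding set_integrable_def
proof (rule Bochner_Integration.integrable_bound)
  have hl: "h \<in> borel_measurable lebesgue" using h by (intro measurable_completion) simp
  have Fi: "integrable lebesgue (\<lambda>x. indicat_real \<Omega> x *\<^sub>R F x)" using F by (simp add: set_integrable_def)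
  then show "integrable lebesgue (\<lambda>x. norm (indicat_real \<Omega> x *\<^sub>R F x) * K)"
    by (intro integrable_mult_left integrable_norm)
  have "(\<lambda>x. indicat_real A x * ((indicat_real \<Omega> x *\<^sub>R F x) \<bullet> h x)) \<in> borel_measurable lebesgue"
    by (intro borel_measurable_times borel_measurable_inner hl borel_measurable_integrable[OF Fi]
        borel_measurable_indicator) (use A in simp)
  moreover have "indicat_real A x * ((indicat_real \<Omega> x *\<^sub>R F x) \<bullet> h x) = indicat_real A x *\<^sub>R (F x \<bullet> h x)" for x
    using A(2) by (auto simp: indicator_def)
  ultimately show "(\<lambda>x. indicat_real A x *\<^sub>R (F x \<bullet> h x)) \<in> borel_measurable lebesgue"
    by (simp only:)
  have "\<bar>F x \<bullet> h x\<bar> \<le> norm (F x) * K" for x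
    using Cauchy_Schwarz_ineq2[of "F x" "h x"] mult_left_mono[OF K[of x] norm_ge_zero[of "F x"]] by linarith
  then show "AE x in lebesgue. norm (indicat_real A x *\<^sub>R (F x \<bullet> h x)) \<le> norm (norm (indicat_real \<Omega> x *\<^sub>R F x) * K)"
    using A(2) order_trans[OF norm_ge_zero K] by (intro AE_I2) (auto simp: indicator_def)
qed

lemma set_integral_inner_tendsto:
  fixes F g :: "real^3 \<Rightarrow> real^3" and f :: "nat \<Rightarrow> real^3 \<Rightarrow> real^3"
  assumes F: "set_integrable lebesgue \<Omega> F"
    and f: "\<And>n. f n \<in> borel_measurable borel" and g: "g \<in> borel_measurable borel"
    and K: "\<And>n. AE x in lebesgue. norm (f n x) \<le> K"
    and lim: "AE x in lebesgue. (\<lambda>n. f n x) \<longlonglongrightarrow> g x"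
  shows "(\<lambda>n. LINT x:\<Omega>|lebesgue. F x \<bullet> f n x) \<longlonglongrightarrow> (LINT x:\<Omega>|lebesgue. F x \<bullet> g x)"
  unfolding set_lebesgue_integral_def
proof (rule integral_dominated_convergence)
  have Fi: "integrable lebesgue (\<lambda>x. indicat_real \<Omega> x *\<^sub>R F x)" using F by (simp add: set_integrable_def)
  then show "integrable lebesgue (\<lambda>x. norm (indicat_real \<Omega> x *\<^sub>R F x) * K)"
    by (intro integrable_mult_left integrable_norm)
  have meas: "(\<lambda>x. indicat_real \<Omega> x *\<^sub>R (F x \<bullet> h x)) \<in> borel_measurable lebesgue"
    if "h \<in> borel_measurable borel" for h
  proof -
    have "(\<lambda>x. (indicat_real \<Omega> x *\<^sub>R F x) \<bullet> h x) \<in> borel_measurable lebesgue"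
      by (intro borel_measurable_inner borel_measurable_integrable[OF Fi] measurable_completion)
         (use that in simp)
    then show ?thesis by simp
  qed
  show "(\<lambda>x. indicat_real \<Omega> x *\<^sub>R (F x \<bullet> g x)) \<in> borel_measurable lebesgue" by (rule meas[OF g])
  show "(\<lambda>x. indicat_real \<Omega> x *\<^sub>R (F x \<bullet> f n x)) \<in> borel_measurable lebesgue" for n by (rule meas[OF f])
  show "AE x in lebesgue. (\<lambda>n. indicat_real \<Omega> x *\<^sub>R (F x \<bullet> f n x)) \<longlonglongrightarrow> indicat_real \<Omega> x *\<^sub>R (F x \<bullet> g x)"
    using lim by eventually_elim (intro tendsto_intros)
  show "AE x in lebesgue. norm (indicat_real \<Omega> x *\<^sub>R (F x \<bullet> f n x)) \<le> norm (indicat_real \<Omega> x *\<^sub>R F x) * K" for n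
    using K[of n]
  proof eventually_elim
    case (elim x)
    have "\<bar>F x \<bullet> f n x\<bar> \<le> norm (F x) * K"
      using Cauchy_Schwarz_ineq2[of "F x" "f n x"] mult_left_mono[OF elim norm_ge_zero[of "F x"]] by linarith
    then show ?case by (auto simp: indicator_def)
  qed
qed

text \<open>On a bounded set \<open>L\<^sup>p\<close> is contained in \<open>L\<^sup>1\<close>, because \<open>t \<le> 1 + t powr p\<close>.\<close>

lemma CM_set_integrable:
  assumes F: "F \<in> CM p \<Omega>" and p: "1 \<le> p" and \<Omega>: "open \<Omega>" "bounded \<Omega>"
  shows "set_integrable lebesgue \<Omega> F"
  unfolding set_integrable_def
proof (rule Bochner_Integration.integrable_bound)
  have \<Omega>l: "\<Omega> \<in> lmeasurable" using \<Omega> by (simp add: lmeasurable_open)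
  have "integrable lebesgue (\<lambda>x. indicat_real \<Omega> x)"
    using \<Omega>l by (intro integrable_real_indicator) (auto simp: fmeasurable_def less_top)
  moreover have "integrable lebesgue (\<lambda>x. indicat_real \<Omega> x *\<^sub>R (norm (F x) powr p))"
    using F by (simp add: CM_def set_integrable_def)
  ultimately show "integrable lebesgue (\<lambda>x. indicat_real \<Omega> x + indicat_real \<Omega> x *\<^sub>R (norm (F x) powr p))"
    by (rule Bochner_Integration.integrable_add)
  have "F \<in> borel_measurable (lebesgue_on \<Omega>)" using F by (simp add: CM_def)
  then show "(\<lambda>x. indicat_real \<Omega> x *\<^sub>R F x) \<in> borel_measurable lebesgue"
    using \<Omega>(1) by (subst (asm) borel_measurable_restrict_space_iff) auto
  have "t \<le> 1 + t powr p" if "t \<ge> 0" for t :: real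
  proof (cases "t \<le> 1")
    case False
    then have "t powr 1 \<le> t powr p" using p by (intro powr_mono) auto
    then show ?thesis using False by simp
  qed (simp add: add_increasing2)
  then show "AE x in lebesgue. norm (indicat_real \<Omega> x *\<^sub>R F x)
      \<le> norm (indicat_real \<Omega> x + indicat_real \<Omega> x *\<^sub>R (norm (F x) powr p))"
    by (intro AE_I2) (auto simp: indicator_def)
qed

lemma mollify_in_test_fields:
  assumes f: "f \<in> Lip_c \<Omega>" and \<Omega>: "open \<Omega>"
  shows "\<exists>\<delta>>0. \<forall>e. 0 < e \<and> e < \<delta> \<longrightarrow> mollify e f \<in> test_fields \<Omega>"
proof -
  obtain L K a b where L: "L-lipschitz_on UNIV f" and K: "\<And>x. norm (f x) \<le> K"
    and ab: "\<And>x. x \<notin> cbox a b \<Longrightarrow> f x = 0"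
    using Lip_cE[OF f] by metis
  have fc: "continuous_on UNIV f" by (rule lipschitz_on_continuous_on[OF L])
  have fm: "f \<in> borel_measurable borel" by (rule borel_measurable_continuous_onI[OF fc])
  let ?S = "closure {x. f x \<noteq> 0}"
  have S: "compact ?S" "?S \<subseteq> \<Omega>"
    using f by (simp_all add: Lip_c_def compactly_supported_in_def)
  \<comment> \<open>Mollifying moves the support by vectors of the cube with side \<open>e\<close>, whose norm is at most \<open>3 e\<close>.\<close>
  obtain \<rho> where \<rho>: "\<rho> > 0" "(\<Union>x\<in>?S. ball x \<rho>) \<subseteq> \<Omega>"
    using compact_subset_open_imp_ball_epsilon_subset[OF S(1) \<Omega> S(2)] by auto
  have "mollify e f \<in> test_fields \<Omega>" if e: "0 < e" "e < \<rho> / 3" for e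
  proof -
    have "mollify e f = (\<lambda>x. integral (cbox a b) (\<lambda>z. mollifier e (z - x) *\<^sub>R f z))"
      by (rule ext) (rule mollify_eq_convolution[OF e(1) fm K ab])
    then have Ck: "Ck_on k UNIV (mollify e f)" for k
      by (simp only: Ck_on_convolution[OF fc Ck_on_mollifier])
    define T where "T = {x - y |x y. x \<in> ?S \<and> y \<in> cbox 0 (e *\<^sub>R (One::real^3))}"
    have T: "compact T" unfolding T_def by (intro compact_differences S compact_cbox)
    have T\<Omega>: "T \<subseteq> \<Omega>"
    proof
      fix w assume "w \<in> T"
      then obtain x y where w: "w = x - y" "x \<in> ?S" "y \<in> cbox 0 (e *\<^sub>R (One::real^3))"
        by (auto simp: T_def)
      have "norm y < \<rho>" using norm_cube_le[OF w(3)] e by simp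
      then have "w \<in> ball x \<rho>" by (simp add: w dist_norm)
      then show "w \<in> \<Omega>" using \<rho>(2) w(2) by blast
    qed
    have "{x. mollify e f x \<noteq> 0} \<subseteq> T"
    proof
      fix x assume "x \<in> {x. mollify e f x \<noteq> 0}"
      then have "\<exists>y. mollifier e y *\<^sub>R f (x + y) \<noteq> 0"
        unfolding mollify_def by (metis (mono_tags, lifting) Bochner_Integration.integral_cong integral_zero mem_Collect_eq)
      then obtain y where y: "mollifier e y \<noteq> 0" "f (x + y) \<noteq> 0" by auto
      have "y \<in> cbox 0 (e *\<^sub>R One)" using mollifier_eq_0[OF e(1)] y(1) by blast
      moreover have "x + y \<in> ?S" using y(2) closure_subset[of "{x. f x \<noteq> 0}"] by auto
      moreover have "x = (x + y) - y" by simp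
      ultimately show "x \<in> T" unfolding T_def by blast
    qed
    then have "compactly_supported_in \<Omega> (mollify e f)"
      by (rule compactly_supported_inI[OF T T\<Omega>])
    then show ?thesis using Ck by (simp add: test_fields_def)
  qed
  then show ?thesis using \<rho>(1) by (intro exI[of _ "\<rho> / 3"]) simp
qed

text \<open>The defining identity of the distributional curl extends from smooth to Lipschitz test fields. The
  mollified fields converge uniformly, which suffices on the measure side; their curls are uniformly bounded
  and converge almost everywhere, which suffices for the integral against the integrable field \<open>F\<close>.\<close>

lemma curl_measure_Lip_c:
  assumes \<mu>: "is_curl_measure \<Omega> F \<mu>" and F: "set_integrable lebesgue \<Omega> F"
    and \<Omega>: "open \<Omega>" and f: "f \<in> Lip_c \<Omega>"
  shows "vector_integral \<Omega> \<mu> \<Omega> f = (LINT x:\<Omega>|lebesgue. F x \<bullet> curl f x)"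
proof -
  obtain L K a b where L: "L-lipschitz_on UNIV f" and K: "\<And>x. norm (f x) \<le> K"
    and ab: "\<And>x. x \<notin> cbox a b \<Longrightarrow> f x = 0"
    using Lip_cE[OF f] by metis
  have fc: "continuous_on UNIV f" by (rule lipschitz_on_continuous_on[OF L])
  have fm: "f \<in> borel_measurable borel" by (rule borel_measurable_continuous_onI[OF fc])
  have pm: "partial_deriv i f \<in> borel_measurable borel" for i by (rule borel_measurable_partial_deriv[OF fc])
  obtain K' where K': "\<And>i x. norm (partial_deriv i f x) \<le> K'" using partial_deriv_bounded[OF L] by auto
  obtain \<delta> where \<delta>: "\<delta> > 0" and test: "\<And>e. 0 < e \<and> e < \<delta> \<Longrightarrow> mollify e f \<in> test_fields \<Omega>"
    using mollify_in_test_fields[OF f \<Omega>] by auto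
  define e where "e n = \<delta> / real (n + 2)" for n
  have e: "0 < e n" "e n < \<delta>" for n     using \<delta> divide_strict_left_mono[of 1 "real (n + 2)" \<delta>] by (simp_all add: e_def)
  have "(\<lambda>n. \<delta> * inverse (real (n + 2))) \<longlonglongrightarrow> 0"
    by (intro tendsto_mult_right_zero LIMSEQ_ignore_initial_segment[OF lim_inverse_n])
  then have e0: "e \<longlonglongrightarrow> 0" by (simp add: e_def[abs_def] divide_inverse)
  then have er: "filterlim e (at_right 0) sequentially"
  proof -
    have "e n \<in> {0<..} \<and> e n \<noteq> 0" for n using e(1)[of n] by simp
    then show ?thesis using e0 unfolding filterlim_at by (intro conjI always_eventually allI) auto
  qed
  define g where "g n = mollify (e n) f" for n
  have gt: "g n \<in> test_fields \<Omega>" for n unfolding g_def by (intro test conjI e)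
  have gd: "g n differentiable (at x)" for n x
  proof -
    have "Ck_on (Suc 0) UNIV (g n)" using gt[of n] unfolding test_fields_def by blast
    then show ?thesis by simp
  qed
  have gc: "continuous_on UNIV (g n)" for n
    using gd by (intro continuous_at_imp_continuous_on ballI differentiable_imp_continuous_within) simp
  have pg: "partial_deriv i (g n) x = mollify (e n) (partial_deriv i f) x" for i n x
    unfolding g_def
    by (rule partial_deriv_mollify[OF e(1) L K has_derivative_imp_partial_deriv(1)[OF differentiable_has_derivative]])
       (rule gd[unfolded g_def])
  have lhs: "(\<lambda>n. vector_integral \<Omega> \<mu> \<Omega> (g n)) \<longlonglongrightarrow> vector_integral \<Omega> \<mu> \<Omega> f"
  proof (rule vector_integral_tendsto)
    show "vector_measure_on \<Omega> \<mu>" using \<mu> by (simp add: is_curl_measure_def)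
    show "\<Omega> \<in> sets borel" using \<Omega> by simp
    show "g n \<in> borel_measurable borel" for n by (rule borel_measurable_continuous_onI[OF gc])
    show "norm (g n x) \<le> K" for n x unfolding g_def by (rule norm_mollify_le[OF e(1) fm K])
    show "f \<in> borel_measurable borel" by (rule fm)
    show "(\<lambda>n. g n x) \<longlonglongrightarrow> f x" for x
    proof (rule Lim_transform_bound[where g="\<lambda>n. L * (3 * e n)", THEN LIM_zero_cancel])
      show "eventually (\<lambda>n. norm (g n x - f x) \<le> norm (L * (3 * e n))) sequentially"
      proof (rule always_eventually, rule allI)
        fix n
        have "norm (g n x - f x) \<le> L * (3 * e n)"
          unfolding g_def
        proof (rule norm_mollify_diff_le_const[OF e(1) fm K])
          fix y :: "real^3" assume y: "y \<in> cbox 0 (e n *\<^sub>R One)"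
          have "norm y \<le> 3 * e n" using norm_cube_le[OF y] by simp
          then show "norm (f (x + y) - f x) \<le> L * (3 * e n)"
            using lipschitz_on_normD[OF L, of "x + y" x] mult_left_mono[OF _ lipschitz_on_nonneg[OF L], of "norm y" "3 * e n"]
            by simp
        qed
        then show "norm (g n x - f x) \<le> norm (L * (3 * e n))" by simp
      qed
      show "(\<lambda>n. L * (3 * e n)) \<longlonglongrightarrow> 0"
        by (intro tendsto_mult_right_zero e0)
    qed
  qed
  have rhs: "(\<lambda>n. LINT x:\<Omega>|lebesgue. F x \<bullet> curl (g n) x) \<longlonglongrightarrow> (LINT x:\<Omega>|lebesgue. F x \<bullet> curl f x)"
  proof (rule set_integral_inner_tendsto[OF F])
    show "curl (g n) \<in> borel_measurable borel" for n by (rule borel_measurable_curl[OF gc])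
    show "curl f \<in> borel_measurable borel" by (rule borel_measurable_curl[OF fc])
    have "norm (curl (g n) x) \<le> 6 * K'" for n x
      by (rule norm_curl_le) (unfold pg, rule norm_mollify_le[OF e(1) pm K'])
    then show "AE x in lebesgue. norm (curl (g n) x) \<le> 6 * K'" for n by simp
    have "\<exists>N. negligible N \<and> (\<forall>x. x \<notin> N \<longrightarrow> ((\<lambda>e. mollify e (partial_deriv i f) x) \<longlongrightarrow> partial_deriv i f x) (at_right 0))" for i
      by (rule mollify_AE_tendsto[OF pm K'])
    then obtain N where N: "\<And>i. negligible (N i)" and lim: "\<And>i x. x \<notin> N i \<Longrightarrow>
        ((\<lambda>e. mollify e (partial_deriv i f) x) \<longlongrightarrow> partial_deriv i f x) (at_right 0)" by metis
    have "negligible (\<Union>i\<in>UNIV. N i)" using N by (intro negligible_Union) auto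
    moreover have "(\<lambda>n. curl (g n) x) \<longlonglongrightarrow> curl f x" if "x \<notin> (\<Union>i\<in>UNIV. N i)" for x
      by (rule tendsto_curl, unfold pg) (use that in \<open>auto intro!: filterlim_compose[OF lim er]\<close>)
    ultimately show "AE x in lebesgue. (\<lambda>n. curl (g n) x) \<longlonglongrightarrow> curl f x"
      unfolding negligible_iff_null_sets by (intro AE_I') auto
  qed
  have "vector_integral \<Omega> \<mu> \<Omega> (g n) = (LINT x:\<Omega>|lebesgue. F x \<bullet> curl (g n) x)" for n
    using \<mu> gt by (simp add: is_curl_measure_def)
  then show ?thesis using LIMSEQ_unique[OF lhs] rhs by simp
qed

section \<open>Fields that are normal to the boundary\<close>

definition cutoff :: "(real^'n) set \<Rightarrow> real \<Rightarrow> real^'n \<Rightarrow> real" where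
  "cutoff C e x = min 1 (infdist x C / e)"

lemma cutoff_bounds: "e > 0 \<Longrightarrow> 0 \<le> cutoff C e x" "cutoff C e x \<le> 1"
  by (simp_all add: cutoff_def infdist_nonneg)

lemma cutoff_lipschitz:
  assumes e: "e > 0"
  shows "(1 / e)-lipschitz_on UNIV (cutoff C e)"
proof (rule lipschitz_onI)
  fix x y
  have "\<bar>infdist x C - infdist y C\<bar> \<le> dist x y"
    using infdist_triangle_abs[of x C y] .
  then have "\<bar>infdist x C / e - infdist y C / e\<bar> \<le> dist x y / e"
    using e by (simp add: diff_divide_distrib[symmetric] abs_divide divide_right_mono)
  then show "dist (cutoff C e x) (cutoff C e y) \<le> 1 / e * dist x y"
    unfolding cutoff_def dist_real_def by (simp add: min_def abs_if split: if_splits)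
qed (use e in simp)

lemma lipschitz_on_scaleR_bounded:
  fixes h :: "'a::metric_space \<Rightarrow> real" and f :: "'a \<Rightarrow> 'b::real_normed_vector"
  assumes h: "M-lipschitz_on X h" "\<And>x. x \<in> X \<Longrightarrow> \<bar>h x\<bar> \<le> H"
    and f: "L-lipschitz_on X f" "\<And>x. x \<in> X \<Longrightarrow> norm (f x) \<le> K"
    and "X \<noteq> {}"
  shows "(H * L + M * K)-lipschitz_on X (\<lambda>x. h x *\<^sub>R f x)"
proof (rule lipschitz_onI)
  obtain x where "x \<in> X" using \<open>X \<noteq> {}\<close> by auto
  then have "0 \<le> H" "0 \<le> K" using h(2)[of x] f(2)[of x] order_trans[OF norm_ge_zero] by (auto intro: order_trans[OF abs_ge_zero])
  then show "0 \<le> H * L + M * K"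
    using lipschitz_on_nonneg[OF h(1)] lipschitz_on_nonneg[OF f(1)] by simp
  fix x y assume xy: "x \<in> X" "y \<in> X"
  have "h x *\<^sub>R f x - h y *\<^sub>R f y = h x *\<^sub>R (f x - f y) + (h x - h y) *\<^sub>R f y"
    by (simp add: algebra_simps)
  then have "norm (h x *\<^sub>R f x - h y *\<^sub>R f y) \<le> \<bar>h x\<bar> * norm (f x - f y) + \<bar>h x - h y\<bar> * norm (f y)"
    unfolding norm_scaleR[symmetric] by (simp only: norm_triangle_ineq)
  also have "\<dots> \<le> H * (L * dist x y) + (M * dist x y) * K"
    using lipschitz_onD[OF h(1) xy] lipschitz_onD[OF f(1) xy] h(2)[OF xy(1)] f(2)[OF xy(2)] \<open>0 \<le> H\<close>
    by (intro add_mono mult_mono) (auto simp: dist_norm intro: order_trans[OF norm_ge_zero] order_trans[OF abs_ge_zero])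
  finally show "dist (h x *\<^sub>R f x) (h y *\<^sub>R f y) \<le> (H * L + M * K) * dist x y"
    by (simp add: dist_norm algebra_simps)
qed

lemma Lip_c_mult:
  assumes h: "M-lipschitz_on UNIV h" "\<And>x. \<bar>h x\<bar> \<le> H" and f: "f \<in> Lip_c \<Omega>"
  shows "(\<lambda>x. h x *\<^sub>R f x) \<in> Lip_c \<Omega>"
proof -
  obtain L K a b where L: "L-lipschitz_on UNIV f" and K: "\<And>x. norm (f x) \<le> K"
    using Lip_cE[OF f] by metis
  have lip: "(H * L + M * K)-lipschitz_on UNIV (\<lambda>x. h x *\<^sub>R f x)"
    by (rule lipschitz_on_scaleR_bounded[OF h(1) h(2) L K]) simp
  have c: "compact (closure {x. f x \<noteq> 0})" "closure {x. f x \<noteq> 0} \<subseteq> \<Omega>"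
    using f by (simp_all add: Lip_c_def compactly_supported_in_def)
  have "compactly_supported_in \<Omega> (\<lambda>x. h x *\<^sub>R f x)"
    by (rule compactly_supported_inI[OF c]) (use closure_subset[of "{x. f x \<noteq> 0}"] in auto)
  then show ?thesis using lip unfolding Lip_c_def by auto
qed

lemma Lip_c_diff:
  assumes f: "f \<in> Lip_c \<Omega>" and g: "g \<in> Lip_c \<Omega>"
  shows "(\<lambda>x. f x - g x) \<in> Lip_c \<Omega>"
proof -
  obtain L M where L: "L-lipschitz_on UNIV f" "M-lipschitz_on UNIV g"
    using f g by (auto simp: Lip_c_def)
  have "(L + M)-lipschitz_on UNIV (\<lambda>x. f x - g x)"
    by (rule lipschitz_on_diff[OF L])
  moreover have "compactly_supported_in \<Omega> (\<lambda>x. f x - g x)"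
  proof -
    let ?A = "closure {x. f x \<noteq> 0}" and ?B = "closure {x. g x \<noteq> 0}"
    have c: "compact (?A \<union> ?B)" "?A \<union> ?B \<subseteq> \<Omega>"
      using f g by (auto simp: Lip_c_def compactly_supported_in_def)
    show ?thesis
      by (rule compactly_supported_inI[OF c order_trans[OF _ Un_mono[OF closure_subset closure_subset]]]) auto
  qed
  ultimately show ?thesis unfolding Lip_c_def by auto
qed

lemma partial_deriv_product:
  fixes h :: "real^'n \<Rightarrow> real"
  assumes "partially_differentiable i h x" "partially_differentiable i f x"
  shows "partial_deriv i (\<lambda>x. h x *\<^sub>R f x) x = h x *\<^sub>R partial_deriv i f x + partial_deriv i h x *\<^sub>R f x"
proof -
  have "((\<lambda>t. h (x + t *\<^sub>R axis i 1) *\<^sub>R f (x + t *\<^sub>R axis i 1)) has_vector_derivative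
      (h (x + 0 *\<^sub>R axis i 1) *\<^sub>R partial_deriv i f x + partial_deriv i h x *\<^sub>R f (x + 0 *\<^sub>R axis i 1))) (at 0)"
    using has_partial_deriv[OF assms(1)] has_partial_deriv[OF assms(2)]
    by (intro has_vector_derivative_scaleR) (simp_all add: has_real_derivative_iff_has_vector_derivative)
  then show ?thesis by (intro partial_derivI(2)) simp
qed

lemma partial_deriv_difference:
  assumes "partially_differentiable i f x" "partially_differentiable i g x"
  shows "partial_deriv i (\<lambda>x. f x - g x) x = partial_deriv i f x - partial_deriv i g x"
  by (rule partial_derivI(2)[OF has_vector_derivative_diff[OF has_partial_deriv[OF assms(1)] has_partial_deriv[OF assms(2)]]])

lemma curl_product:
  assumes "\<And>i. partially_differentiable i h x" "\<And>i. partially_differentiable i f x"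
  shows "curl (\<lambda>x. h x *\<^sub>R f x) x = h x *\<^sub>R curl f x + cross3 (grad h x) (f x)"
proof -
  have "curl (\<lambda>x. h x *\<^sub>R f x) x $ j = (h x *\<^sub>R curl f x + cross3 (grad h x) (f x)) $ j" for j
    using exhaust_3[of j]
    by (elim disjE) (simp_all add: curl_nth partial_deriv_product assms cross3_def grad_def algebra_simps)
  then show ?thesis by (simp add: vec_eq_iff)
qed

lemma curl_difference:
  assumes "\<And>i. partially_differentiable i f x" "\<And>i. partially_differentiable i g x"
  shows "curl (\<lambda>x. f x - g x) x = curl f x - curl g x"
proof -
  have "curl (\<lambda>x. f x - g x) x $ j = (curl f x - curl g x) $ j" for j
    using exhaust_3[of j]
    by (elim disjE) (simp_all add: curl_nth partial_deriv_difference assms)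
  then show ?thesis by (simp add: vec_eq_iff)
qed

lemma partial_deriv_at_minimum:
  fixes h :: "real^'n \<Rightarrow> real"
  assumes "partially_differentiable i h x" and "\<And>t. h x \<le> h (x + t *\<^sub>R axis i 1)"
  shows "partial_deriv i h x = 0"
proof -
  have "DERIV (\<lambda>t. h (x + t *\<^sub>R axis i 1)) 0 :> partial_deriv i h x"
    using has_partial_deriv[OF assms(1)] by (simp add: has_real_derivative_iff_has_vector_derivative)
  then show ?thesis
    by (rule DERIV_local_min[of _ _ _ 1]) (use assms(2) in auto)
qed

text \<open>The difference \<open>k - h\<close> is nonnegative and vanishes at \<open>x\<close>, so it has a minimum there.\<close>

lemma partial_deriv_touching:
  fixes h k :: "real^'n \<Rightarrow> real"
  assumes h: "partially_differentiable i h x" and k: "partially_differentiable i k x"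
    and le: "\<And>y. h y \<le> k y" and eq: "h x = k x"
  shows "partial_deriv i h x = partial_deriv i k x"
proof -
  have "partially_differentiable i (\<lambda>y. k y - h y) x"
    by (rule partial_derivI(1)[OF has_vector_derivative_diff[OF has_partial_deriv[OF k] has_partial_deriv[OF h]]])
  then have "partial_deriv i (\<lambda>y. k y - h y) x = 0"
    by (rule partial_deriv_at_minimum) (use le eq in simp)
  then show ?thesis by (simp add: partial_deriv_difference[OF k h])
qed

lemma partial_deriv_dist:
  fixes x y :: "real^'n"
  assumes "x \<noteq> y" "e > 0"
  shows "partially_differentiable i (\<lambda>z. norm (z - y) / e) x"
    "partial_deriv i (\<lambda>z. norm (z - y) / e) x = (x - y) $ i / (norm (x - y) * e)"
proof -
  have "((\<lambda>z. z - y) has_derivative (\<lambda>h. h)) (at x)"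
    by (auto intro!: derivative_eq_intros)
  from has_derivative_compose[OF this has_derivative_norm]
  have "((\<lambda>z. norm (z - y)) has_derivative (\<lambda>h. h \<bullet> sgn (x - y))) (at x)"
    using assms by (simp add: inner_commute)
  from has_derivative_mult_left[OF this, of "inverse e"]
  have "((\<lambda>z. norm (z - y) / e) has_derivative (\<lambda>h. (h \<bullet> sgn (x - y)) / e)) (at x)"
    by (simp add: divide_inverse)
  from has_derivative_imp_partial_deriv[OF this, of i]
  show "partially_differentiable i (\<lambda>z. norm (z - y) / e) x"
    "partial_deriv i (\<lambda>z. norm (z - y) / e) x = (x - y) $ i / (norm (x - y) * e)"
    by (simp_all add: inner_axis' sgn_div_norm divide_inverse mult.commute)
qed

text \<open>At such points the cutoff function attains its minimum \<open>0\<close> or its maximum \<open>1\<close>.\<close>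

lemma grad_cutoff_0:
  fixes x :: "real^'n"
  assumes pd: "\<And>i. partially_differentiable i (cutoff C e) x" and e: "e > 0"
    and x: "x \<in> C \<or> infdist x C \<ge> e"
  shows "grad (cutoff C e) x = 0"
proof -
  have "partial_deriv i (cutoff C e) x = 0" for i
  proof (cases "x \<in> C")
    case True
    then show ?thesis
      using cutoff_bounds(1)[OF e] e by (intro partial_deriv_at_minimum pd) (simp add: cutoff_def)
  next
    case False
    then have "infdist x C \<ge> e" using x by simp
    then have 1: "cutoff C e x = 1" using e by (simp add: cutoff_def)
    show ?thesis
    proof -
      have "((\<lambda>z::real^'n. 1::real) has_derivative (\<lambda>h. 0)) (at x)" by simp
      from has_derivative_imp_partial_deriv[OF this, of i]
      show ?thesis using partial_deriv_touching[OF pd, where k="\<lambda>z. 1"] cutoff_bounds(2)[of C e] 1 by simp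
    qed
  qed
  then show ?thesis by (simp add: grad_def vec_eq_iff)
qed

text \<open>If \<open>y\<close> is a nearest point of \<open>C\<close>, the cutoff function lies below \<open>z \<mapsto> norm (z - y) / e\<close> and touches it at
  \<open>x\<close>. Hence its gradient points along \<open>x - y\<close>.\<close>

lemma grad_cutoff:
  fixes x y :: "real^'n"
  assumes pd: "\<And>i. partially_differentiable i (cutoff C e) x" and e: "e > 0"
    and y: "y \<in> C" "infdist x C = dist x y" and x: "x \<notin> C" "infdist x C < e"
  shows "grad (cutoff C e) x = (1 / (norm (x - y) * e)) *\<^sub>R (x - y)"
proof -
  have ne: "x \<noteq> y" using x y by auto
  have "partial_deriv i (cutoff C e) x = partial_deriv i (\<lambda>z. norm (z - y) / e) x" for i
  proof (rule partial_deriv_touching[OF pd partial_deriv_dist(1)[OF ne e]])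
    fix z
    have "infdist z C \<le> dist z y" by (rule infdist_le[OF y(1)])
    then show "cutoff C e z \<le> norm (z - y) / e"
      using e unfolding cutoff_def dist_norm by (intro min.coboundedI2 divide_right_mono) auto
    show "cutoff C e x = norm (x - y) / e"
      using x y e by (simp add: cutoff_def dist_norm)
  qed
  then show ?thesis by (simp add: grad_def vec_eq_iff partial_deriv_dist[OF ne e])
qed

lemma norm_cross3_le: "norm (cross3 a b) \<le> norm a * norm b"
proof -
  have "(norm (cross3 a b))\<^sup>2 \<le> (norm a * norm b)\<^sup>2"
    unfolding norm_cross_dot[of a b, symmetric] by simp
  then show ?thesis by (rule power2_le_imp_le) simp
qed

text \<open>The gradient of the cutoff function has size \<open>1 / e\<close>, but it is parallel to \<open>x - y\<close>, and so is \<open>\<psi> y\<close>. Only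
  the difference \<open>\<psi> x - \<psi> y\<close> contributes to the cross product; it is at most \<open>L * e\<close>, and the two factors
  cancel.\<close>

lemma norm_grad_cutoff_cross_le:
  fixes \<psi> :: "real^3 \<Rightarrow> real^3"
  assumes pd: "\<And>i. partially_differentiable i (cutoff C e) x" and e: "e > 0"
    and C: "closed C" "C \<noteq> {}" and L: "L-lipschitz_on UNIV \<psi>"
    and normal: "\<And>y. x \<notin> C \<Longrightarrow> y \<in> C \<Longrightarrow> infdist x C = dist x y \<Longrightarrow> \<exists>c. \<psi> y = c *\<^sub>R (x - y)"
  shows "norm (cross3 (grad (cutoff C e) x) (\<psi> x)) \<le> L"
proof (cases "x \<in> C \<or> infdist x C \<ge> e")
  case True
  then show ?thesis using grad_cutoff_0[OF pd e] lipschitz_on_nonneg[OF L] by simp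
next
  case False
  obtain y where y: "y \<in> C" "infdist x C = dist x y"
    using infdist_attains_inf[OF C] by metis
  obtain c where c: "\<psi> y = c *\<^sub>R (x - y)" using normal[OF _ y] False by auto
  have ne: "norm (x - y) > 0" using y False by auto
  have g: "grad (cutoff C e) x = (1 / (norm (x - y) * e)) *\<^sub>R (x - y)"
    using False by (intro grad_cutoff[OF pd e y]) auto
  have "cross3 (x - y) (\<psi> x) = cross3 (x - y) (\<psi> x - \<psi> y)"
    by (simp add: Cross3.right_diff_distrib c cross_mult_right)
  then have "norm (cross3 (grad (cutoff C e) x) (\<psi> x)) = 1 / (norm (x - y) * e) * norm (cross3 (x - y) (\<psi> x - \<psi> y))"
    using ne e by (simp add: g cross_mult_left)
  also have "\<dots> \<le> 1 / (norm (x - y) * e) * (norm (x - y) * (L * norm (x - y)))"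
    using ne e lipschitz_on_normD[OF L, of x y]
    by (intro mult_left_mono order_trans[OF norm_cross3_le]) auto
  also have "\<dots> = L * (norm (x - y) / e)" using ne by simp
  also have "\<dots> \<le> L * 1"
    using False y e lipschitz_on_nonneg[OF L] by (intro mult_left_mono) (auto simp: dist_norm)
  finally show ?thesis by simp
qed

text \<open>The field \<open>\<psi>\<close>, multiplied by the cutoff function, is an admissible test field on \<open>\<Omega>\<close> that vanishes on \<open>C\<close>. Its curl
  is the cutoff function times \<open>curl \<psi>\<close> plus an error that is bounded uniformly in \<open>e\<close> by the previous lemma
  and lives on \<open>{x. 0 < infdist x C < e}\<close>. These sets shrink to the empty set as \<open>e \<rightarrow> 0\<close>, so the error
  disappears by dominated convergence, and the identity for the test fields turns into the claim.\<close>

lemma trace_of_normal_field_vanishes: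
  assumes \<mu>: "is_curl_measure \<Omega> F \<mu>" and F: "set_integrable lebesgue \<Omega> F" and \<Omega>: "open \<Omega>"
    and C: "closed C" and \<psi>: "\<psi> \<in> Lip_c \<Omega>"
    and normal: "\<And>x y. x \<notin> C \<Longrightarrow> y \<in> C \<Longrightarrow> infdist x C = dist x y \<Longrightarrow> \<exists>c. \<psi> y = c *\<^sub>R (x - y)"
  shows "vector_integral \<Omega> \<mu> (\<Omega> - C) \<psi> = (LINT x:\<Omega> - C|lebesgue. F x \<bullet> curl \<psi> x)"
proof (cases "C = {}")
  case True
  then show ?thesis using curl_measure_Lip_c[OF \<mu> F \<Omega> \<psi>] by simp
next
  case False
  obtain L K a b where L: "L-lipschitz_on UNIV \<psi>" and K: "\<And>x. norm (\<psi> x) \<le> K"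
    using Lip_cE[OF \<psi>] by metis
  obtain K' where cm: "curl \<psi> \<in> borel_measurable borel" and K': "\<And>x. norm (curl \<psi> x) \<le> K'"
    using curl_Lip_c[OF \<psi>] by metis
  have \<psi>m: "\<psi> \<in> borel_measurable borel" by (rule Lip_c_borel_measurable[OF \<psi>])
  define e where "e n = inverse (real (Suc n))" for n
  have e: "e n > 0" for n by (simp add: e_def)
  have e0: "e \<longlonglongrightarrow> 0" unfolding e_def by (rule LIMSEQ_inverse_real_of_nat)
  define u where "u n = (\<lambda>x. cutoff C (e n) x *\<^sub>R \<psi> x)" for n
  have \<theta>: "\<bar>cutoff C (e n) x\<bar> \<le> 1" for n x using cutoff_bounds(1)[OF e, of C n x] cutoff_bounds(2)[of C "e n" x] by simp
  have u: "u n \<in> Lip_c \<Omega>" for n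
    unfolding u_def by (rule Lip_c_mult[OF cutoff_lipschitz[OF e] \<theta> \<psi>])
  \<comment> \<open>Each point outside \<open>C\<close> leaves the layer of width \<open>e n\<close> around \<open>C\<close> eventually.\<close>
  have small: "eventually (\<lambda>n. e n \<le> infdist x C) sequentially" if "x \<notin> C" for x
  proof -
    have "infdist x C > 0" using C False that by (simp add: infdist_pos_not_in_closed)
    then have "eventually (\<lambda>n. e n < infdist x C) sequentially" by (rule order_tendstoD(2)[OF e0])
    then show ?thesis by eventually_elim simp
  qed
  have \<theta>lim: "eventually (\<lambda>n. cutoff C (e n) x = indicator (-C) x) sequentially" for x
  proof (cases "x \<in> C")
    case False
    show ?thesis using small[OF False] by eventually_elim (use e False in \<open>simp add: cutoff_def\<close>)
  qed (simp add: cutoff_def)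
  have ind: "indicat_real (\<Omega> - C) x = indicat_real (- C) x" if "x \<in> \<Omega>" for x
    using that by (simp add: indicator_def)
  have lhs: "(\<lambda>n. vector_integral \<Omega> \<mu> \<Omega> (u n)) \<longlonglongrightarrow> vector_integral \<Omega> \<mu> \<Omega> (\<lambda>x. indicat_real (\<Omega> - C) x *\<^sub>R \<psi> x)"
  proof (rule vector_integral_tendsto)
    show "vector_measure_on \<Omega> \<mu>" using \<mu> by (simp add: is_curl_measure_def)
    show "\<Omega> \<in> sets borel" using \<Omega> by simp
    show "u n \<in> borel_measurable borel" for n by (rule Lip_c_borel_measurable[OF u])
    show "norm (u n x) \<le> K" for n x
      using mult_mono[OF \<theta>[of n x] K[of x]] order_trans[OF norm_ge_zero K] by (simp add: u_def)
    show "(\<lambda>x. indicat_real (\<Omega> - C) x *\<^sub>R \<psi> x) \<in> borel_measurable borel"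
      using \<Omega> C by (intro borel_measurable_scaleR borel_measurable_indicator \<psi>m) auto
    show "(\<lambda>n. u n x) \<longlonglongrightarrow> indicat_real (\<Omega> - C) x *\<^sub>R \<psi> x" if "x \<in> \<Omega>" for x
      unfolding ind[OF that] u_def
      by (intro tendsto_scaleR tendsto_const tendsto_eventually \<theta>lim)
  qed
  have pdu: "AE x in lebesgue. \<forall>n i. partially_differentiable i (cutoff C (e n)) x \<and> partially_differentiable i \<psi> x"
    unfolding AE_all_countable
    by (intro allI AE_conjI AE_completion lipschitz_AE_partially_differentiable[OF cutoff_lipschitz[OF e]]
        lipschitz_AE_partially_differentiable[OF L])
  have "(\<lambda>n. LINT x:\<Omega>|lebesgue. F x \<bullet> curl (u n) x) \<longlonglongrightarrow>
      (LINT x:\<Omega>|lebesgue. F x \<bullet> (indicat_real (- C) x *\<^sub>R curl \<psi> x))"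
  proof (rule set_integral_inner_tendsto[OF F])
    show "curl (u n) \<in> borel_measurable borel" for n
      by (rule curl_Lip_c[OF u])
    show "(\<lambda>x. indicat_real (- C) x *\<^sub>R curl \<psi> x) \<in> borel_measurable borel"
      using C by (intro borel_measurable_scaleR borel_measurable_indicator cm) auto
    show "AE x in lebesgue. norm (curl (u n) x) \<le> K' + L" for n
      using pdu
    proof eventually_elim
      case (elim x)
      have "norm (cutoff C (e n) x *\<^sub>R curl \<psi> x) \<le> K'"
        using mult_mono[OF \<theta>[of n x] K'[of x]] order_trans[OF norm_ge_zero K'] by simp
      moreover have "norm (cross3 (grad (cutoff C (e n)) x) (\<psi> x)) \<le> L"
        using elim by (intro norm_grad_cutoff_cross_le e C False L normal) auto
      ultimately show ?case
        using elim unfolding u_def by (subst curl_product) (auto intro: norm_triangle_mono)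
    qed
    show "AE x in lebesgue. (\<lambda>n. curl (u n) x) \<longlonglongrightarrow> indicat_real (- C) x *\<^sub>R curl \<psi> x"
      using pdu
    proof eventually_elim
      case (elim x)
      have "eventually (\<lambda>n. x \<in> C \<or> infdist x C \<ge> e n) sequentially"
        using small[of x] by (cases "x \<in> C") auto
      then have "eventually (\<lambda>n. curl (u n) x = indicat_real (- C) x *\<^sub>R curl \<psi> x) sequentially"
        using \<theta>lim[of x]
      proof eventually_elim
        case (elim n)
        then have "grad (cutoff C (e n)) x = 0"
          using \<open>\<forall>n i. partially_differentiable i (cutoff C (e n)) x \<and> partially_differentiable i \<psi> x\<close>
          by (intro grad_cutoff_0 e) auto
        then show ?case
          using elim \<open>\<forall>n i. partially_differentiable i (cutoff C (e n)) x \<and> partially_differentiable i \<psi> x\<close>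
          unfolding u_def by (subst curl_product) auto
      qed
      then show ?case by (rule tendsto_eventually)
    qed
  qed
  moreover have "vector_integral \<Omega> \<mu> \<Omega> (u n) = (LINT x:\<Omega>|lebesgue. F x \<bullet> curl (u n) x)" for n
    by (rule curl_measure_Lip_c[OF \<mu> F \<Omega> u])
  ultimately have "vector_integral \<Omega> \<mu> \<Omega> (\<lambda>x. indicat_real (\<Omega> - C) x *\<^sub>R \<psi> x)
      = (LINT x:\<Omega>|lebesgue. F x \<bullet> (indicat_real (- C) x *\<^sub>R curl \<psi> x))"
    using LIMSEQ_unique[OF lhs] by simp
  moreover have "vector_integral \<Omega> \<mu> \<Omega> (\<lambda>x. indicat_real (\<Omega> - C) x *\<^sub>R \<psi> x) = vector_integral \<Omega> \<mu> (\<Omega> - C) \<psi>"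
    by (rule vector_integral_indicator) auto
  moreover have "(LINT x:\<Omega>|lebesgue. F x \<bullet> (indicat_real (- C) x *\<^sub>R curl \<psi> x)) = (LINT x:\<Omega> - C|lebesgue. F x \<bullet> curl \<psi> x)"
    unfolding set_lebesgue_integral_def
    by (rule Bochner_Integration.integral_cong) (auto simp: indicator_def)
  ultimately show ?thesis by simp
qed

section \<open>Tangent planes and normals of a \<open>C\<^sup>2\<close> boundary\<close>

text \<open>The derivative is bounded on the compact and convex ball.\<close>

lemma Ck1_lipschitz_on_cball:
  fixes f :: "real^'n \<Rightarrow> 'b::real_normed_vector"
  assumes f: "Ck_on (Suc 0) UNIV f"
  shows "\<exists>L. L-lipschitz_on (cball a R) f"
proof -
  have d: "f differentiable (at x)" for x using f by simp
  have c: "continuous_on (cball a R) (partial_deriv i f)" for i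
    using f by (auto intro: continuous_on_subset)
  have "\<exists>B. \<forall>x\<in>cball a R. norm (partial_deriv i f x) \<le> B" for i
  proof -
    have "bounded (partial_deriv i f ` cball a R)"
      by (intro compact_imp_bounded compact_continuous_image c compact_cball)
    then show ?thesis by (auto simp: bounded_iff)
  qed
  then obtain B where B: "\<And>i x. x \<in> cball a R \<Longrightarrow> norm (partial_deriv i f x) \<le> B i" by metis
  have "(\<Sum>i\<in>UNIV. \<bar>B i\<bar>)-lipschitz_on (cball a R) f"
  proof (rule bounded_derivative_imp_lipschitz)
    show "(f has_derivative (\<lambda>h. \<Sum>i\<in>UNIV. h $ i *\<^sub>R partial_deriv i f x)) (at x within cball a R)" for x
      by (rule has_derivative_at_withinI[OF differentiable_has_derivative[OF d]])
    fix x assume x: "x \<in> cball a R"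
    show "onorm (\<lambda>h. \<Sum>i\<in>UNIV. h $ i *\<^sub>R partial_deriv i f x) \<le> (\<Sum>i\<in>UNIV. \<bar>B i\<bar>)"
    proof (rule onorm_le)
      fix h :: "real^'n"
      have "norm (\<Sum>i\<in>UNIV. h $ i *\<^sub>R partial_deriv i f x) \<le> (\<Sum>i\<in>UNIV. norm h * \<bar>B i\<bar>)"
      proof (rule sum_norm_le)
        fix i
        have "norm (partial_deriv i f x) \<le> \<bar>B i\<bar>" using B[OF x, of i] by linarith
        then show "norm (h $ i *\<^sub>R partial_deriv i f x) \<le> norm h * \<bar>B i\<bar>"
          unfolding norm_scaleR real_norm_def[symmetric]
          by (intro mult_mono) (auto simp: component_le_norm_cart)
      qed
      then show "norm (\<Sum>i\<in>UNIV. h $ i *\<^sub>R partial_deriv i f x) \<le> (\<Sum>i\<in>UNIV. \<bar>B i\<bar>) * norm h"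
        by (simp add: sum_distrib_left mult.commute)
    qed
  qed (auto intro: sum_nonneg)
  then show ?thesis by blast
qed

text \<open>The defining function \<open>\<rho>\<close> of the region above a graph has gradient \<open>G y = inv T (- \<partial>\<^sub>1\<gamma>, - \<partial>\<^sub>2\<gamma>, 1)\<close>. Its norm
  is at least \<open>1\<close> because of the last entry, and it is locally Lipschitz because \<open>\<gamma>\<close> is twice continuously
  differentiable. Curves in the zero set with a prescribed tangent vector are obtained by lifting a straight
  line of the plane to the graph.\<close>

lemma graph_chart:
  fixes T :: "real^3 \<Rightarrow> real^3" and \<gamma> :: "real^2 \<Rightarrow> real"
  assumes T: "orthogonal_transformation T" and \<gamma>: "Ck_on 2 UNIV \<gamma>"
    and \<rho>_def: "\<rho> = (\<lambda>y. T y $ 3 - \<gamma> (vector [T y $ 1, T y $ 2]))"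
  obtains G where "\<And>y. (\<rho> has_derivative (\<lambda>h. G y \<bullet> h)) (at y)" "\<And>y. norm (G y) \<ge> 1"
    "\<And>x r. \<exists>L. L-lipschitz_on (ball x r) G"
    "\<And>y v. \<rho> y = 0 \<Longrightarrow> G y \<bullet> v = 0 \<Longrightarrow>
       \<exists>c. c 0 = y \<and> (\<forall>t::real. \<rho> (c t) = 0) \<and> (c has_vector_derivative v) (at 0)"
proof -
  define P :: "real^3 \<Rightarrow> real^2" where "P w = vector [w $ 1, w $ 2]" for w
  have Peq: "P w = w $ 1 *\<^sub>R axis 1 1 + w $ 2 *\<^sub>R axis 2 1" for w
    by (simp add: P_def vec_eq_iff forall_2 axis_def)
  have Pbl: "bounded_linear P"
    unfolding Peq[abs_def]
    by (intro bounded_linear_add bounded_linear_scaleR_const bounded_linear_vec_nth)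
  have Plin: "linear P" by (rule bounded_linear.linear[OF Pbl])
  have Pn: "P w $ 1 = w $ 1" "P w $ 2 = w $ 2" for w by (simp_all add: P_def)
  have Pnorm: "norm (P w) \<le> norm w" for w
    unfolding norm_eq_sqrt_inner by (rule real_sqrt_le_mono) (simp add: inner_vec_def sum_2 sum_3 Pn)
  have Tlin: "linear T" using T by (simp add: orthogonal_transformation_def)
  have Tbl: "bounded_linear T" using Tlin by (rule linear_conv_bounded_linear[THEN iffD1])
  define S where "S = inv T"
  have bij: "bij T" by (rule orthogonal_transformation_bij[OF T])
  have TS: "T (S w) = w" for w unfolding S_def by (rule surj_f_inv_f[OF bij_is_surj[OF bij]])
  have ST: "S (T w) = w" for w unfolding S_def by (rule inv_f_f[OF bij_is_inj[OF bij]])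
  have So: "orthogonal_transformation S" unfolding S_def by (rule orthogonal_transformation_inv[OF T])
  have Slin: "linear S" using So by (simp add: orthogonal_transformation_def)
  have Sbl: "bounded_linear S" using Slin by (rule linear_conv_bounded_linear[THEN iffD1])
  have adj: "a \<bullet> T h = S a \<bullet> h" for a h
    using So TS ST by (metis orthogonal_transformation_def)
  have \<gamma>2: "\<gamma> differentiable (at z)" "Ck_on (Suc 0) UNIV (partial_deriv i \<gamma>)" for z i
    using \<gamma> by (simp_all add: numeral_2_eq_2)
  define d where "d i w = partial_deriv i \<gamma> (P w)" for i w
  have \<gamma>d: "((\<lambda>w. \<gamma> (P w)) has_derivative (\<lambda>h. h $ 1 * d 1 w + h $ 2 * d 2 w)) (at w)" for w
  proof -
    have "((\<lambda>w. \<gamma> (P w)) has_derivative (\<lambda>h. \<Sum>i\<in>UNIV. P h $ i *\<^sub>R partial_deriv i \<gamma> (P w))) (at w)"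
      by (rule has_derivative_compose[OF bounded_linear_imp_has_derivative[OF Pbl] differentiable_has_derivative[OF \<gamma>2(1)]])
    then show ?thesis by (simp add: sum_2 Pn d_def)
  qed
  define n :: "real^3 \<Rightarrow> real^3" where "n w = vector [- d 1 w, - d 2 w, 1]" for w
  have n: "n w $ 1 = - d 1 w" "n w $ 2 = - d 2 w" "n w $ 3 = 1" for w by (simp_all add: n_def)
  define G where "G y = S (n (T y))" for y
  show ?thesis
  proof (rule that)
    fix y
    have "((\<lambda>w. w $ 3 - \<gamma> (P w)) has_derivative (\<lambda>h. h $ 3 - (h $ 1 * d 1 (T y) + h $ 2 * d 2 (T y)))) (at (T y))"
      by (intro has_derivative_diff \<gamma>d bounded_linear_imp_has_derivative bounded_linear_vec_nth)
    from has_derivative_compose[OF bounded_linear_imp_has_derivative[OF Tbl] this]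
    have "(\<rho> has_derivative (\<lambda>h. T h $ 3 - (T h $ 1 * d 1 (T y) + T h $ 2 * d 2 (T y)))) (at y)"
      by (simp add: \<rho>_def P_def)
    moreover have "T h $ 3 - (T h $ 1 * d 1 (T y) + T h $ 2 * d 2 (T y)) = G y \<bullet> h" for h
      unfolding G_def adj[symmetric] by (simp add: inner_vec_def sum_3 n algebra_simps)
    ultimately show "(\<rho> has_derivative (\<lambda>h. G y \<bullet> h)) (at y)" by simp
    have "\<bar>n (T y) $ 3\<bar> \<le> norm (n (T y))" by (rule component_le_norm_cart)
    then show "norm (G y) \<ge> 1"
      by (simp add: G_def orthogonal_transformation_norm[OF So] n)
  next
    fix x :: "real^3" and r :: real
    have "\<exists>L. \<forall>i. L-lipschitz_on (cball (P (T x)) r) (partial_deriv i \<gamma>)"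
    proof -
      obtain L1 where L1: "L1-lipschitz_on (cball (P (T x)) r) (partial_deriv 1 \<gamma>)"
        using Ck1_lipschitz_on_cball[OF \<gamma>2(2)[of 1], of "P (T x)" r] by (elim exE)
      obtain L2 where L2: "L2-lipschitz_on (cball (P (T x)) r) (partial_deriv 2 \<gamma>)"
        using Ck1_lipschitz_on_cball[OF \<gamma>2(2)[of 2], of "P (T x)" r] by (elim exE)
      show ?thesis
        unfolding forall_2
        using lipschitz_on_mono[OF L1 order_refl, of "max L1 L2"] lipschitz_on_mono[OF L2 order_refl, of "max L1 L2"]
        by (intro exI[of _ "max L1 L2"]) simp
    qed
    then obtain L where "\<forall>i. L-lipschitz_on (cball (P (T x)) r) (partial_deriv i \<gamma>)" by (elim exE)
    then have L: "L-lipschitz_on (cball (P (T x)) r) (partial_deriv i \<gamma>)" for i by simp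
    have "(2 * L)-lipschitz_on (ball x r) G"
    proof (rule lipschitz_onI)
      show "0 \<le> 2 * L" using lipschitz_on_nonneg[OF L] by simp
      fix y z assume yz: "y \<in> ball x r" "z \<in> ball x r"
      have Pd: "norm (P (T a) - P (T b)) \<le> norm (a - b)" for a b
        using Pnorm[of "T (a - b)"]
        by (simp add: linear_diff[OF Plin] linear_diff[OF Tlin] orthogonal_transformation_norm[OF T, symmetric, of "a - b"])
      have mem: "P (T y) \<in> cball (P (T x)) r" "P (T z) \<in> cball (P (T x)) r"
        using yz Pd[of x y] Pd[of x z] by (simp_all add: dist_norm)
      have dd: "\<bar>d i (T y) - d i (T z)\<bar> \<le> L * norm (y - z)" for i
        using lipschitz_on_normD[OF L mem, of i] mult_left_mono[OF Pd[of y z] lipschitz_on_nonneg[OF L]]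
        by (simp add: d_def)
      have "dist (G y) (G z) = norm (S (n (T y) - n (T z)))"
        by (simp add: dist_norm G_def linear_diff[OF Slin])
      also have "\<dots> = norm (n (T y) - n (T z))" by (rule orthogonal_transformation_norm[OF So])
      also have "\<dots> \<le> (\<Sum>i\<in>UNIV. \<bar>(n (T y) - n (T z)) $ i\<bar>)" by (rule norm_le_l1_cart)
      also have "\<dots> \<le> 2 * L * dist y z"
        using dd[of 1] dd[of 2] by (simp add: sum_3 n dist_norm)
      finally show "dist (G y) (G z) \<le> 2 * L * dist y z" .
    qed
    then show "\<exists>L. L-lipschitz_on (ball x r) G" by (rule exI)
  next
    fix y v assume y: "\<rho> y = 0" and v: "G y \<bullet> v = 0"
    define w h where "w = T y" and "h = T v"
    \<comment> \<open>The line \<open>w + t h\<close> in chart coordinates, moved vertically onto the graph of \<open>\<gamma>\<close>.\<close>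
    define k :: "real \<Rightarrow> real^3" where
      "k t = (w + t *\<^sub>R h) + (\<gamma> (P (w + t *\<^sub>R h)) - (w + t *\<^sub>R h) $ 3) *\<^sub>R axis 3 1" for t
    have k: "k t $ 1 = (w + t *\<^sub>R h) $ 1" "k t $ 2 = (w + t *\<^sub>R h) $ 2" "k t $ 3 = \<gamma> (P (w + t *\<^sub>R h))" for t
      by (simp_all add: k_def axis_def)
    have Pk: "P (k t) = P (w + t *\<^sub>R h)" for t by (simp add: Peq k del: vector_add_component vector_scaleR_component)
    have "n w \<bullet> h = 0" using v by (simp add: w_def h_def G_def adj)
    then have h3: "h $ 3 = h $ 1 * d 1 w + h $ 2 * d 2 w"
      by (simp add: inner_vec_def sum_3 n algebra_simps)
    have line: "((\<lambda>t. w + t *\<^sub>R h) has_derivative (\<lambda>t. t *\<^sub>R h)) (at 0)"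
      by (auto intro!: derivative_eq_intros)
    have "((\<lambda>t. \<gamma> (P (w + t *\<^sub>R h))) has_derivative (\<lambda>t. t *\<^sub>R (h $ 1 * d 1 w + h $ 2 * d 2 w))) (at 0)"
      using has_derivative_compose[OF line, of "\<lambda>w. \<gamma> (P w)" "\<lambda>h. h $ 1 * d 1 w + h $ 2 * d 2 w"] \<gamma>d[of w]
      by (simp add: algebra_simps)
    then have "((\<lambda>t. \<gamma> (P (w + t *\<^sub>R h)) - (w + t *\<^sub>R h) $ 3) has_derivative (\<lambda>t. t *\<^sub>R (h $ 1 * d 1 w + h $ 2 * d 2 w) - (t *\<^sub>R h) $ 3)) (at 0)"
      by (intro has_derivative_diff has_derivative_compose[OF line] bounded_linear_imp_has_derivative bounded_linear_vec_nth)
    then have "((\<lambda>t. \<gamma> (P (w + t *\<^sub>R h)) - (w + t *\<^sub>R h) $ 3) has_derivative (\<lambda>t. 0)) (at 0)"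
      by (simp add: h3)
    from has_derivative_add[OF line has_derivative_scaleR_left[OF this, of "axis 3 1"]]
    have "(k has_derivative (\<lambda>t. t *\<^sub>R h)) (at 0)"
      by (simp add: k_def[abs_def])
    from has_derivative_compose[OF this bounded_linear_imp_has_derivative[OF Sbl]]
    have "((\<lambda>t. S (k t)) has_derivative (\<lambda>t. t *\<^sub>R v)) (at 0)"
      by (simp add: linear_scale[OF Slin] h_def ST)
    then have der: "((\<lambda>t. S (k t)) has_vector_derivative v) (at 0)"
      by (simp add: has_vector_derivative_def)
    have "w $ 3 = \<gamma> (P w)" using y by (simp add: \<rho>_def P_def w_def)
    then have "k 0 = w" by (simp add: k_def)
    then have "S (k 0) = y" by (simp add: w_def ST)
    moreover have "\<rho> (S (k t)) = 0" for t
    proof -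
      have "\<rho> (S (k t)) = k t $ 3 - \<gamma> (P (k t))" by (simp add: \<rho>_def TS P_def)
      then show ?thesis by (simp only: Pk k(3) diff_self)
    qed
    ultimately show "\<exists>c. c 0 = y \<and> (\<forall>t::real. \<rho> (c t) = 0) \<and> (c has_vector_derivative v) (at 0)"
      using der by (intro exI[of _ "\<lambda>t. S (k t)"]) simp
  qed
qed

lemma positive_derivative_imp_positive_right:
  fixes \<rho> :: "'a::real_normed_vector \<Rightarrow> real"
  assumes \<rho>: "(\<rho> has_derivative D) (at y)" and y: "\<rho> y = 0" and D: "D m > 0"
  shows "eventually (\<lambda>t. \<rho> (y + t *\<^sub>R m) > 0) (at_right 0)"
proof -
  have "((\<lambda>t. y + t *\<^sub>R m) has_derivative (\<lambda>t. t *\<^sub>R m)) (at 0)"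
    by (auto intro!: derivative_eq_intros)
  from has_derivative_compose[OF this, of \<rho> D] \<rho>
  have "((\<lambda>t. \<rho> (y + t *\<^sub>R m)) has_derivative (\<lambda>t. D (t *\<^sub>R m))) (at 0)" by simp
  then have "DERIV (\<lambda>t. \<rho> (y + t *\<^sub>R m)) 0 :> D m"
    using linear_scale[OF has_derivative_linear[OF \<rho>]]
    by (simp add: has_field_derivative_def mult_commute_abs)
  from DERIV_pos_inc_right[OF this D] obtain d where "d > 0" "\<And>h. 0 < h \<Longrightarrow> h < d \<Longrightarrow> \<rho> (y + h *\<^sub>R m) > 0"
    using y by auto
  then show ?thesis by (auto simp: eventually_at_right_field)
qed

lemma orthogonal_to_hyperplane_imp_parallel:
  fixes g m :: "'a::real_inner"
  assumes g: "g \<noteq> 0" and m: "\<And>v. g \<bullet> v = 0 \<Longrightarrow> m \<bullet> v = 0"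
  shows "m = ((m \<bullet> g) / (g \<bullet> g)) *\<^sub>R g"
proof -
  define v where "v = m - ((m \<bullet> g) / (g \<bullet> g)) *\<^sub>R g"
  have gv: "g \<bullet> v = 0" using g by (simp add: v_def inner_diff_right inner_commute)
  have "v \<bullet> v = m \<bullet> v - ((m \<bullet> g) / (g \<bullet> g)) * (g \<bullet> v)"
    by (subst v_def) (simp add: inner_diff_left)
  then have "v = 0" using gv m[OF gv] by simp
  then show ?thesis by (simp add: v_def)
qed

lemma norm_normalize_diff_le:
  fixes a b :: "'a::real_normed_vector"
  assumes "norm a \<ge> 1" "norm b \<ge> 1"
  shows "norm (a /\<^sub>R norm a - b /\<^sub>R norm b) \<le> 2 * norm (a - b)"
proof -
  have pos: "norm a > 0" "norm b > 0" using assms by linarith+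
  have "a /\<^sub>R norm a - b /\<^sub>R norm b = (a - b) /\<^sub>R norm a + (inverse (norm a) - inverse (norm b)) *\<^sub>R b"
    by (simp add: algebra_simps)
  also have "norm \<dots> \<le> norm ((a - b) /\<^sub>R norm a) + norm ((inverse (norm a) - inverse (norm b)) *\<^sub>R b)"
    by (rule norm_triangle_ineq)
  also have "norm ((a - b) /\<^sub>R norm a) = norm (a - b) / norm a" by (simp add: divide_inverse mult.commute)
  also have "norm ((inverse (norm a) - inverse (norm b)) *\<^sub>R b) = \<bar>norm b - norm a\<bar> / norm a"
  proof -
    have "inverse (norm a) - inverse (norm b) = (norm b - norm a) / (norm a * norm b)"
      using pos by (simp add: field_simps)
    then show ?thesis using pos by (simp add: abs_divide abs_mult)
  qed
  also have "\<bar>norm b - norm a\<bar> / norm a \<le> norm (a - b) / norm a"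
    using norm_triangle_ineq3[of a b] pos by (intro divide_right_mono) (auto simp: abs_minus_commute)
  also have "norm (a - b) / norm a + norm (a - b) / norm a \<le> norm (a - b) / 1 + norm (a - b) / 1"
    using assms pos by (intro add_mono divide_left_mono) auto
  finally show ?thesis by simp
qed

context
  fixes U :: "(real^3) set"
  assumes U: "open U" and C2: "C2_boundary U"
begin

text \<open>In a chart the boundary is the zero set of the defining function \<open>\<rho>\<close>. Differentiating \<open>\<rho>\<close> along curves in
  the boundary shows that tangent vectors are orthogonal to the gradient \<open>G y\<close>, and the curves in the graph
  provide the converse. A unit vector orthogonal to the resulting plane is plus or minus the normalised
  gradient; the sign of \<open>\<rho>\<close> decides which of the two points into \<open>U\<close>.\<close>

lemma boundary_geometry:
  assumes x: "x \<in> frontier U"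
  shows "\<exists>r>0. \<exists>G. (\<exists>L. L-lipschitz_on (ball x r) G) \<and> (\<forall>y\<in>frontier U \<inter> ball x r.
     norm (G y) \<ge> 1 \<and> tangent_space (frontier U) y = {v. G y \<bullet> v = 0} \<and>
     inner_normal U y = G y /\<^sub>R norm (G y))"
proof -
  obtain r and T :: "real^3 \<Rightarrow> real^3" and \<gamma> :: "real^2 \<Rightarrow> real" where r: "r > 0" and T: "orthogonal_transformation T" and \<gamma>: "Ck_on 2 UNIV \<gamma>"
    and Ueq: "U \<inter> ball x r = {y \<in> ball x r. T y $ 3 > \<gamma> (vector [T y $ 1, T y $ 2])}"
    using C2[unfolded C2_boundary_def, rule_format, OF x] by (elim exE conjE)
  define \<rho> where "\<rho> = (\<lambda>y. T y $ 3 - \<gamma> (vector [T y $ 1, T y $ 2]))"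
  show ?thesis
  proof (rule graph_chart[OF T \<gamma> \<rho>_def])
    fix G
    assume der: "\<And>y. (\<rho> has_derivative (\<lambda>h. G y \<bullet> h)) (at y)" and G1: "\<And>y. norm (G y) \<ge> 1"
      and Lip: "\<And>x r. \<exists>L. L-lipschitz_on (ball x r) G"
      and curve: "\<And>y v. \<rho> y = 0 \<Longrightarrow> G y \<bullet> v = 0 \<Longrightarrow>
         \<exists>c. c 0 = y \<and> (\<forall>t::real. \<rho> (c t) = 0) \<and> (c has_vector_derivative v) (at 0)"
    have Uiff: "y \<in> U \<longleftrightarrow> \<rho> y > 0" if "y \<in> ball x r" for y
    proof -
      have "y \<in> U \<inter> ball x r \<longleftrightarrow> y \<in> ball x r \<and> \<rho> y > 0" unfolding Ueq \<rho>_def by simp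
      then show ?thesis using that by simp
    qed
    have \<rho>c: "isCont \<rho> y" for y by (rule has_derivative_continuous[OF der])
    have in_ball: "eventually (\<lambda>z. z \<in> ball x r) (nhds y)" if "y \<in> ball x r" for y
      using that by (intro eventually_nhds_in_open) auto
    have lineball: "eventually (\<lambda>t. y + t *\<^sub>R m \<in> ball x r) (at_right 0)" if "y \<in> ball x r" for y m
    proof -
      have "((\<lambda>t. y + t *\<^sub>R m) \<longlongrightarrow> y + 0 *\<^sub>R m) (at_right 0)" by (intro tendsto_intros)
      then show ?thesis by (rule topological_tendstoD) (use that in auto)
    qed
    have Gpos: "G y \<bullet> G y > 0" for y
    proof -
      have "G y \<noteq> 0" using G1[of y] by auto
      then show ?thesis by simp
    qed
    have inU: "eventually (\<lambda>t. y + t *\<^sub>R m \<in> U) (at_right 0)"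
      if y: "y \<in> ball x r" "\<rho> y = 0" and m: "G y \<bullet> m > 0" for y m
      using lineball[OF y(1), of m] positive_derivative_imp_positive_right[OF der y(2) m]
      by eventually_elim (simp add: Uiff)
    have fr: "y \<in> frontier U \<longleftrightarrow> \<rho> y = 0" if y: "y \<in> ball x r" for y
    proof
      assume yf: "y \<in> frontier U"
      then have "y \<notin> U" using U by (simp add: frontier_def interior_open)
      then have "\<rho> y \<le> 0" using Uiff[OF y] by simp
      moreover have "\<not> \<rho> y < 0"
      proof
        assume "\<rho> y < 0"
        then have "eventually (\<lambda>z. \<rho> z < 0) (nhds y)"
          using \<rho>c[of y] by (simp add: isCont_def tendsto_nhds_iff order_tendstoD(2))
        then have "eventually (\<lambda>z. z \<notin> U) (nhds y)"
          using in_ball[OF y] by eventually_elim (simp add: Uiff)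
        then obtain V where V: "open V" "y \<in> V" "V \<inter> U = {}" by (auto simp: eventually_nhds)
        then have "y \<notin> closure U" by (meson disjoint_iff open_Int_closure_eq_empty)
        then show False using yf by (simp add: frontier_def)
      qed
      ultimately show "\<rho> y = 0" by simp
    next
      assume y0: "\<rho> y = 0"
      have "y \<notin> interior U" using y0 Uiff[OF y] U by (simp add: interior_open)
      moreover have "y \<in> closure U"
      proof (rule Lim_in_closed_set[OF closed_closure])
        show "eventually (\<lambda>t. y + t *\<^sub>R G y \<in> closure U) (at_right 0)"
          using inU[OF y y0 Gpos] by eventually_elim (use closure_subset in auto)
        have "((\<lambda>t. y + t *\<^sub>R G y) \<longlongrightarrow> y + 0 *\<^sub>R G y) (at_right 0)" by (intro tendsto_intros)
        then show "((\<lambda>t. y + t *\<^sub>R G y) \<longlongrightarrow> y) (at_right 0)" by simp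
      qed simp
      ultimately show "y \<in> frontier U" by (simp add: frontier_def)
    qed
    have main: "tangent_space (frontier U) y = {v. G y \<bullet> v = 0} \<and> inner_normal U y = G y /\<^sub>R norm (G y)"
      if y: "y \<in> frontier U \<inter> ball x r" for y
    proof
      have yb: "y \<in> ball x r" and y0: "\<rho> y = 0" using y fr by auto
      show tan: "tangent_space (frontier U) y = {v. G y \<bullet> v = 0}"
      proof (intro equalityI subsetI)
        fix v assume "v \<in> tangent_space (frontier U) y"
        then obtain c where c0: "c 0 = y" and cf: "eventually (\<lambda>t. c t \<in> frontier U) (at 0)"
          and cd: "(c has_vector_derivative v) (at 0)"
          unfolding tangent_space_def curve_through_def by blast
        have "isCont c 0" using cd by (rule has_vector_derivative_continuous)
        then have "(c \<longlongrightarrow> y) (at 0)" using c0 by (simp add: isCont_def)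
        then have "eventually (\<lambda>t. c t \<in> ball x r) (at 0)"
          by (rule topological_tendstoD) (use yb in auto)
        then have ev: "eventually (\<lambda>t. \<rho> (c t) = 0) (at 0)"
          using cf by eventually_elim (simp add: fr)
        have "((\<lambda>t. \<rho> (c t)) has_derivative (\<lambda>t. G y \<bullet> (t *\<^sub>R v))) (at 0)"
          using has_derivative_compose[OF cd[unfolded has_vector_derivative_def], of \<rho> "\<lambda>h. G y \<bullet> h"] der[of y] c0 by simp
        then have "((\<lambda>t::real. 0::real) has_derivative (\<lambda>t. G y \<bullet> (t *\<^sub>R v))) (at 0)"
          by (rule has_derivative_transform_eventually) (use ev c0 y0 in auto)
        moreover have "((\<lambda>t::real. 0::real) has_derivative (\<lambda>t. 0)) (at 0)" by simp
        ultimately have "(\<lambda>t::real. G y \<bullet> (t *\<^sub>R v)) = (\<lambda>t. 0)" by (rule has_derivative_unique)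
        from fun_cong[OF this, of 1] show "v \<in> {v. G y \<bullet> v = 0}" by simp
      next
        fix v assume "v \<in> {v. G y \<bullet> v = 0}"
        then obtain c where c0: "c 0 = y" and c\<rho>: "\<And>t::real. \<rho> (c t) = 0" and cd: "(c has_vector_derivative v) (at 0)"
          using curve[OF y0, of v] by auto
        have "isCont c 0" using cd by (rule has_vector_derivative_continuous)
        then have "(c \<longlongrightarrow> y) (at 0)" using c0 by (simp add: isCont_def)
        then have "eventually (\<lambda>t. c t \<in> ball x r) (at 0)"
          by (rule topological_tendstoD) (use yb in auto)
        then have "eventually (\<lambda>t. c t \<in> frontier U) (at 0)"
          by eventually_elim (simp add: fr c\<rho>)
        then show "v \<in> tangent_space (frontier U) y"
          using c0 cd by (auto simp: tangent_space_def curve_through_def)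
      qed
      have G0: "norm (G y) > 0" using G1[of y] by linarith
      show "inner_normal U y = G y /\<^sub>R norm (G y)"
        unfolding inner_normal_def
      proof (rule the_equality)
        show "norm (G y /\<^sub>R norm (G y)) = 1 \<and> (\<forall>v\<in>tangent_space (frontier U) y. (G y /\<^sub>R norm (G y)) \<bullet> v = 0) \<and>
          eventually (\<lambda>t. y + t *\<^sub>R (G y /\<^sub>R norm (G y)) \<in> U) (at_right 0)"
          using G0 Gpos[of y] unfolding tan by (intro conjI inU yb y0) auto
        fix m assume m: "norm m = 1 \<and> (\<forall>v\<in>tangent_space (frontier U) y. m \<bullet> v = 0) \<and>
          eventually (\<lambda>t. y + t *\<^sub>R m \<in> U) (at_right 0)"
        define a where "a = (m \<bullet> G y) / (G y \<bullet> G y)"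
        have ma: "m = a *\<^sub>R G y"
          unfolding a_def by (rule orthogonal_to_hyperplane_imp_parallel) (use G0 m tan in auto)
        have a1: "\<bar>a\<bar> * norm (G y) = 1" using m by (simp add: ma)
        have "\<not> a < 0"
        proof
          assume "a < 0"
          then have "(- G y) \<bullet> m > 0" using Gpos[of y] by (simp add: ma mult_neg_pos)
          moreover have "((\<lambda>y. - \<rho> y) has_derivative (\<lambda>h. (- G y) \<bullet> h)) (at y)"
            using has_derivative_minus[OF der[of y]] by simp
          ultimately have "eventually (\<lambda>t. - \<rho> (y + t *\<^sub>R m) > 0) (at_right 0)"
            using positive_derivative_imp_positive_right[of "\<lambda>y. - \<rho> y"] y0 by simp
          moreover have "eventually (\<lambda>t. y + t *\<^sub>R m \<in> U) (at_right 0)" using m by simp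
          ultimately have "eventually (\<lambda>t::real. False) (at_right 0)"
            using lineball[OF yb, of m] by eventually_elim (simp add: Uiff)
          then show False by simp
        qed
        then have "a = inverse (norm (G y))" using a1 G0 by (simp add: field_simps)
        then show "m = G y /\<^sub>R norm (G y)" by (simp add: ma)
      qed
    qed
    have "(\<exists>L. L-lipschitz_on (ball x r) G) \<and> (\<forall>y\<in>frontier U \<inter> ball x r.
        norm (G y) \<ge> 1 \<and> tangent_space (frontier U) y = {v. G y \<bullet> v = 0} \<and>
        inner_normal U y = G y /\<^sub>R norm (G y))"
      using Lip[of x r] G1 main by simp
    then have "\<exists>G. (\<exists>L. L-lipschitz_on (ball x r) G) \<and> (\<forall>y\<in>frontier U \<inter> ball x r.
        norm (G y) \<ge> 1 \<and> tangent_space (frontier U) y = {v. G y \<bullet> v = 0} \<and>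
        inner_normal U y = G y /\<^sub>R norm (G y))"
      by (rule exI[of _ G])
    then show ?thesis by (intro exI[of _ r] conjI[OF r])
  qed
qed

lemma norm_inner_normal: "x \<in> frontier U \<Longrightarrow> norm (inner_normal U x) = 1"
  and tangent_space_eq: "x \<in> frontier U \<Longrightarrow> tangent_space (frontier U) x = {v. inner_normal U x \<bullet> v = 0}"
proof -
  assume x: "x \<in> frontier U"
  obtain r G where "r > 0" and G: "\<forall>y\<in>frontier U \<inter> ball x r. norm (G y) \<ge> 1 \<and>
     tangent_space (frontier U) y = {v. G y \<bullet> v = 0} \<and> inner_normal U y = G y /\<^sub>R norm (G y)"
    using boundary_geometry[OF x] by auto
  then have *: "norm (G x) \<ge> 1" "tangent_space (frontier U) x = {v. G x \<bullet> v = 0}" "inner_normal U x = G x /\<^sub>R norm (G x)"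
    using x by auto
  then have "norm (G x) > 0" by linarith
  then show "norm (inner_normal U x) = 1" "tangent_space (frontier U) x = {v. inner_normal U x \<bullet> v = 0}"
    unfolding * by auto
qed

lemma inner_normal_locally_lipschitz:
  assumes x: "x \<in> frontier U"
  shows "\<exists>r>0. \<exists>L. L-lipschitz_on (frontier U \<inter> ball x r) (inner_normal U)"
proof -
  obtain r G L where r: "r > 0" and L: "L-lipschitz_on (ball x r) G"
    and G: "\<forall>y\<in>frontier U \<inter> ball x r. norm (G y) \<ge> 1 \<and>
     tangent_space (frontier U) y = {v. G y \<bullet> v = 0} \<and> inner_normal U y = G y /\<^sub>R norm (G y)"
    using boundary_geometry[OF x] by auto
  have "(2 * L)-lipschitz_on (frontier U \<inter> ball x r) (inner_normal U)"
  proof (rule lipschitz_onI)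
    fix y z assume yz: "y \<in> frontier U \<inter> ball x r" "z \<in> frontier U \<inter> ball x r"
    then have "norm (G y /\<^sub>R norm (G y) - G z /\<^sub>R norm (G z)) \<le> 2 * norm (G y - G z)"
      using G by (intro norm_normalize_diff_le) auto
    also have "\<dots> \<le> 2 * (L * norm (y - z))"
      using yz lipschitz_on_normD[OF L, of y z] by simp
    finally show "dist (inner_normal U y) (inner_normal U z) \<le> 2 * L * dist y z"
      using G yz by (simp add: dist_norm)
  qed (use lipschitz_on_nonneg[OF L] in simp)
  then show ?thesis using r by auto
qed

end

section \<open>Lipschitz extensions\<close>

text \<open>Points closer than a Lebesgue number of a finite cover share a ball of the cover; for the other pairs
  boundedness of \<open>f\<close> suffices.\<close>

lemma locally_lipschitz_compact_imp_lipschitz: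
  fixes f :: "'a::metric_space \<Rightarrow> 'b::real_normed_vector"
  assumes K: "compact K" and B: "\<And>x. x \<in> K \<Longrightarrow> norm (f x) \<le> B"
    and loc: "\<And>x. x \<in> K \<Longrightarrow> \<exists>r>0. \<exists>L. L-lipschitz_on (K \<inter> ball x r) f"
  shows "\<exists>L. L-lipschitz_on K f"
proof (cases "K = {}")
  case False
  obtain r L where r: "\<And>x. x \<in> K \<Longrightarrow> r x > 0" and L: "\<And>x. x \<in> K \<Longrightarrow> (L x)-lipschitz_on (K \<inter> ball x (r x)) f"
    using loc by metis
  obtain D where D: "D \<subseteq> K" "finite D" and cov: "K \<subseteq> (\<Union>x\<in>D. ball x (r x))"
    using compactE_image[OF K, of K "\<lambda>x. ball x (r x)"] r by force
  obtain \<epsilon> where \<epsilon>: "\<epsilon> > 0" and near: "\<And>x. x \<in> K \<Longrightarrow> \<exists>V\<in>(\<lambda>x. ball x (r x)) ` D. ball x \<epsilon> \<subseteq> V"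
    using Heine_Borel_lemma[OF K, of "(\<lambda>x. ball x (r x)) ` D"] cov by auto
  define M where "M = (\<Sum>x\<in>D. L x) + 2 * B / \<epsilon>"
  have L0: "0 \<le> L x" if "x \<in> D" for x using L[of x] that D by (auto intro: lipschitz_on_nonneg)
  obtain x0 where "x0 \<in> K" using False by auto
  then have B0: "0 \<le> B" using B[of x0] norm_ge_zero order_trans by blast
  have S0: "0 \<le> (\<Sum>x\<in>D. L x)" using L0 by (intro sum_nonneg) auto
  have "M-lipschitz_on K f"
  proof (rule lipschitz_onI)
    show "0 \<le> M" using S0 B0 \<epsilon> by (simp add: M_def)
    fix x y assume xy: "x \<in> K" "y \<in> K"
    show "dist (f x) (f y) \<le> M * dist x y"
    proof (cases "dist x y < \<epsilon>")
      case True
      obtain z where z: "z \<in> D" "ball x \<epsilon> \<subseteq> ball z (r z)" using near[OF xy(1)] by auto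
      have "x \<in> K \<inter> ball z (r z)" "y \<in> K \<inter> ball z (r z)"
        using z(2) xy True \<epsilon> by (auto simp: subset_eq)
      then have "dist (f x) (f y) \<le> L z * dist x y"
        using z(1) D(1) by (intro lipschitz_onD[OF L[of z]]) auto
      also have "L z \<le> (\<Sum>x\<in>D. L x)"
        using member_le_sum[of z D L] z(1) D L0 by auto
      also have "\<dots> \<le> M" using B0 \<epsilon> by (simp add: M_def)
      finally show ?thesis by (simp add: mult_right_mono)
    next
      case False
      have "dist (f x) (f y) \<le> norm (f x) + norm (f y)" by (simp add: dist_norm norm_triangle_ineq4)
      also have "\<dots> \<le> 2 * B" using B[OF xy(1)] B[OF xy(2)] by simp
      also have "\<dots> \<le> 2 * B / \<epsilon> * dist x y"
        using False B0 \<epsilon> mult_left_mono[of \<epsilon> "dist x y" "2 * B / \<epsilon>"] by simp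
      also have "\<dots> \<le> M * dist x y" using S0 by (intro mult_right_mono) (auto simp: M_def)
      finally show ?thesis .
    qed
  qed
  then show ?thesis by blast
qed (auto intro: exI[of _ 0])

lemma lipschitz_on_inner_bounded:
  fixes f g :: "'a::metric_space \<Rightarrow> 'b::real_inner"
  assumes f: "L-lipschitz_on X f" "\<And>x. x \<in> X \<Longrightarrow> norm (f x) \<le> A"
    and g: "M-lipschitz_on X g" "\<And>x. x \<in> X \<Longrightarrow> norm (g x) \<le> B"
    and A0: "0 \<le> A" and B0: "0 \<le> B"
  shows "(A * M + L * B)-lipschitz_on X (\<lambda>x. f x \<bullet> g x)"
proof (rule lipschitz_onI)
  show "0 \<le> A * M + L * B"
    using lipschitz_on_nonneg[OF f(1)] lipschitz_on_nonneg[OF g(1)] A0 B0 by simp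
  fix x y assume xy: "x \<in> X" "y \<in> X"
  have "f x \<bullet> g x - f y \<bullet> g y = f x \<bullet> (g x - g y) + (f x - f y) \<bullet> g y"
    by (simp add: inner_diff_left inner_diff_right)
  then have "\<bar>f x \<bullet> g x - f y \<bullet> g y\<bar> \<le> norm (f x) * norm (g x - g y) + norm (f x - f y) * norm (g y)"
    using Cauchy_Schwarz_ineq2[of "f x" "g x - g y"] Cauchy_Schwarz_ineq2[of "f x - f y" "g y"] by linarith
  also have "\<dots> \<le> A * (M * dist x y) + (L * dist x y) * B"
    using lipschitz_onD[OF f(1) xy] lipschitz_onD[OF g(1) xy] f(2)[OF xy(1)] g(2)[OF xy(2)] A0 lipschitz_on_nonneg[OF f(1)]
    by (intro add_mono mult_mono) (simp_all add: dist_norm)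
  finally show "dist (f x \<bullet> g x) (f y \<bullet> g y) \<le> (A * M + L * B) * dist x y"
    by (simp add: dist_real_def algebra_simps)
qed

lemma lipschitz_on_compact_bounded:
  fixes f :: "'a::metric_space \<Rightarrow> 'b::real_normed_vector"
  assumes "compact K" "L-lipschitz_on K f"
  obtains B where "0 \<le> B" "\<And>x. x \<in> K \<Longrightarrow> norm (f x) \<le> B"
proof -
  have "bounded (f ` K)"
    by (rule compact_imp_bounded[OF compact_continuous_image[OF lipschitz_on_continuous_on[OF assms(2)] assms(1)]])
  then obtain B where "B > 0" "\<forall>x\<in>K. norm (f x) \<le> B" by (auto simp: bounded_pos)
  then show ?thesis by (intro that[of B]) auto
qed

text \<open>The McShane formula \<open>INF y\<in>S. f y + L * dist x y\<close> extends \<open>f\<close> with the same Lipschitz constant.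
  Truncation at \<open>\<plusminus> B\<close> makes the extension bounded, which is needed to multiply it with a cutoff function.\<close>

lemma McShane_extension:
  fixes f :: "'a::metric_space \<Rightarrow> real"
  assumes f: "L-lipschitz_on S f" and B: "\<And>x. x \<in> S \<Longrightarrow> \<bar>f x\<bar> \<le> B" and S: "S \<noteq> {}"
  obtains g where "L-lipschitz_on UNIV g" "\<And>x. x \<in> S \<Longrightarrow> g x = f x" "\<And>x. \<bar>g x\<bar> \<le> B"
proof -
  have L0: "0 \<le> L" using f by (rule lipschitz_on_nonneg)
  define h where "h x = (INF y\<in>S. f y + L * dist x y)" for x
  have bdd: "bdd_below ((\<lambda>y. f y + L * dist x y) ` S)" for x
  proof (rule bdd_belowI2)
    fix y assume "y \<in> S"
    then have "- B \<le> f y" using B[of y] by linarith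
    moreover have "0 \<le> L * dist x y" using L0 by simp
    ultimately show "- B \<le> f y + L * dist x y" by linarith
  qed
  have hle: "h x \<le> h z + L * dist x z" for x z
  proof -
    have "h x - L * dist x z \<le> h z"
      unfolding h_def[of z]
    proof (rule cINF_greatest[OF S])
      fix y assume y: "y \<in> S"
      have "h x \<le> f y + L * dist x y" unfolding h_def by (rule cINF_lower[OF bdd y])
      also have "\<dots> \<le> f y + L * (dist x z + dist z y)"
        using L0 by (intro add_left_mono mult_left_mono dist_triangle)
      finally show "h x - L * dist x z \<le> f y + L * dist z y" by (simp add: algebra_simps)
    qed
    then show ?thesis by simp
  qed
  have heq: "h x = f x" if x: "x \<in> S" for x
  proof (rule antisym)
    show "h x \<le> f x" using cINF_lower[OF bdd x, of x] by (simp add: h_def)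
    show "f x \<le> h x"
      unfolding h_def
    proof (rule cINF_greatest[OF S])
      fix y assume "y \<in> S"
      then show "f x \<le> f y + L * dist x y"
        using lipschitz_onD[OF f x, of y] by (simp add: dist_real_def abs_le_iff)
    qed
  qed
  obtain s where "s \<in> S" using S by auto
  then have B0: "0 \<le> B" using B[of s] by linarith
  define g where "g x = max (- B) (min B (h x))" for x
  show ?thesis
  proof (rule that[of g])
    show "L-lipschitz_on UNIV g"
    proof (rule lipschitz_onI[OF _ L0])
      fix x z
      have "\<bar>h x - h z\<bar> \<le> L * dist x z" using hle[of x z] hle[of z x] by (simp add: dist_commute)
      then show "dist (g x) (g z) \<le> L * dist x z"
        using B0 by (simp add: g_def dist_real_def max_def min_def abs_if split: if_splits)
    qed
    show "g x = f x" if "x \<in> S" for x using heq[OF that] B[OF that] by (simp add: g_def)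
    show "\<bar>g x\<bar> \<le> B" for x using B0 by (simp add: g_def)
  qed
qed

lemma lipschitz_on_vecI:
  fixes f :: "'a::metric_space \<Rightarrow> real^'n"
  assumes "\<And>i. (L i)-lipschitz_on X (\<lambda>x. f x $ i)"
  shows "(\<Sum>i\<in>UNIV. L i)-lipschitz_on X f"
proof (rule lipschitz_onI)
  show "0 \<le> (\<Sum>i\<in>UNIV. L i)" by (intro sum_nonneg lipschitz_on_nonneg[OF assms])
  fix x y assume xy: "x \<in> X" "y \<in> X"
  have "dist (f x) (f y) \<le> (\<Sum>i\<in>UNIV. \<bar>(f x - f y) $ i\<bar>)" unfolding dist_norm by (rule norm_le_l1_cart)
  also have "\<dots> \<le> (\<Sum>i\<in>UNIV. L i * dist x y)"
    using lipschitz_onD[OF assms xy] by (intro sum_mono) (simp add: dist_real_def)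
  finally show "dist (f x) (f y) \<le> (\<Sum>i\<in>UNIV. L i) * dist x y" by (simp add: sum_distrib_right)
qed

lemma Lip_c_extension:
  assumes K: "compact K" and \<Omega>: "open \<Omega>" "K \<subseteq> \<Omega>" and \<phi>: "\<phi> \<in> Lip K"
  shows "\<exists>\<psi>\<in>Lip_c \<Omega>. \<forall>x\<in>K. \<psi> x = \<phi> x"
proof (cases "K = {}")
  case True
  have "(\<lambda>x. 0) \<in> Lip_c \<Omega>"
    by (auto simp: Lip_c_def compactly_supported_in_def intro!: exI[of _ 0] lipschitz_on_constant)
  then show ?thesis using True by (intro bexI[of _ "\<lambda>x. 0"]) auto
next
  case False
  obtain L where L: "L-lipschitz_on K \<phi>" using \<phi> by (auto simp: Lip_def)
  obtain B where B: "0 \<le> B" "\<And>x. x \<in> K \<Longrightarrow> norm (\<phi> x) \<le> B"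
    using lipschitz_on_compact_bounded[OF K L] by metis
  have "\<exists>g. L-lipschitz_on UNIV g \<and> (\<forall>x\<in>K. g x = \<phi> x $ i) \<and> (\<forall>x. \<bar>g x\<bar> \<le> B)" for i
  proof (rule McShane_extension[OF _ _ False])
    show "L-lipschitz_on K (\<lambda>x. \<phi> x $ i)"
    proof (rule lipschitz_onI)
      fix x y assume "x \<in> K" "y \<in> K"
      then show "dist (\<phi> x $ i) (\<phi> y $ i) \<le> L * dist x y"
        using lipschitz_onD[OF L, of x y] dist_vec_nth_le[of "\<phi> x" i "\<phi> y"] by linarith
    qed (rule lipschitz_on_nonneg[OF L])
    show "\<bar>\<phi> x $ i\<bar> \<le> B" if "x \<in> K" for x
      using B(2)[OF that] component_le_norm_cart[of "\<phi> x" i] by linarith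
  qed blast
  then obtain g where g: "\<And>i. L-lipschitz_on UNIV (g i)" "\<And>i x. x \<in> K \<Longrightarrow> g i x = \<phi> x $ i" "\<And>i x. \<bar>g i x\<bar> \<le> B"
    by metis
  define G where "G x = (\<chi> i. g i x)" for x
  have GL: "(\<Sum>i\<in>(UNIV::3 set). L)-lipschitz_on UNIV G"
    by (rule lipschitz_on_vecI) (simp add: G_def g)
  have GK: "G x = \<phi> x" if "x \<in> K" for x using g(2)[OF that] by (simp add: G_def vec_eq_iff)
  have GB: "norm (G x) \<le> 3 * B" for x
  proof -
    have "norm (G x) \<le> (\<Sum>i\<in>UNIV. \<bar>G x $ i\<bar>)" by (rule norm_le_l1_cart)
    also have "\<dots> \<le> (\<Sum>i\<in>(UNIV::3 set). B)" by (intro sum_mono) (simp add: G_def g)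
    finally show ?thesis by simp
  qed
  obtain \<rho> where \<rho>: "\<rho> > 0" "(\<Union>x\<in>K. cball x \<rho>) \<subseteq> \<Omega>"
    using compact_subset_open_imp_cball_epsilon_subset[OF K \<Omega>] by metis
  define \<eta> where "\<eta> x = 1 - cutoff K \<rho> x" for x
  have \<eta>L: "(1 / \<rho>)-lipschitz_on UNIV \<eta>"
    using cutoff_lipschitz[OF \<rho>(1), of K] unfolding lipschitz_on_def \<eta>_def by (simp add: dist_real_def abs_minus_commute)
  have \<eta>B: "\<bar>\<eta> x\<bar> \<le> 1" for x
    using cutoff_bounds(1)[OF \<rho>(1), of K x] cutoff_bounds(2)[of K \<rho> x] by (simp add: \<eta>_def)
  have lip: "(1 * (\<Sum>i\<in>(UNIV::3 set). L) + 1 / \<rho> * (3 * B))-lipschitz_on UNIV (\<lambda>x. \<eta> x *\<^sub>R G x)"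
    by (rule lipschitz_on_scaleR_bounded[OF \<eta>L \<eta>B GL GB]) simp
  define T where "T = {x + y |x y. x \<in> K \<and> y \<in> cball 0 \<rho>}"
  have T: "compact T" unfolding T_def by (intro compact_sums K compact_cball)
  have T\<Omega>: "T \<subseteq> \<Omega>"
  proof
    fix w assume "w \<in> T"
    then obtain x y where "w = x + y" "x \<in> K" "norm y \<le> \<rho>" by (auto simp: T_def)
    then have "x \<in> K" "w \<in> cball x \<rho>" by (simp_all add: dist_norm)
    then have "w \<in> (\<Union>x\<in>K. cball x \<rho>)" by blast
    then show "w \<in> \<Omega>" using \<rho>(2) by blast
  qed
  have "{x. \<eta> x *\<^sub>R G x \<noteq> 0} \<subseteq> T"
  proof
    fix x assume "x \<in> {x. \<eta> x *\<^sub>R G x \<noteq> 0}"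
    then have "infdist x K < \<rho>" using \<rho>(1) by (auto simp: \<eta>_def cutoff_def min_def split: if_splits)
    moreover obtain y where y: "y \<in> K" "infdist x K = dist x y"
      using infdist_attains_inf[OF compact_imp_closed[OF K] False] by metis
    ultimately have "x = y + (x - y)" "x - y \<in> cball 0 \<rho>" by (simp_all add: dist_norm norm_minus_commute)
    then show "x \<in> T" using y(1) unfolding T_def by blast
  qed
  then have "compactly_supported_in \<Omega> (\<lambda>x. \<eta> x *\<^sub>R G x)"
    by (rule compactly_supported_inI[OF T T\<Omega>])
  then have "(\<lambda>x. \<eta> x *\<^sub>R G x) \<in> Lip_c \<Omega>" using lip by (auto simp: Lip_c_def)
  moreover have "\<eta> x *\<^sub>R G x = \<phi> x" if "x \<in> K" for x
    using that by (simp add: \<eta>_def cutoff_def GK)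
  ultimately show ?thesis by (intro bexI[of _ "\<lambda>x. \<eta> x *\<^sub>R G x"]) auto
qed

section \<open>Interior and exterior traces\<close>

lemma nearest_point_in_frontier:
  fixes x y :: "'a::real_normed_vector"
  assumes x: "x \<notin> C" and y: "y \<in> C" "infdist x C = dist x y"
  shows "y \<in> frontier C"
proof -
  have "y \<notin> interior C"
  proof
    assume "y \<in> interior C"
    then obtain \<epsilon> where \<epsilon>: "\<epsilon> > 0" "ball y \<epsilon> \<subseteq> C" by (auto simp: mem_interior)
    have ne: "norm (x - y) > 0" using x y by auto
    define s where "s = min 1 (\<epsilon> / (2 * norm (x - y)))"
    have s: "0 < s" "s \<le> 1" using \<epsilon> ne by (simp_all add: s_def)
    have "s * norm (x - y) \<le> \<epsilon> / (2 * norm (x - y)) * norm (x - y)"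
      using ne by (intro mult_right_mono) (simp_all add: s_def)
    also have "\<dots> < \<epsilon>" using \<epsilon> ne by simp
    finally have "y + s *\<^sub>R (x - y) \<in> ball y \<epsilon>" using s by (simp add: dist_norm)
    then have "infdist x C \<le> dist x (y + s *\<^sub>R (x - y))" using \<epsilon>(2) by (intro infdist_le) blast
    also have "x - (y + s *\<^sub>R (x - y)) = (1 - s) *\<^sub>R (x - y)" by (simp add: algebra_simps)
    then have "dist x (y + s *\<^sub>R (x - y)) = (1 - s) * norm (x - y)" using s by (simp add: dist_norm)
    finally show False using y mult_pos_pos[OF s(1) ne] by (simp add: dist_norm algebra_simps)
  qed
  then show ?thesis using y(1) closure_subset[of C] by (auto simp: frontier_def)
qed

text \<open>Along a curve in \<open>S\<close> through the nearest point \<open>y\<close> the squared distance to \<open>x\<close> has a minimum at \<open>y\<close>.\<close>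

lemma nearest_point_orthogonal_to_tangent_space:
  fixes x y :: "real^3"
  assumes y: "infdist x C = dist x y" and S: "S \<subseteq> C" and v: "v \<in> tangent_space S y"
  shows "(x - y) \<bullet> v = 0"
proof -
  obtain c where c0: "c 0 = y" and cS: "eventually (\<lambda>t. c t \<in> S) (at 0)" and cd: "(c has_vector_derivative v) (at 0)"
    using v by (auto simp: tangent_space_def curve_through_def)
  have d: "((\<lambda>t. x - c t) has_derivative (\<lambda>t. - (t *\<^sub>R v))) (at 0)"
    using cd unfolding has_vector_derivative_def by (auto intro!: derivative_eq_intros)
  have "((\<lambda>t. (x - c t) \<bullet> (x - c t)) has_derivative (\<lambda>t. (- 2 * ((x - y) \<bullet> v)) * t)) (at 0)"
    using has_derivative_inner[OF d d] by (simp add: c0 inner_commute[of v] algebra_simps)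
  then have "DERIV (\<lambda>t. (x - c t) \<bullet> (x - c t)) 0 :> - 2 * ((x - y) \<bullet> v)"
    by (simp only: has_field_derivative_def)
  moreover obtain \<delta> where \<delta>: "\<delta> > 0" "\<And>t. t \<noteq> 0 \<Longrightarrow> dist t 0 < \<delta> \<Longrightarrow> c t \<in> S"
    using cS unfolding eventually_at by auto
  moreover have "(x - c 0) \<bullet> (x - c 0) \<le> (x - c t) \<bullet> (x - c t)" if "\<bar>0 - t\<bar> < \<delta>" for t
  proof (cases "t = 0")
    case False
    then have "c t \<in> C" using \<delta>(2)[of t] that S by (auto simp: dist_real_def)
    then have "norm (x - c 0) \<le> norm (x - c t)"
      using infdist_le[of "c t" C x] y c0 by (simp add: dist_norm)
    then have "(norm (x - c 0))\<^sup>2 \<le> (norm (x - c t))\<^sup>2" by (intro power_mono) auto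
    then show ?thesis by (simp only: power2_norm_eq_inner)
  qed simp
  ultimately have "- 2 * ((x - y) \<bullet> v) = 0"
    by (intro DERIV_local_min[of _ _ 0 \<delta>]) auto
  then show ?thesis by simp
qed

lemma Lip_c_ext_cong:
  assumes "\<And>x. x \<in> frontier U \<Longrightarrow> \<phi> x = \<phi>' x"
  shows "Lip_c_ext \<Omega> U \<phi> = Lip_c_ext \<Omega> U \<phi>'"
proof -
  have "(\<psi> \<in> Lip_c \<Omega> \<and> (\<forall>x\<in>frontier U. \<psi> x = \<phi> x)) = (\<psi> \<in> Lip_c \<Omega> \<and> (\<forall>x\<in>frontier U. \<psi> x = \<phi>' x))" for \<psi>
    using assms by auto
  then show ?thesis by (simp only: Lip_c_ext_def)
qed

locale trace_setup =
  fixes \<Omega> U :: "(real^3) set" and p :: real and F :: "real^3 \<Rightarrow> real^3"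
  assumes \<Omega>: "open \<Omega>" "bounded \<Omega>" and U: "open U" "compact (closure U)" "closure U \<subseteq> \<Omega>" "C2_boundary U"
    and p: "1 \<le> p" and F: "F \<in> CM p \<Omega>"
begin

lemma compact_frontier: "compact (frontier U)"
  using U(2) by (intro compact_frontier_bounded) (metis bounded_closure bounded_subset closure_subset compact_imp_bounded)

lemma frontier_subset: "frontier U \<subseteq> \<Omega>"
  using U(3) by (auto simp: frontier_def)

lemma curl_measure: "is_curl_measure \<Omega> F (curl_measure \<Omega> F)"
proof -
  have "\<exists>\<mu>. is_curl_measure \<Omega> F \<mu>" using F by (simp add: CM_def)
  then show ?thesis unfolding curl_measure_def by (rule someI_ex)
qed

lemma F_integrable: "set_integrable lebesgue \<Omega> F"
  by (rule CM_set_integrable[OF F p \<Omega>])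

lemma Lip_c_ext:
  assumes "\<phi> \<in> Lip (frontier U)"
  shows "Lip_c_ext \<Omega> U \<phi> \<in> Lip_c \<Omega>" "x \<in> frontier U \<Longrightarrow> Lip_c_ext \<Omega> U \<phi> x = \<phi> x"
proof -
  have "\<exists>\<psi>. \<psi> \<in> Lip_c \<Omega> \<and> (\<forall>x\<in>frontier U. \<psi> x = \<phi> x)"
    using Lip_c_extension[OF compact_frontier \<Omega>(1) frontier_subset assms] by auto
  from someI_ex[OF this] show "Lip_c_ext \<Omega> U \<phi> \<in> Lip_c \<Omega>" "x \<in> frontier U \<Longrightarrow> Lip_c_ext \<Omega> U \<phi> x = \<phi> x"
    by (simp_all add: Lip_c_ext_def)
qed

text \<open>Both traces are instances, with \<open>C = - U\<close> for the interior and \<open>C = closure U\<close> for the exterior one.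
  For \<open>x \<notin> C\<close> with nearest point \<open>y \<in> C\<close> the vector \<open>x - y\<close> is orthogonal to the tangent plane at \<open>y\<close>, hence
  parallel to the normal and to \<open>\<psi>\<^sub>1 y - \<psi>\<^sub>2 y\<close>. So the difference of the two fields has vanishing trace.\<close>

lemma one_sided_trace_eq:
  assumes C: "closed C" "frontier C \<subseteq> frontier U" "frontier U \<subseteq> C"
    and \<psi>: "\<psi>\<^sub>1 \<in> Lip_c \<Omega>" "\<psi>\<^sub>2 \<in> Lip_c \<Omega>"
    and normal: "\<And>y. y \<in> frontier U \<Longrightarrow> \<exists>a. \<psi>\<^sub>1 y - \<psi>\<^sub>2 y = a *\<^sub>R inner_normal U y"
  defines "\<mu> \<equiv> curl_measure \<Omega> F"
  shows "vector_integral \<Omega> \<mu> (\<Omega> - C) \<psi>\<^sub>1 - (LINT x:\<Omega> - C|lebesgue. F x \<bullet> curl \<psi>\<^sub>1 x)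
       = vector_integral \<Omega> \<mu> (\<Omega> - C) \<psi>\<^sub>2 - (LINT x:\<Omega> - C|lebesgue. F x \<bullet> curl \<psi>\<^sub>2 x)"
proof -
  have \<mu>: "is_curl_measure \<Omega> F \<mu>" unfolding \<mu>_def by (rule curl_measure)
  have A: "\<Omega> - C \<in> sets borel" "\<Omega> - C \<subseteq> \<Omega>" using \<Omega>(1) C(1) by auto
  define \<psi> where "\<psi> x = \<psi>\<^sub>1 x - \<psi>\<^sub>2 x" for x
  have main: "vector_integral \<Omega> \<mu> (\<Omega> - C) \<psi> = (LINT x:\<Omega> - C|lebesgue. F x \<bullet> curl \<psi> x)"
  proof (rule trace_of_normal_field_vanishes[OF \<mu> F_integrable \<Omega>(1) C(1)])
    show "\<psi> \<in> Lip_c \<Omega>" unfolding \<psi>_def by (rule Lip_c_diff[OF \<psi>])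
    fix x y assume x: "x \<notin> C" and y: "y \<in> C" "infdist x C = dist x y"
    have yf: "y \<in> frontier U" using nearest_point_in_frontier[OF x y] C(2) by blast
    obtain a where a: "\<psi> y = a *\<^sub>R inner_normal U y" using normal[OF yf] by (auto simp: \<psi>_def)
    let ?n = "inner_normal U y"
    have n1: "norm ?n = 1" by (rule norm_inner_normal[OF U(1,4) yf])
    define c where "c = ((x - y) \<bullet> ?n) / (?n \<bullet> ?n)"
    have xy: "x - y = c *\<^sub>R ?n"
      unfolding c_def
    proof (rule orthogonal_to_hyperplane_imp_parallel)
      show "?n \<noteq> 0" using n1 by auto
      show "(x - y) \<bullet> v = 0" if "?n \<bullet> v = 0" for v
        by (rule nearest_point_orthogonal_to_tangent_space[OF y(2) C(3)])
           (simp add: tangent_space_eq[OF U(1,4) yf] that)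
    qed
    have "c \<noteq> 0" using xy x y by auto
    then have "\<psi> y = (a / c) *\<^sub>R (x - y)" by (simp add: a xy)
    then show "\<exists>c. \<psi> y = c *\<^sub>R (x - y)" by blast
  qed
  obtain L1 K1 a1 b1 where L1: "L1-lipschitz_on UNIV \<psi>\<^sub>1" and K1: "\<And>x. norm (\<psi>\<^sub>1 x) \<le> K1"
    using Lip_cE[OF \<psi>(1)] by metis
  obtain L2 K2 a2 b2 where L2: "L2-lipschitz_on UNIV \<psi>\<^sub>2" and K2: "\<And>x. norm (\<psi>\<^sub>2 x) \<le> K2"
    using Lip_cE[OF \<psi>(2)] by metis
  have "vector_integral \<Omega> \<mu> (\<Omega> - C) \<psi> = vector_integral \<Omega> \<mu> (\<Omega> - C) \<psi>\<^sub>1 - vector_integral \<Omega> \<mu> (\<Omega> - C) \<psi>\<^sub>2"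
    unfolding \<psi>_def
  proof (rule vector_integral_diff[where K="max K1 K2"])
    show "vector_measure_on \<Omega> \<mu>" using \<mu> by (simp add: is_curl_measure_def)
    show "\<Omega> \<in> sets borel" using \<Omega> by simp
    show "norm (\<psi>\<^sub>1 x) \<le> max K1 K2" for x using K1[of x] by simp
    show "norm (\<psi>\<^sub>2 x) \<le> max K1 K2" for x using K2[of x] by simp
  qed (rule A Lip_c_borel_measurable[OF \<psi>(1)] Lip_c_borel_measurable[OF \<psi>(2)])+
  moreover have "(LINT x:\<Omega> - C|lebesgue. F x \<bullet> curl \<psi> x)
      = (LINT x:\<Omega> - C|lebesgue. F x \<bullet> curl \<psi>\<^sub>1 x) - (LINT x:\<Omega> - C|lebesgue. F x \<bullet> curl \<psi>\<^sub>2 x)"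
  proof -
    obtain M1 where c1: "curl \<psi>\<^sub>1 \<in> borel_measurable borel" "\<And>x. norm (curl \<psi>\<^sub>1 x) \<le> M1"
      using curl_Lip_c[OF \<psi>(1)] by metis
    obtain M2 where c2: "curl \<psi>\<^sub>2 \<in> borel_measurable borel" "\<And>x. norm (curl \<psi>\<^sub>2 x) \<le> M2"
      using curl_Lip_c[OF \<psi>(2)] by metis
    have i1: "set_integrable lebesgue (\<Omega> - C) (\<lambda>x. F x \<bullet> curl \<psi>\<^sub>1 x)"
      by (rule set_integrable_inner_bounded[OF F_integrable A c1])
    have i2: "set_integrable lebesgue (\<Omega> - C) (\<lambda>x. F x \<bullet> curl \<psi>\<^sub>2 x)"
      by (rule set_integrable_inner_bounded[OF F_integrable A c2])
    have m: "curl \<psi> \<in> borel_measurable borel"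
      unfolding \<psi>_def by (rule curl_Lip_c[OF Lip_c_diff[OF \<psi>]])
    have ae: "AE x in lebesgue. curl \<psi> x = curl \<psi>\<^sub>1 x - curl \<psi>\<^sub>2 x"
    proof -
      have "AE x in lebesgue. \<forall>i. partially_differentiable i \<psi>\<^sub>1 x \<and> partially_differentiable i \<psi>\<^sub>2 x"
        unfolding AE_all_countable
        by (intro allI AE_conjI AE_completion lipschitz_AE_partially_differentiable[OF L1]
            lipschitz_AE_partially_differentiable[OF L2])
      then show ?thesis
        unfolding \<psi>_def by eventually_elim (simp add: curl_difference)
    qed
    obtain M where M: "\<And>x. norm (curl \<psi> x) \<le> M"
      unfolding \<psi>_def by (rule curl_Lip_c[OF Lip_c_diff[OF \<psi>]]) blast
    have i: "set_integrable lebesgue (\<Omega> - C) (\<lambda>x. F x \<bullet> curl \<psi> x)"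
      by (rule set_integrable_inner_bounded[OF F_integrable A m M])
    have "(LINT x:\<Omega> - C|lebesgue. F x \<bullet> curl \<psi> x) = (LINT x:\<Omega> - C|lebesgue. F x \<bullet> curl \<psi>\<^sub>1 x - F x \<bullet> curl \<psi>\<^sub>2 x)"
      unfolding set_lebesgue_integral_def
    proof (rule integral_cong_AE)
      show "(\<lambda>x. indicat_real (\<Omega> - C) x *\<^sub>R (F x \<bullet> curl \<psi> x)) \<in> borel_measurable lebesgue"
        using i by (simp add: set_integrable_def borel_measurable_integrable)
      show "(\<lambda>x. indicat_real (\<Omega> - C) x *\<^sub>R (F x \<bullet> curl \<psi>\<^sub>1 x - F x \<bullet> curl \<psi>\<^sub>2 x)) \<in> borel_measurable lebesgue"
        using set_integral_diff(1)[OF i1 i2] by (simp only: set_integrable_def borel_measurable_integrable)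
      show "AE x in lebesgue. indicat_real (\<Omega> - C) x *\<^sub>R (F x \<bullet> curl \<psi> x) =
          indicat_real (\<Omega> - C) x *\<^sub>R (F x \<bullet> curl \<psi>\<^sub>1 x - F x \<bullet> curl \<psi>\<^sub>2 x)"
        using ae by eventually_elim (simp add: inner_diff_right)
    qed
    then show ?thesis by (simp only: set_integral_diff(2)[OF i1 i2])
  qed
  ultimately show ?thesis using main by linarith
qed

lemma trace_eq:
  assumes "\<phi>\<^sub>1 \<in> Lip (frontier U)" "\<phi>\<^sub>2 \<in> Lip (frontier U)"
    and normal: "\<And>y. y \<in> frontier U \<Longrightarrow> \<exists>a. \<phi>\<^sub>1 y - \<phi>\<^sub>2 y = a *\<^sub>R inner_normal U y"
  shows "trace_int \<Omega> F U \<phi>\<^sub>1 = trace_int \<Omega> F U \<phi>\<^sub>2" "trace_ext \<Omega> F U \<phi>\<^sub>1 = trace_ext \<Omega> F U \<phi>\<^sub>2"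
proof -
  note e = Lip_c_ext[OF assms(1)] Lip_c_ext[OF assms(2)]
  have n: "\<exists>a. Lip_c_ext \<Omega> U \<phi>\<^sub>1 y - Lip_c_ext \<Omega> U \<phi>\<^sub>2 y = a *\<^sub>R inner_normal U y" if "y \<in> frontier U" for y
    using normal[OF that] e(2,4)[OF that] by simp
  have "\<Omega> - (- U) = U" using U(3) closure_subset[of U] by auto
  moreover have "frontier U \<subseteq> - U" using U(1) by (auto simp: frontier_def interior_open)
  ultimately show "trace_int \<Omega> F U \<phi>\<^sub>1 = trace_int \<Omega> F U \<phi>\<^sub>2"
    using one_sided_trace_eq[of "- U", OF _ _ _ e(1,3) n] U(1)
    by (simp add: trace_int_def Let_def frontier_complement closed_Compl)
  have "frontier (closure U) \<subseteq> frontier U" 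
    using interior_mono[OF closure_subset[of U]] by (auto simp: frontier_def)
  moreover have "frontier U \<subseteq> closure U" by (auto simp: frontier_def)
  ultimately show "trace_ext \<Omega> F U \<phi>\<^sub>1 = trace_ext \<Omega> F U \<phi>\<^sub>2"
    using one_sided_trace_eq[of "closure U", OF closed_closure _ _ e(1,3) n]
    by (simp add: trace_ext_def Let_def)
qed

text \<open>This provides the Lipschitz extension on which the trace of \<open>tangential_part U \<phi>\<close> is evaluated. It rests
  on the Lipschitz continuity of the normal and thus on the second derivatives of the charts.\<close>

lemma tangential_part_Lip:
  assumes \<phi>: "\<phi> \<in> Lip (frontier U)"
  shows "tangential_part U \<phi> \<in> Lip (frontier U)"
proof (cases "frontier U = {}")
  case True
  then show ?thesis by (auto simp: Lip_def intro: exI[of _ 0])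
next
  case False
  obtain L where L: "L-lipschitz_on (frontier U) \<phi>" using \<phi> by (auto simp: Lip_def)
  obtain B where B: "0 \<le> B" "\<And>x. x \<in> frontier U \<Longrightarrow> norm (\<phi> x) \<le> B"
    using lipschitz_on_compact_bounded[OF compact_frontier L] by metis
  have n1: "norm (inner_normal U x) \<le> 1" if "x \<in> frontier U" for x
    using norm_inner_normal[OF U(1,4) that] by simp
  obtain M where M: "M-lipschitz_on (frontier U) (inner_normal U)"
    using locally_lipschitz_compact_imp_lipschitz[OF compact_frontier n1 inner_normal_locally_lipschitz[OF U(1,4)]]
    by auto
  have ip: "(B * M + L * 1)-lipschitz_on (frontier U) (\<lambda>x. \<phi> x \<bullet> inner_normal U x)"
    by (rule lipschitz_on_inner_bounded[OF L B(2) M n1 B(1)]) auto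
  have ipB: "\<bar>\<phi> x \<bullet> inner_normal U x\<bar> \<le> B" if "x \<in> frontier U" for x
    using Cauchy_Schwarz_ineq2[of "\<phi> x" "inner_normal U x"] norm_inner_normal[OF U(1,4) that] B(2)[OF that] by simp
  have "(B * M + (B * M + L * 1) * 1)-lipschitz_on (frontier U) (\<lambda>x. (\<phi> x \<bullet> inner_normal U x) *\<^sub>R inner_normal U x)"
    by (rule lipschitz_on_scaleR_bounded[OF ip ipB M n1 False])
  from lipschitz_on_diff[OF L this] show ?thesis
    unfolding Lip_def tangential_part_def[abs_def] by blast
qed

text \<open>Along boundary curves \<open>\<phi>\<close> agrees with \<open>\<Phi>\<close>, so \<open>grad \<Phi>\<close> represents the differential of \<open>\<phi>\<close> on the tangent
  plane; removing its normal component does not change this and makes it tangential.\<close>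

lemma tangential_grad_eq:
  assumes \<Phi>: "C2_extension (frontier U) \<phi> \<Phi>" and y: "y \<in> frontier U"
  shows "tangential_grad (frontier U) \<phi> y = tangential_part U (grad \<Phi>) y"
proof -
  let ?n = "inner_normal U y" and ?g = "tangential_part U (grad \<Phi>) y"
  have n1: "?n \<bullet> ?n = 1"
    using norm_inner_normal[OF U(1,4) y] by (simp add: norm_eq_1)
  have tan: "v \<in> tangent_space (frontier U) y \<longleftrightarrow> ?n \<bullet> v = 0" for v
    by (simp add: tangent_space_eq[OF U(1,4) y])
  have gt: "?g \<in> tangent_space (frontier U) y"
    unfolding tan by (simp add: tangential_part_def inner_diff_right n1 inner_commute)
  have \<Phi>d: "\<Phi> differentiable (at y)" using \<Phi> by (simp add: C2_extension_def numeral_2_eq_2)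
  have der: "((\<lambda>t. \<phi> (c t)) has_real_derivative ?g \<bullet> v) (at 0)"
    if c: "curve_through (frontier U) y v c" for v c
  proof -
    have c0: "c 0 = y" and cf: "eventually (\<lambda>t. c t \<in> frontier U) (at 0)" and cd: "(c has_vector_derivative v) (at 0)"
      using c by (auto simp: curve_through_def)
    have nv: "?n \<bullet> v = 0" using tan[of v] c by (auto simp: tangent_space_def)
    have gv: "?g \<bullet> v = grad \<Phi> y \<bullet> v" by (simp add: tangential_part_def inner_diff_left nv)
    have "((\<lambda>t. \<Phi> (c t)) has_derivative (\<lambda>t. \<Sum>i\<in>UNIV. (t *\<^sub>R v) $ i *\<^sub>R partial_deriv i \<Phi> y)) (at 0)"
      by (rule has_derivative_compose[OF cd[unfolded has_vector_derivative_def]])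
         (simp only: c0 differentiable_has_derivative[OF \<Phi>d])
    moreover have "(\<Sum>i\<in>UNIV. (t *\<^sub>R v) $ i *\<^sub>R partial_deriv i \<Phi> y) = (?g \<bullet> v) * t" for t :: real
      unfolding gv by (simp add: inner_vec_def grad_def sum_distrib_left sum_distrib_right algebra_simps)
    ultimately have D: "((\<lambda>t. \<Phi> (c t)) has_derivative (\<lambda>t. (?g \<bullet> v) * t)) (at 0)" by simp
    have "((\<lambda>t. \<phi> (c t)) has_derivative (\<lambda>t. (?g \<bullet> v) * t)) (at 0)"
    proof (rule has_derivative_transform_eventually[OF D])
      show "eventually (\<lambda>t. \<Phi> (c t) = \<phi> (c t)) (at 0)"
        using cf by eventually_elim (use \<Phi> in \<open>simp add: C2_extension_def\<close>)
      show "\<Phi> (c 0) = \<phi> (c 0)" using \<Phi> y by (simp add: C2_extension_def c0)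
    qed simp
    then show ?thesis by (simp add: has_field_derivative_def)
  qed
  show ?thesis
    unfolding tangential_grad_def
  proof (rule the_equality)
    show "?g \<in> tangent_space (frontier U) y \<and>
        (\<forall>v c. curve_through (frontier U) y v c \<longrightarrow> ((\<lambda>t. \<phi> (c t)) has_real_derivative ?g \<bullet> v) (at 0))"
      using gt der by blast
    fix g assume g: "g \<in> tangent_space (frontier U) y \<and>
        (\<forall>v c. curve_through (frontier U) y v c \<longrightarrow> ((\<lambda>t. \<phi> (c t)) has_real_derivative g \<bullet> v) (at 0))"
    have "g - ?g \<in> tangent_space (frontier U) y"
      using g gt unfolding tan by (simp add: inner_diff_right)
    then obtain c where c: "curve_through (frontier U) y (g - ?g) c" by (auto simp: tangent_space_def)
    have "g \<bullet> (g - ?g) = ?g \<bullet> (g - ?g)"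
      using DERIV_unique[OF _ der[OF c]] g c by blast
    then have "(g - ?g) \<bullet> (g - ?g) = 0" by (simp add: inner_diff_left)
    then show "g = ?g" by simp
  qed
qed

lemma grad_Lip:
  assumes "C2_extension S \<phi> \<Phi>" and S: "compact S"
  shows "grad \<Phi> \<in> Lip S"
proof -
  have C: "Ck_on (Suc 0) UNIV (partial_deriv i \<Phi>)" for i
    using assms(1) by (simp add: C2_extension_def numeral_2_eq_2)
  obtain a R where ab: "S \<subseteq> cball a R" using compact_imp_bounded[OF S] bounded_subset_cball by blast
  have "\<exists>L. L-lipschitz_on S (partial_deriv i \<Phi>)" for i
    using Ck1_lipschitz_on_cball[OF C, of a R i] lipschitz_on_subset[OF _ ab] by blast
  then obtain L where L: "\<And>i. (L i)-lipschitz_on S (partial_deriv i \<Phi>)" by metis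
  have "(\<Sum>i\<in>UNIV. L i)-lipschitz_on S (grad \<Phi>)"
    by (rule lipschitz_on_vecI) (simp add: grad_def L)
  then show ?thesis by (auto simp: Lip_def)
qed

lemma trace_tangential_part:
  assumes "\<phi> \<in> Lip (frontier U)"
  shows "trace_int \<Omega> F U \<phi> = trace_int \<Omega> F U (tangential_part U \<phi>)"
    "trace_ext \<Omega> F U \<phi> = trace_ext \<Omega> F U (tangential_part U \<phi>)"
  by (rule trace_eq[OF assms tangential_part_Lip[OF assms]]; force simp: tangential_part_def)+

text \<open>The tangential gradient agrees with \<open>tangential_part U (grad \<Phi>)\<close> on the boundary only, which is
  enough because the chosen extension depends on nothing but the boundary values.\<close>

lemma trace_tangential_grad:
  assumes "C2_extension (frontier U) \<phi> \<Phi>"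
  shows "trace_int \<Omega> F U (grad \<Phi>) = trace_int \<Omega> F U (tangential_grad (frontier U) \<phi>)"
    "trace_ext \<Omega> F U (grad \<Phi>) = trace_ext \<Omega> F U (tangential_grad (frontier U) \<phi>)"
proof -
  have "Lip_c_ext \<Omega> U (tangential_grad (frontier U) \<phi>) = Lip_c_ext \<Omega> U (tangential_part U (grad \<Phi>))"
    by (rule Lip_c_ext_cong) (rule tangential_grad_eq[OF assms])
  then show "trace_int \<Omega> F U (grad \<Phi>) = trace_int \<Omega> F U (tangential_grad (frontier U) \<phi>)"
    "trace_ext \<Omega> F U (grad \<Phi>) = trace_ext \<Omega> F U (tangential_grad (frontier U) \<phi>)"
    using trace_tangential_part[OF grad_Lip[OF assms compact_frontier]]
    by (simp_all only: trace_int_def trace_ext_def)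
qed

end

theorem theorem7p11:
  fixes \<Omega> \<Omega>' :: "(real^3) set" and p :: real and F :: "real^3 \<Rightarrow> real^3"
  assumes "open \<Omega>" and "bounded \<Omega>"
    and "open \<Omega>'" and "compact (closure \<Omega>')" and "closure \<Omega>' \<subseteq> \<Omega>" and "C2_boundary \<Omega>'"
    and "1 \<le> p" and "F \<in> CM p \<Omega>"
  shows "(\<forall>\<phi>\<in>Lip (frontier \<Omega>').
            trace_int \<Omega> F \<Omega>' \<phi> = trace_int \<Omega> F \<Omega>' (tangential_part \<Omega>' \<phi>)) \<and>
         (\<forall>\<phi> \<Phi>. C2_extension (frontier \<Omega>') \<phi> \<Phi> \<longrightarrow>
            trace_int \<Omega> F \<Omega>' (grad \<Phi>) = trace_int \<Omega> F \<Omega>' (tangential_grad (frontier \<Omega>') \<phi>)) \<and>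
         (\<forall>\<phi>\<in>Lip (frontier \<Omega>').
            trace_ext \<Omega> F \<Omega>' \<phi> = trace_ext \<Omega> F \<Omega>' (tangential_part \<Omega>' \<phi>)) \<and>
         (\<forall>\<phi> \<Phi>. C2_extension (frontier \<Omega>') \<phi> \<Phi> \<longrightarrow>
            trace_ext \<Omega> F \<Omega>' (grad \<Phi>) = trace_ext \<Omega> F \<Omega>' (tangential_grad (frontier \<Omega>') \<phi>))"
proof -
  interpret trace_setup \<Omega> \<Omega>' p F by unfold_locales (fact assms)+
  show ?thesis using trace_tangential_part trace_tangential_grad by blast
qed

end
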